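(* Let $f$ be a harmonic map with $z_0$ a smooth critical point. Let $m$ be the order of $f$ at $z_0$, and let $j$ be the integer such that the critical value curve $\beta$ at $z_0$ has the order-pair $(j,j+1)$ (in its natural parametrization, of order $j$). Assume $j<\infty$. Let $n^+,n^-$ be defined by the following table: - $m$ odd, $j$ odd ($\beta$ convex): $(2n^+-1,2n^--1)=(m,m)$; - $m$ odd, $j$ even ($\beta$ cusp): $(2n^+-1,2n^--1)=(m+2,m)$ or $(m,m+2)$; - $m$ even, $j$ odd ($\beta$ convex): $(2n^+-1,2n^--1)=(m+1,m-1)$ or $(m-1,m+1)$; - $m$ even, $j$ even ($\beta$ cusp): $(2n^+-1,2n^--1)=(m+1,m+1)$. Set $$R_{n^+,n^-}(re^{i\theta})=\begin{cases} re^{i(2n^+-1)\theta} & 0\le\theta\le\pi,\\ re^{-i(2n^--1)\theta} & \pi\le\theta\le2\pi.\end{cases}$$ Then one of the choices of $R_{n^+,n^-}$ (the choice is unique if $m+j$ is even) is a local topological model of $f$ in the following sense: there are a neighborhood $U$ of $z_0$ and two orientation preserving homeomorphisms $h_1:U\to\mathbb D$, $z_0\mapsto0$, and $h_2:\mathbb C\to\mathbb C$, $f(z_0)\mapsto0$, such that $$h_2\circ f\circ h_1^{-1}(z)=R_{n^+,n^-}(z).$$ Moreover $\#(f|_U)^{-1}(z)=n^++n^-$ or $n^++n^--2$ depending on whether $z$ is in one sector or the other of $f(U)\smallsetminus\beta$.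
   Context: $\mathbb D$ is the unit disc. A planar harmonic map is a map from an open subset of $\mathbb C=\mathbb R^2$ to $\mathbb C$ whose two real components are harmonic; locally $f=p+\overline q$ with $p,q$ holomorphic. $J_f$ is the Jacobian determinant, $\mathcal C_f=\{J_f=0\}$. A point $z_0\in\mathcal C_f$ is a smooth critical point if $\mathcal C_f$ is a 1-dimensional submanifold near $z_0$. The order of an analytic map at $a$ is the lowest total degree of a nonzero monomial in the Taylor expansions at $a$ of the components of $f-f(a)$. At a smooth critical point, $\psi=p'/q'$ extends holomorphically with $|\psi(z_0)|=1$, $\psi'(z_0)\neq0$, and $\mathcal C_f=\psi^{-1}(S^1)$ near $z_0$. The natural parametrization of $\mathcal C_f$ is $\gamma(t)=\psi^{-1}(\psi(z_0)e^{it})$, $\gamma(0)=z_0$, and that of the critical value curve is $\beta(t)=f(\gamma(t))$. The integer $j$ (the critical value order) is the order of $\beta$ at $t=0$, with $j=\infty$ if $\beta$ is constant. A planar analytic curve $\beta$ has order-pair $(j,k)$ at $\beta(0)$ if up to reparametrization in the source and analytic change of coordinates in the range it takes the form $\beta(s)=\beta(0)+(Cs^j+\text{higher order terms},\,C's^k+\text{higher order terms})$ with $CC'\neq0$. The critical value curve is locally convex when $j$ is odd and a cusp when $j$ is even. *)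

theory Defs
  imports "HOL-Complex_Analysis.Complex_Analysis" "HOL-Library.Extended_Nat"
begin

definition pdx :: "(complex \<Rightarrow> 'a::real_normed_vector) \<Rightarrow> complex \<Rightarrow> 'a" where
  "pdx u z = vector_derivative (\<lambda>t. u (z + of_real t)) (at 0)"

definition pdy :: "(complex \<Rightarrow> 'a::real_normed_vector) \<Rightarrow> complex \<Rightarrow> 'a" where
  "pdy u z = vector_derivative (\<lambda>t. u (z + \<i> * of_real t)) (at 0)"

definition C1_on :: "('a::real_normed_vector \<Rightarrow> 'b::real_normed_vector) \<Rightarrow> 'a set \<Rightarrow> bool" where
  "C1_on g S \<longleftrightarrow>
     (\<exists>D. continuous_on S D \<and> (\<forall>x\<in>S. (g has_derivative blinfun_apply (D x)) (at x)))"

definition harmonic_fun_on :: "(complex \<Rightarrow> real) \<Rightarrow> complex set \<Rightarrow> bool" where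
  "harmonic_fun_on u S \<longleftrightarrow>
     open S \<and> C1_on u S \<and> C1_on (pdx u) S \<and> C1_on (pdy u) S \<and>
     (\<forall>z\<in>S. pdx (pdx u) z + pdy (pdy u) z = 0)"

definition harmonic_map_on :: "(complex \<Rightarrow> complex) \<Rightarrow> complex set \<Rightarrow> bool" where
  "harmonic_map_on f S \<longleftrightarrow>
     harmonic_fun_on (\<lambda>z. Re (f z)) S \<and> harmonic_fun_on (\<lambda>z. Im (f z)) S"

definition jacobian :: "(complex \<Rightarrow> complex) \<Rightarrow> complex \<Rightarrow> real" where
  "jacobian f z = Re (pdx f z) * Im (pdy f z) - Re (pdy f z) * Im (pdx f z)"

definition critical_set :: "(complex \<Rightarrow> complex) \<Rightarrow> complex set \<Rightarrow> complex set" where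
  "critical_set f S = {z\<in>S. jacobian f z = 0}"

(* Submanifold of class C^1, described by a straightening chart of the ambient plane.
   For critical sets of planar harmonic maps this is the same as C^infinity or analytic. *)
definition curve_submanifold_at :: "complex set \<Rightarrow> complex \<Rightarrow> bool" where
  "curve_submanifold_at C a \<longleftrightarrow>
     (\<exists>U V \<Phi> \<Psi>. open U \<and> a \<in> U \<and> open V \<and> homeomorphism U V \<Phi> \<Psi> \<and>
        C1_on \<Phi> U \<and> C1_on \<Psi> V \<and> \<Phi> ` (C \<inter> U) = {w\<in>V. Im w = 0})"

definition smooth_critical_point ::
    "(complex \<Rightarrow> complex) \<Rightarrow> complex set \<Rightarrow> complex \<Rightarrow> bool" where
  "smooth_critical_point f S a \<longleftrightarrow>
     a \<in> critical_set f S \<and> curve_submanifold_at (critical_set f S) a"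

(* Orders: the coefficient of x^k y^l in the Taylor expansion of f - f(a) at a is, for k + l > 0,
   the partial derivative below divided by k! l!; it is complex, and vanishes iff the
   corresponding coefficients of both real components vanish. Inf {} is infinity. *)
definition map_order :: "(complex \<Rightarrow> complex) \<Rightarrow> complex \<Rightarrow> enat" where
  "map_order f a =
     Inf {enat (k + l) | k l. k + l > 0 \<and> (pdx ^^ k) ((pdy ^^ l) f) a \<noteq> 0}"

definition curve_order :: "(real \<Rightarrow> 'a::real_normed_vector) \<Rightarrow> real \<Rightarrow> enat" where
  "curve_order b t =
     Inf {enat n | n. n > 0 \<and> ((\<lambda>g s. vector_derivative g (at s)) ^^ n) b t \<noteq> 0}"

definition real_analytic_at :: "(real \<Rightarrow> real) \<Rightarrow> real \<Rightarrow> bool" where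
  "real_analytic_at g a \<longleftrightarrow>
     (\<exists>c r. r > 0 \<and> (\<forall>t. \<bar>t\<bar> < r \<longrightarrow> (\<lambda>n. c n * t ^ n) sums g (a + t)))"

definition plane_analytic_at :: "(complex \<Rightarrow> complex) \<Rightarrow> complex \<Rightarrow> bool" where
  "plane_analytic_at g a \<longleftrightarrow>
     (\<exists>c r. r > 0 \<and> (\<forall>x y. \<bar>x\<bar> < r \<and> \<bar>y\<bar> < r \<longrightarrow>
        ((\<lambda>(k, l). c k l * of_real (x ^ k * y ^ l)) has_sum g (a + Complex x y)) UNIV))"

(* \<phi> is a local analytic reparametrization of the source and \<Phi> a local analytic change of
   coordinates of the plane (invertible differential, so the inverses are analytic as well). *)
definition has_order_pair :: "(real \<Rightarrow> complex) \<Rightarrow> real \<Rightarrow> nat \<Rightarrow> nat \<Rightarrow> bool" where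
  "has_order_pair b t j k \<longleftrightarrow>
     (\<exists>\<phi> \<Phi>. real_analytic_at \<phi> 0 \<and> \<phi> 0 = t \<and> deriv \<phi> 0 \<noteq> 0 \<and>
        plane_analytic_at \<Phi> (b t) \<and> \<Phi> (b t) = b t \<and> jacobian \<Phi> (b t) \<noteq> 0 \<and>
        curve_order (\<lambda>s. Re (\<Phi> (b (\<phi> s)))) 0 = enat j \<and>
        curve_order (\<lambda>s. Im (\<Phi> (b (\<phi> s)))) 0 = enat k)"

(* \<gamma>(t) = \<psi>^{-1}(\<psi>(a) e^{it}) for t near 0, where \<psi> is the holomorphic extension of p'/q'
   across a and W is so small that \<psi> is injective on it. Only the germ of \<gamma> at 0 matters. *)
definition natural_parametrization ::
    "(complex \<Rightarrow> complex) \<Rightarrow> complex \<Rightarrow> (real \<Rightarrow> complex) \<Rightarrow> bool" where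
  "natural_parametrization f a \<gamma> \<longleftrightarrow>
     (\<exists>W p q \<psi> \<epsilon>. open W \<and> a \<in> W \<and> p holomorphic_on W \<and> q holomorphic_on W \<and>
        (\<forall>z\<in>W. f z = p z + cnj (q z)) \<and>
        \<psi> holomorphic_on W \<and>
        (\<forall>z\<in>W - {a}. deriv q z \<noteq> 0 \<and> \<psi> z = deriv p z / deriv q z) \<and>
        inj_on \<psi> W \<and> \<epsilon> > 0 \<and>
        (\<forall>t. \<bar>t\<bar> < \<epsilon> \<longrightarrow> \<gamma> t \<in> W \<and> \<psi> (\<gamma> t) = \<psi> a * cis t))"

(* For a homeomorphism h of an open set U onto a plane open set: local degree +1 everywhere. *)
definition orientation_preserving_on :: "complex set \<Rightarrow> (complex \<Rightarrow> complex) \<Rightarrow> bool" where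
  "orientation_preserving_on U h \<longleftrightarrow>
     (\<forall>z\<in>U. \<forall>r>0. cball z r \<subseteq> U \<longrightarrow> winding_number (h \<circ> circlepath z r) (h z) = 1)"

definition model_map :: "nat \<Rightarrow> nat \<Rightarrow> complex \<Rightarrow> complex" where
  "model_map n1 n2 z =
     (if Arg2pi z \<le> pi then of_real (cmod z) * cis ((2 * real n1 - 1) * Arg2pi z)
      else of_real (cmod z) * cis (- (2 * real n2 - 1) * Arg2pi z))"

(* The pairs (n^+, n^-) allowed by the table. *)
definition model_indices :: "nat \<Rightarrow> nat \<Rightarrow> (nat \<times> nat) set" where
  "model_indices m j = {(n1, n2).
     (2 * int n1 - 1, 2 * int n2 - 1) \<in>
       (if odd m \<and> odd j then {(int m, int m)}
        else if odd m \<and> even j then {(int m + 2, int m), (int m, int m + 2)}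
        else if even m \<and> odd j then {(int m + 1, int m - 1), (int m - 1, int m + 1)}
        else {(int m + 1, int m + 1)})}"

(* \<beta> is the critical value curve inside V = h2^{-1}(disc), an open neighbourhood of f(a)
   containing f(U). It cuts V into two sectors S1, S2. If n^+ = n^- = 1 the map is a fold, f(U)
   misses S2, and the second value n^+ + n^- - 2 is 0; otherwise f(U) = V. *)
definition fibre_cardinalities ::
    "(complex \<Rightarrow> complex) \<Rightarrow> complex set \<Rightarrow> complex set \<Rightarrow> complex set \<Rightarrow> nat \<Rightarrow> nat \<Rightarrow> bool" where
  "fibre_cardinalities f U V \<beta> n1 n2 \<longleftrightarrow>
     (\<exists>S1 S2. components (V - \<beta>) = {S1, S2} \<and> S1 \<noteq> S2 \<and>
        f ` U - \<beta> = (if n1 + n2 = 2 then S1 else S1 \<union> S2) \<and>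
        (\<forall>z\<in>S1. finite {w\<in>U. f w = z} \<and> card {w\<in>U. f w = z} = n1 + n2) \<and>
        (\<forall>z\<in>S2. finite {w\<in>U. f w = z} \<and> card {w\<in>U. f w = z} = n1 + n2 - 2))"

end

theory Submission
  imports Defs
begin

text \<open>
  After a rotation of the target, \<open>f - f z0 = P + cnj Q\<close> with \<open>P' = T * Q'\<close>, where \<open>T\<close> is a
  constant multiple of \<open>\<psi>\<close> with \<open>T z0 = 1\<close> if \<open>j\<close> is odd and \<open>T z0 = -1\<close> if \<open>j\<close> is even. The real
  part of the map is \<open>Re A\<close> and its imaginary part \<open>Im B\<close>, for \<open>A = P + Q\<close> and \<open>B = P - Q\<close>. Here \<open>A\<close>
  vanishes at \<open>z0\<close> to order \<open>M = m\<close> or \<open>M = m + 1\<close>, so \<open>A = \<kappa> ^ M\<close> in a conformal coordinate \<open>\<kappa>\<close>, and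
  \<open>Re (B' / A') = (\<bar>T\<bar>\<^sup>2 - 1) / \<bar>T + 1\<bar>\<^sup>2\<close> has the sign of the Jacobian. Hence on each line
  \<open>Re A = const\<close> the imaginary part is monotone on either side of the critical curve: every sector
  of \<open>Re A \<noteq> 0\<close> is mapped homeomorphically, or folded exactly once. Moreover the critical value
  curve is a graph over the real axis (this is why the cusp is turned by a right angle), so a
  shear straightens it. On each closed side of the critical curve the argument of the straightened map is lifted by
  comparison with \<open>M\<close> times the argument of \<open>\<kappa>\<close>, and dividing the lift by its total variation
  \<open>k * pi\<close> gives the source homeomorphism; tangency of the critical curve to a line forces
  \<open>\<bar>k - M\<bar> \<le> 1\<close>, and \<open>k\<close> is odd, which is the table.
\<close>

section \<open>The closed upper half of a conformal chart\<close>

text \<open>After the rotation, \<open>A' = (T + 1) * Q'\<close>. For odd \<open>j\<close> the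
  factor \<open>T + 1\<close> is 2 at \<open>z0\<close> and \<open>A\<close> has order
  \<open>m\<close>; for even \<open>j\<close> it has a simple zero, which raises the order to
  \<open>m + 1\<close>. A cusp is placed with its tangent along the imaginary axis: the real part of
  the curve then starts with the odd power \<open>t ^ (j + 1)\<close> and the imaginary part with
  \<open>t ^ j\<close>. Such a curve is a graph, but its slope blows up at the cusp, so the shear is
  merely continuous. Everything behind the shear is therefore topological: surjectivity comes from
  invariance of domain, and orientation is tested by winding numbers.

  The lift of the argument exists because the straightened map and \<open>\<kappa> ^ M\<close> share
  their real part: they can point in opposite directions only where this part is 0, and monotonicity
  along rays excludes that. The number \<open>k\<close> is odd because the two ends of the critical
  curve go to opposite real half-axes. The reflected lower half makes \<open>2 * M - k\<close> half
  turns, whence the sum of the two indices is \<open>M + 1\<close>.\<close>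

definition upper_arg :: "complex \<Rightarrow> real" where
  "upper_arg w = Im (Ln (- \<i> * w)) + pi / 2"

lemma cis_upper_arg:
  assumes "w \<noteq> 0"
  shows "w = of_real (cmod w) * cis (upper_arg w)"
proof -
  have "of_real (cmod w) * cis (Im (Ln (- \<i> * w))) = - \<i> * w"
  proof -
    have "exp (Ln (- \<i> * w)) = of_real (exp (ln (cmod w))) * cis (Im (Ln (- \<i> * w)))"
      using assms by (simp add: exp_eq_polar norm_mult)
    then show ?thesis using assms by simp
  qed
  moreover have "cis (upper_arg w) = cis (Im (Ln (- \<i> * w))) * \<i>"
    unfolding upper_arg_def by (simp add: cis_mult [symmetric])
  ultimately have "of_real (cmod w) * cis (upper_arg w) = (- \<i> * w) * \<i>"
    by (metis mult.assoc)
  also have "(- \<i> * w) * \<i> = w" by (simp add: complex_eq_iff)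
  finally show ?thesis by simp
qed

lemma upper_arg_of_real:
  "x > 0 \<Longrightarrow> upper_arg (of_real x) = 0" "x < 0 \<Longrightarrow> upper_arg (of_real x) = pi"
proof -
  assume "x > 0"
  then have "Ln (- \<i> * of_real x) = Ln (of_real x * - \<i>)" by (simp add: mult.commute)
  also have "\<dots> = of_real (ln x) + Ln (- \<i>)" using Ln_times_of_real [of x "- \<i>"] \<open>x>0\<close> by (simp add: Ln_of_real)
  finally show "upper_arg (of_real x) = 0"
    unfolding upper_arg_def by simp
next
  assume "x < 0"
  then have "Ln (- \<i> * of_real x) = Ln (of_real (-x) * \<i>)" by (simp add: mult.commute)
  also have "\<dots> = of_real (ln (-x)) + Ln \<i>" using Ln_times_of_real [of "-x" "\<i>"] Ln_of_real [of "- x"] \<open>x<0\<close> by simp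
  finally show "upper_arg (of_real x) = pi"
    unfolding upper_arg_def by simp
qed

lemma cis_eq_1:
  assumes "cis x = 1"
  obtains i :: int where "x = of_int i * 2 * pi"
proof -
  have "cos x = 1" using assms by (metis cis.simps(1) one_complex.simps(1))
  then show ?thesis using that by (auto simp: cos_one_2pi_int)
qed

section \<open>Sectors: intervals of length \<open>pi\<close> centred at the multiples of
  \<open>pi\<close>\<close>

lemma sector_exists:
  assumes "cos x \<noteq> 0"
  obtains i :: int where "\<bar>x - i * pi\<bar> < pi / 2"
proof -
  define i where "i = round (x / pi)"
  have "\<bar>of_int i - x / pi\<bar> \<le> 1 / 2" unfolding i_def by (rule of_int_round_abs_le)
  then have "\<bar>of_int i - x / pi\<bar> * pi \<le> pi / 2" by simp
  then have le: "\<bar>x - i * pi\<bar> \<le> pi / 2"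
    by (simp add: abs_mult_pos left_diff_distrib abs_minus_commute)
  have "\<bar>x - i * pi\<bar> \<noteq> pi / 2"
  proof
    assume eq: "\<bar>x - i * pi\<bar> = pi / 2"
    have "cos (x - i * pi) = 0" 
      using eq by (metis abs_if cos_minus cos_pi_half)
    moreover have "cos (x - i * pi) = cos x * cos (i * pi)"
      by (simp add: cos_diff sin_npi_int [of i, simplified mult.commute [of pi]])
    moreover have "cos (of_int i * pi) \<noteq> 0" 
      by (metis cos_npi_int mult.commute zero_neq_neg_one zero_neq_one)
    ultimately show False using assms by simp
  qed
  then show ?thesis using that [of i] le by linarith
qed

lemma cos_sector:
  assumes "\<bar>x - of_int i * pi\<bar> < pi / 2"
  shows "sgn (cos x) = (if even i then 1 else -1)"
proof -
  have "0 < cos (x - of_int i * pi)" using assms unfolding abs_less_iff by (intro cos_gt_zero_pi) linarith+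
  then have "0 < cos x * cos (of_int i * pi)"
    by (simp add: cos_diff sin_npi_int [of i, simplified mult.commute [of pi]])
  then show ?thesis using cos_npi_int [of i] by (auto simp: mult.commute sgn_real_def zero_less_mult_iff split: if_splits)
qed

text \<open>A sign reveals only the parity of a sector. Centres of equal parity are a multiple of
  \<open>2 * pi\<close> apart, so a distance below \<open>pi\<close> between the two angles leaves
  room for one centre only.\<close>

lemma sector_unique:
  assumes "\<bar>x - of_int i * pi\<bar> < pi / 2" "\<bar>y - of_int i' * pi\<bar> < pi / 2" "\<bar>x - y\<bar> < pi"
    and "even i \<longleftrightarrow> even i'"
  shows "i = i'"
proof -
  have "\<bar>of_int i * pi - of_int i' * pi\<bar> < 2 * pi"
    using assms(1-3) unfolding abs_less_iff by linarith
  then have "\<bar>real_of_int (i - i') * pi\<bar> < 2 * pi"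
    by (simp only: of_int_diff left_diff_distrib)
  then have "\<bar>real_of_int (i - i')\<bar> < 2" by (simp only: abs_mult) simp
  then have "\<bar>i - i'\<bar> < 2" by linarith
  with assms(4) show ?thesis by presburger
qed

lemma upper_arg_bounds:
  assumes "w \<noteq> 0" "Im w \<ge> 0"
  shows "0 \<le> upper_arg w" "upper_arg w \<le> pi"
proof -
  have "\<bar>Im (Ln (- \<i> * w))\<bar> \<le> pi / 2"
    using Re_Ln_pos_le [of "- \<i> * w"] assms by simp
  then show "0 \<le> upper_arg w" "upper_arg w \<le> pi"
    unfolding upper_arg_def by auto
qed

lemma upper_arg_bounds_strict:
  assumes "Im w > 0"
  shows "0 < upper_arg w" "upper_arg w < pi"
proof -
  have "w \<noteq> 0" using assms by auto
  then have "\<bar>Im (Ln (- \<i> * w))\<bar> < pi / 2"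
    using Re_Ln_pos_lt [of "- \<i> * w"] assms by simp
  then show "0 < upper_arg w" "upper_arg w < pi"
    unfolding upper_arg_def by auto
qed

text \<open>This is the purpose of the rotation in \<open>upper_arg\<close>:
  \<open>- \<i> * w\<close> meets the cut of \<open>Ln\<close> only when \<open>w\<close> is 0 or on
  the negative imaginary axis, so both real half-axes are included.\<close>

lemma continuous_on_upper_arg:
  "continuous_on {w. Im w \<ge> 0 \<and> w \<noteq> 0} upper_arg"
proof -
  have "- \<i> * w \<notin> \<real>\<^sub>\<le>\<^sub>0" if "Im w \<ge> 0" "w \<noteq> 0" for w
    using that by (auto simp: complex_nonpos_Reals_iff complex_eq_iff)
  then show ?thesis
    unfolding upper_arg_def by (intro continuous_intros) auto
qed

text \<open>\<open>eta\<close> is a conformal coordinate in which the critical curve is real, \<open>H\<close> is the map after the shear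
  by \<open>c\<close>, which makes it real on the critical curve. In \<open>upper_half\<close>, \<open>k\<close> is the number of half turns
  made by \<open>H\<close> between the two ends of the critical curve. The lower half is covered by conjugating.\<close>

locale upper_half_base =
  fixes M :: nat and R0 :: real and ell eta B H :: "complex \<Rightarrow> complex" and c :: "real \<Rightarrow> real"
  assumes M_pos: "0 < M" and R0_pos: "0 < R0"
    and cont_ell: "continuous_on (ball 0 R0) ell"
    and eta_eq: "\<And>z. z \<in> ball 0 R0 \<Longrightarrow> eta z = z * exp (- ell z)"
    and inj_eta: "inj_on eta (ball 0 R0)"
    and hol_B: "B holomorphic_on ball 0 R0"
    and H_eq: "\<And>z. z \<in> ball 0 R0 \<Longrightarrow> H z = Complex (Re (z ^ M)) (Im (B z) - c (Re (z ^ M)))"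
    and cont_H: "continuous_on (ball 0 R0) H"
    and crit_real: "\<And>z. z \<in> ball 0 R0 \<Longrightarrow> Im (eta z) = 0 \<Longrightarrow> Im (H z) = 0"
    and crit_mono: "\<And>z w. z \<in> ball 0 R0 \<Longrightarrow> w \<in> ball 0 R0 \<Longrightarrow> Im (eta z) = 0 \<Longrightarrow> Im (eta w) = 0 \<Longrightarrow>
           Re (eta z) < Re (eta w) \<Longrightarrow> Re (z ^ M) < Re (w ^ M)"
    and sgn_B: "\<And>z. z \<in> ball 0 R0 \<Longrightarrow> z \<noteq> 0 \<Longrightarrow>
           sgn (Re (deriv B z / (of_nat M * z ^ (M - 1)))) = sgn (Im (eta z))"
begin

text \<open>Lifts of the arguments of \<open>z ^ M\<close> and \<open>H z\<close> to the closed upper half minus the origin.\<close>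

definition "lam z = M * (upper_arg (eta z) + Im (ell z))"
definition "Theta z = lam z + Im (Ln (H z / z ^ M))"
definition "C = {z \<in> ball 0 R0. 0 \<le> Im (eta z) \<and> z \<noteq> 0}"

lemma eta_0 [simp]: "eta 0 = 0" using eta_eq [of 0] R0_pos by simp

lemma eta_nz: "z \<in> ball 0 R0 \<Longrightarrow> z \<noteq> 0 \<Longrightarrow> eta z \<noteq> 0"
  by (simp add: eta_eq)

lemma cont_eta: "continuous_on (ball 0 R0) eta"
  by (subst continuous_on_cong [OF refl eta_eq]) (auto intro!: continuous_intros cont_ell)

lemma Im_H_0: "Im (H 0) = 0" and Re_H_0: "Re (H 0) = 0"
  using crit_real [of 0] H_eq [of 0] R0_pos M_pos by auto

lemma H_0: "H 0 = 0" using Im_H_0 Re_H_0 by (simp add: complex_eq_iff)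

lemma Re_H: "z \<in> ball 0 R0 \<Longrightarrow> Re (H z) = Re (z ^ M)"
  by (simp add: H_eq)

text \<open>Divided by \<open>M\<close>, the lift \<open>lam\<close> is an argument of
  \<open>z\<close> itself and not just of \<open>z ^ M\<close>. It thus remembers which root is
  meant, on which the injectivity proof relies.\<close>

lemma polar: 
  assumes "z \<in> ball 0 R0" "z \<noteq> 0"
  shows "z = of_real (cmod z) * cis (lam z / M)"
proof -
  have "z = eta z * exp (ell z)" 
    using assms by (simp add: eta_eq exp_minus)
  also have "\<dots> = of_real (cmod (eta z)) * cis (upper_arg (eta z)) * (of_real (exp (Re (ell z))) * cis (Im (ell z)))"
    using cis_upper_arg [OF eta_nz [OF assms]] exp_eq_polar [of "ell z"] by simp
  also have "\<dots> = of_real (cmod (eta z) * exp (Re (ell z))) * cis (lam z / M)"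
    using M_pos by (simp add: lam_def cis_mult [symmetric] mult_ac)
  finally have *: "z = of_real (cmod (eta z) * exp (Re (ell z))) * cis (lam z / M)" .
  then have "cmod z = cmod (eta z) * exp (Re (ell z))"
    by (metis abs_mult abs_norm_cancel abs_exp_cancel mult.right_neutral norm_cis norm_mult norm_of_real)
  with * show ?thesis by simp
qed

lemma power_polar:
  assumes "z \<in> ball 0 R0" "z \<noteq> 0"
  shows "z ^ M = of_real (cmod z ^ M) * cis (lam z)"
proof -
  have "z ^ M = (of_real (cmod z) * cis (lam z / M)) ^ M"
    by (rule arg_cong [OF polar [OF assms]])
  then show ?thesis
    using M_pos by (simp add: power_mult_distrib Complex.DeMoivre)
qed

text \<open>Strict monotonicity of the real part along the critical curve leaves the origin as its
  only point over 0.\<close>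

lemma crit_Re_0:
  assumes "z \<in> ball 0 R0" "Im (eta z) = 0" "Re (z ^ M) = 0"
  shows "z = 0"
proof (rule ccontr)
  assume "z \<noteq> 0"
  then have "Re (eta z) \<noteq> 0" using eta_nz [OF assms(1)] assms(2) by (metis complex_eq_iff zero_complex.sel)
  then consider "Re (eta z) < Re (eta 0)" | "Re (eta 0) < Re (eta z)" by fastforce
  then show False
    using crit_mono [of z 0] crit_mono [of 0 z] assms M_pos R0_pos by cases (auto simp: zero_power)
qed

text \<open>Along a ray on which \<open>Re (z ^ M) = 0\<close> the critical curve is never met, so \<open>Im (eta z)\<close>
  keeps its sign and \<open>Im H\<close> is strictly monotone.\<close>

lemma ray_mono:
  assumes z: "z \<in> C" and Re0: "Re (z ^ M) = 0" and r: "0 \<le> r" "r < cmod z"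
    and u: "u = z / of_real (cmod z)"
  shows "0 < sgn (Im (z ^ M)) * (Im (H z) - Im (H (of_real r * u)))"
proof -
  have zb: "z \<in> ball 0 R0" and z0: "z \<noteq> 0" and Yz: "0 \<le> Im (eta z)"
    using z by (auto simp: C_def)
  define s where "s = sgn (Im (z ^ M))"
  have nu: "cmod u = 1" using z0 by (simp add: u norm_divide)
  have zu: "z = of_real (cmod z) * u" using z0 by (simp add: u)
  have Im_nz: "Im (z ^ M) \<noteq> 0"
    using Re0 z0 by (metis complex_eq_iff power_eq_0_iff zero_complex.sel)
  \<comment> \<open>The direction \<open>u\<close> is an \<open>M\<close>-th root of
    \<open>\<i>\<close> or \<open>- \<i>\<close>. All powers along the ray have real part 0, so the
    shear only subtracts the constant \<open>c 0\<close> there.\<close>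
  have uM: "u ^ M = \<i> * of_real s"
  proof -
    have "z ^ M = \<i> * of_real (Im (z ^ M))" using Re0 by (simp add: complex_eq_iff)
    moreover have "cmod z ^ M = \<bar>Im (z ^ M)\<bar>"
      using Re0 by (metis abs_norm_cancel cmod_eq_Im norm_power)
    ultimately have "u ^ M = \<i> * of_real (Im (z ^ M)) / of_real \<bar>Im (z ^ M)\<bar>"
      by (simp add: u power_divide flip: of_real_power)
    also have "\<dots> = \<i> * of_real s"
      using Im_nz by (simp add: s_def sgn_real_def)
    finally show ?thesis .
  qed
  have s2: "s * s = 1" using Im_nz by (simp add: s_def sgn_real_def)
  have inb: "of_real t * u \<in> ball 0 R0" if "0 \<le> t" "t \<le> cmod z" for t
    using that zb nu by (simp add: norm_mult)
  have ReM: "Re ((of_real t * u) ^ M) = 0" for t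
    by (simp add: power_mult_distrib uM flip: of_real_power)
  have Ynz: "Im (eta (of_real t * u)) \<noteq> 0" if "0 < t" "t \<le> cmod z" for t
    using crit_Re_0 [OF inb _ ReM, of t] that nu by auto
  have contY: "continuous_on {0..cmod z} (\<lambda>t. Im (eta (of_real t * u)))"
    by (intro continuous_intros continuous_on_compose2 [OF cont_eta]) (use inb in auto)
  have Ypos: "0 < Im (eta (of_real t * u))" if t: "0 < t" "t \<le> cmod z" for t
  proof (rule ccontr)
    assume "\<not> ?thesis"
    then have "Im (eta (of_real t * u)) \<le> 0" by simp
    moreover have "0 \<le> Im (eta (of_real (cmod z) * u))" using Yz zu by simp
    moreover have "continuous_on {t..cmod z} (\<lambda>t. Im (eta (of_real t * u)))"
      by (rule continuous_on_subset [OF contY]) (use t in auto)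
    ultimately obtain t' where "t \<le> t'" "t' \<le> cmod z" "Im (eta (of_real t' * u)) = 0"
      using IVT' [of "\<lambda>t. Im (eta (of_real t * u))" t 0 "cmod z"] t by auto
    then show False using Ynz [of t'] t by auto
  qed
  define f where "f t = s * Im (B (of_real t * u))" for t
  have der: "\<exists>y>0. (f has_real_derivative y) (at t)" if t: "0 < t" "t \<le> cmod z" for t
  proof -
    let ?w = "of_real t * u"
    have w: "?w \<in> ball 0 R0" "?w \<noteq> 0" using inb t nu by auto
    have "(B has_field_derivative deriv B ?w) (at ?w)"
      using hol_B w by (meson holomorphic_derivI open_ball)
    moreover have "((\<lambda>t. of_real t * u) has_vector_derivative u) (at t)"
      by (auto intro!: derivative_eq_intros)
    ultimately have "((\<lambda>t. B (of_real t * u)) has_vector_derivative (u * deriv B ?w)) (at t)"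
      using field_vector_diff_chain_at [of "\<lambda>t. of_real t * u" u t B "deriv B ?w"] by (simp add: o_def)
    then have "((\<lambda>t. Im (B (of_real t * u))) has_real_derivative Im (u * deriv B ?w)) (at t)"
      unfolding has_real_derivative_iff_has_vector_derivative
      by (rule bounded_linear.has_vector_derivative [OF bounded_linear_Im])
    then have D: "(f has_real_derivative s * Im (u * deriv B ?w)) (at t)"
      unfolding f_def by (rule DERIV_cmult)
    \<comment> \<open>Writing \<open>u\<close> as \<open>\<i> * s / u ^ (M - 1)\<close> exposes the
      quotient of \<open>deriv B\<close> by the derivative of the power, whose real part has a known
      sign by \<open>sgn_B\<close>.\<close>
    have "u * deriv B ?w = \<i> * of_real (s * M * t ^ (M - 1)) * (deriv B ?w / (of_nat M * ?w ^ (M - 1)))"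
    proof -
      have "\<i> * of_real s = u * u ^ (M - 1)" 
        using uM M_pos by (metis power_minus_mult mult.commute)
      moreover have "u ^ (M - 1) \<noteq> 0" using nu by auto
      ultimately have "\<i> * of_real s / u ^ (M - 1) = u" by (simp add: divide_eq_eq)
      then have "\<i> * (of_real s * d) / u ^ (M - 1) = u * d" for d
        by (metis mult.assoc times_divide_eq_left)
      then show ?thesis using M_pos t by (simp add: power_mult_distrib)
    qed
    then have "Im (u * deriv B ?w) = s * M * t ^ (M - 1) * Re (deriv B ?w / (of_nat M * ?w ^ (M - 1)))"
      by (simp del: times_divide_eq_right) 
    then have "s * Im (u * deriv B ?w) = (s * s) * M * t ^ (M - 1) * Re (deriv B ?w / (of_nat M * ?w ^ (M - 1)))"
      by (simp add: mult_ac)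
    moreover have "0 < Re (deriv B ?w / (of_nat M * ?w ^ (M - 1)))"
      using sgn_B [OF w] Ypos [OF t] by (metis sgn_1_pos)
    ultimately have "0 < s * Im (u * deriv B ?w)"
      using s2 M_pos t by simp
    with D show ?thesis by blast
  qed
  have "f r < f (cmod z)"
  proof (rule DERIV_pos_imp_increasing_open [OF r(2)])
    show "\<exists>y. (f has_real_derivative y) (at x) \<and> 0 < y" if "r < x" "x < cmod z" for x
      using der [of x] that r by auto
    show "continuous_on {r..cmod z} f"
      unfolding f_def
      by (intro continuous_intros continuous_on_compose2 [OF holomorphic_on_imp_continuous_on [OF hol_B]])
         (use inb r in auto)
  qed
  moreover have "Im (H (of_real t * u)) = Im (B (of_real t * u)) - c 0" if "0 \<le> t" "t \<le> cmod z" for t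
    using H_eq [OF inb [OF that]] ReM by simp
  from this [of r] this [of "cmod z"] have "Im (H (of_real r * u)) = Im (B (of_real r * u)) - c 0"
    "Im (H z) = Im (B (of_real (cmod z) * u)) - c 0"
    using r zu by auto
  ultimately show ?thesis
    unfolding f_def s_def [symmetric] by (simp add: right_diff_distrib)
qed

lemma sgn_ray:
  assumes "z \<in> C" "Re (z ^ M) = 0"
  shows "sgn (Im (H z)) = sgn (Im (z ^ M))" "Im (z ^ M) \<noteq> 0"
proof -
  have "z \<noteq> 0" using assms by (auto simp: C_def)
  then have *: "0 < sgn (Im (z ^ M)) * Im (H z)"
    using ray_mono [OF assms, of 0] by (simp add: H_0)
  then show "Im (z ^ M) \<noteq> 0" by auto
  show "sgn (Im (H z)) = sgn (Im (z ^ M))"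
    using * by (auto simp: sgn_real_def split: if_splits)
qed

text \<open>\<open>H z\<close> and \<open>z ^ M\<close> have equal real parts, so a nonpositive real
  quotient forces this part to vanish. There the imaginary parts have equal signs by
  \<open>sgn_ray\<close>, and the quotient is positive. Hence the principal logarithm in
  \<open>Theta\<close> never meets its cut.\<close>

lemma H_over_power:
  assumes "z \<in> C"
  shows "H z / z ^ M \<notin> \<real>\<^sub>\<le>\<^sub>0" "Re (z ^ M) = 0 \<Longrightarrow> Im (Ln (H z / z ^ M)) = 0" "H z \<noteq> 0"
proof -
  have zb: "z \<in> ball 0 R0" and z0: "z \<noteq> 0" using assms by (auto simp: C_def)
  have ray: "H z = of_real (\<bar>Im (H z)\<bar> / \<bar>Im (z ^ M)\<bar>) * z ^ M \<and> \<bar>Im (H z)\<bar> / \<bar>Im (z ^ M)\<bar> > 0"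
    if "Re (z ^ M) = 0"
    using sgn_ray [OF assms that] Re_H [OF zb] that
    by (auto simp: complex_eq_iff sgn_real_def zero_less_divide_iff split: if_splits)
  have ray': "H z / z ^ M = of_real (\<bar>Im (H z)\<bar> / \<bar>Im (z ^ M)\<bar>)" if "Re (z ^ M) = 0"
    using conjunct1 [OF ray [OF that]] z0 by (metis nonzero_eq_divide_eq power_not_zero)
  show "Im (Ln (H z / z ^ M)) = 0" if "Re (z ^ M) = 0"
    using ray' [OF that] ray [OF that] by (metis Im_Ln_of_real)
  show "H z \<noteq> 0"
  proof
    assume "H z = 0"
    then have "Re (z ^ M) = 0" using Re_H [OF zb] by simp
    then show False using ray \<open>H z = 0\<close> by simp
  qed
  show "H z / z ^ M \<notin> \<real>\<^sub>\<le>\<^sub>0"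
  proof
    assume "H z / z ^ M \<in> \<real>\<^sub>\<le>\<^sub>0"
    then obtain t where t: "H z / z ^ M = of_real t" "t \<le> 0"
      by (auto simp: nonpos_Reals_def)
    then have "H z = of_real t * z ^ M" using z0 by (simp add: field_simps)
    then have "Re (z ^ M) = t * Re (z ^ M)" using Re_H [OF zb] by simp
    then have "Re (z ^ M) = 0" using t(2) by auto
    then show False using ray' ray t by (metis not_le of_real_eq_iff)
  qed
qed

lemma H_polar:
  assumes "z \<in> C"
  shows "H z = of_real (cmod (H z)) * cis (Theta z)"
proof -
  have zb: "z \<in> ball 0 R0" and z0: "z \<noteq> 0" using assms by (auto simp: C_def)
  let ?q = "H z / z ^ M"
  have q0: "?q \<noteq> 0" using H_over_power(3) [OF assms] z0 by simp
  have "?q = of_real (cmod ?q) * cis (Im (Ln ?q))"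
    using exp_eq_polar [of "Ln ?q"] q0 by simp
  then have "H z = of_real (cmod ?q) * cis (Im (Ln ?q)) * (of_real (cmod z ^ M) * cis (lam z))"
    using power_polar [OF zb z0] z0 by (metis nonzero_eq_divide_eq power_not_zero)
  also have "\<dots> = of_real (cmod ?q * cmod z ^ M) * cis (Theta z)"
    unfolding Theta_def by (simp add: cis_mult [symmetric] mult_ac)
  also have "cmod ?q * cmod z ^ M = cmod (H z)"
    using z0 by (simp add: norm_divide norm_power)
  finally show ?thesis .
qed

lemma Theta_near:
  assumes "z \<in> C"
  shows "\<bar>Theta z - lam z\<bar> < pi"
proof -
  have "Im (Ln (H z / z ^ M)) < pi"
    using Im_Ln_less_pi [of "H z / z ^ M"] H_over_power [OF assms]
    by (metis Im_Ln_le_pi Im_Ln_eq_pi complex_nonpos_Reals_iff div_0 less_eq_real_def nonpos_Reals_zero_I order_less_irrefl)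
  moreover have "- pi < Im (Ln (H z / z ^ M))"
    using mpi_less_Im_Ln H_over_power [OF assms] by (metis nonpos_Reals_zero_I)
  ultimately show ?thesis unfolding Theta_def by auto
qed

lemma cont_Theta: "continuous_on C Theta"
proof -
  have "continuous_on C (\<lambda>z. upper_arg (eta z))"
    by (rule continuous_on_compose2 [OF continuous_on_upper_arg continuous_on_subset [OF cont_eta]])
       (auto simp: C_def eta_nz)
  moreover have "continuous_on C ell" "continuous_on C H"
    using cont_ell cont_H by (auto intro: continuous_on_subset simp: C_def)
  ultimately show ?thesis
    unfolding Theta_def lam_def
    by (intro continuous_intros) (auto simp: H_over_power, auto simp: C_def)
qed


end

text \<open>\<open>far\<close> keeps the set \<open>cmod (H z) < \<rho>\<close> off the circle of
  radius \<open>R\<close>, so that points of the half can escape only through the critical curve or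
  the origin. \<open>ell_right\<close> and \<open>ell_left\<close> fix the lift at the two ends to
  within one sector, \<open>crit_surj\<close> makes the curve long enough to cover the diameter, and
  \<open>upper_nonempty\<close> starts the connectedness argument.\<close>

locale upper_half = upper_half_base M R0 ell eta B H c
  for M :: nat and R0 :: real and ell eta B H :: "complex \<Rightarrow> complex" and c :: "real \<Rightarrow> real" +
  fixes k :: nat and R \<rho> :: real
  assumes k_pos: "0 < k" and k_odd: "odd k"
    and R_pos: "0 < R" and R_less: "R < R0" and rho_pos: "0 < \<rho>"
    and ell_right: "\<And>z. z \<in> ball 0 R0 \<Longrightarrow> Im (eta z) = 0 \<Longrightarrow> 0 < Re (eta z) \<Longrightarrow>
           \<bar>M * Im (ell z)\<bar> < pi / 2"
    and ell_left: "\<And>z. z \<in> ball 0 R0 \<Longrightarrow> Im (eta z) = 0 \<Longrightarrow> Re (eta z) < 0 \<Longrightarrow>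
           \<bar>M * (pi + Im (ell z)) - k * pi\<bar> < pi / 2"
    and far: "\<And>z. cmod z = R \<Longrightarrow> \<rho> \<le> cmod (H z)"
    and crit_surj: "\<And>a. \<bar>a\<bar> < \<rho> \<Longrightarrow> \<exists>z\<in>ball 0 R. Im (eta z) = 0 \<and> Re (z ^ M) = a"
    and upper_nonempty: "\<exists>z\<in>ball 0 R. 0 < Im (eta z) \<and> cmod (H z) < \<rho>"
begin

text \<open>\<open>H\<close> is positive here, so \<open>Theta\<close> is a multiple of
  \<open>2 * pi\<close>, and its modulus is below \<open>pi + pi / 2\<close> by
  \<open>Theta_near\<close> and \<open>ell_right\<close>.\<close>

lemma Theta_right:
  assumes "z \<in> ball 0 R0" "Im (eta z) = 0" "0 < Re (eta z)"
  shows "Theta z = 0"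
proof -
  have zC: "z \<in> C" using assms eta_0 by (force simp: C_def)
  have "H z = of_real (Re (z ^ M))" 
    using crit_real [OF assms(1,2)] Re_H [OF assms(1)] by (simp add: complex_eq_iff)
  moreover have "0 < Re (z ^ M)"
    using crit_mono [of 0 z] assms R0_pos M_pos by (simp add: zero_power)
  ultimately have "cis (Theta z) = 1"
    using H_polar [OF zC] by simp
  then obtain i :: int where i: "Theta z = of_int i * 2 * pi"
    by (rule cis_eq_1)
  have "lam z = M * Im (ell z)"
    using upper_arg_of_real(1) [OF assms(3)] assms(2) by (simp add: lam_def complex_is_Real_iff of_real_Re)
  then have "\<bar>of_int i * 2 * pi\<bar> < 2 * pi"
    using Theta_near [OF zC] ell_right [OF assms] i by linarith
  then have "\<bar>real_of_int i\<bar> < 1" by (simp add: abs_mult)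
  then have "i = 0" by linarith
  then show ?thesis using i by simp
qed

text \<open>\<open>H\<close> is negative here; only an odd \<open>k\<close> makes
  \<open>k * pi\<close> an admissible argument. The rest is the estimate of
  \<open>Theta_right\<close> with \<open>ell_left\<close>.\<close>

lemma Theta_left:
  assumes "z \<in> ball 0 R0" "Im (eta z) = 0" "Re (eta z) < 0"
  shows "Theta z = k * pi"
proof -
  have zC: "z \<in> C" using assms eta_0 by (force simp: C_def)
  have "H z = of_real (Re (z ^ M))" 
    using crit_real [OF assms(1,2)] Re_H [OF assms(1)] by (simp add: complex_eq_iff)
  moreover have neg: "Re (z ^ M) < 0"
    using crit_mono [of z 0] assms R0_pos M_pos by (simp add: zero_power)
  ultimately have "of_real (Re (z ^ M)) = complex_of_real (- Re (z ^ M)) * cis (Theta z)"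
    using H_polar [OF zC] by simp
  then have "of_real (Re (z ^ M)) * (cis (Theta z) + 1) = 0"
    unfolding distrib_left by (metis add.commute add.right_inverse minus_mult_left mult.right_neutral of_real_minus)
  then have "cis (Theta z) = - 1"
    using neg by (auto simp: add_eq_0_iff2)
  moreover have "cis (k * pi) = - 1" using k_odd by (simp add: cis_conv_exp complex_eq_iff Re_exp Im_exp)
  ultimately have "cis (Theta z - k * pi) = 1"
    by (simp add: cis_divide [symmetric])
  then obtain i :: int where i: "Theta z - k * pi = of_int i * 2 * pi"
    by (rule cis_eq_1)
  have "lam z = M * (pi + Im (ell z))"
    using upper_arg_of_real(2) [OF assms(3)] assms(2) by (simp add: lam_def complex_is_Real_iff of_real_Re)
  then have "\<bar>of_int i * 2 * pi\<bar> < 2 * pi"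
    using Theta_near [OF zC] ell_left [OF assms] i by linarith
  then have "\<bar>real_of_int i\<bar> < 1" by (simp add: abs_mult)
  then have "i = 0" by linarith
  then show ?thesis using i by simp
qed

text \<open>The cosines of \<open>Theta z\<close> and \<open>lam z\<close> both have the sign of the
  common real part, and the angles are less than \<open>pi\<close> apart, so
  \<open>sector_unique\<close> applies. The sector of the source point can thus be read off from
  \<open>Theta\<close>.\<close>

lemma same_sector:
  assumes "z \<in> C" "Re (z ^ M) \<noteq> 0" "\<bar>Theta z - of_int i * pi\<bar> < pi / 2"
  shows "\<bar>lam z - of_int i * pi\<bar> < pi / 2"
proof -
  have zb: "z \<in> ball 0 R0" and z0: "z \<noteq> 0" using assms by (auto simp: C_def)
  have p1: "Re (z ^ M) = cmod z ^ M * cos (lam z)"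
    by (subst power_polar [OF zb z0]) simp
  have p2: "Re (z ^ M) = cmod (H z) * cos (Theta z)"
    using arg_cong [OF H_polar [OF assms(1)], of Re] Re_H [OF zb] by simp
  have "cos (lam z) \<noteq> 0" using p1 assms(2) by auto
  then obtain i' :: int where i': "\<bar>lam z - i' * pi\<bar> < pi / 2" by (rule sector_exists)
  have "sgn (cos (lam z)) = sgn (Re (z ^ M))" using p1 z0 by (simp add: sgn_mult)
  moreover have "sgn (cos (Theta z)) = sgn (Re (z ^ M))"
    using p2 H_over_power(3) [OF assms(1)] by (simp add: sgn_mult)
  ultimately have par: "even i \<longleftrightarrow> even i'"
    using cos_sector [OF i'] cos_sector [OF assms(3)] by (auto split: if_splits)
  have "i = i'" using sector_unique [OF assms(3) i' Theta_near [OF assms(1)] par] .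
  with i' show ?thesis by simp
qed

text \<open>Two points of the same fibre of \<open>Re (z ^ M)\<close> in one sector are joined by a lifted vertical
  segment \<open>(a + i t) ^ (1/M)\<close>. It meets the critical curve at most once, hence stays in the
  closed upper half, and \<open>Im B\<close> strictly increases along it.\<close>

lemma vertical_mono:
  assumes z: "z \<in> C" and w: "w \<in> C" and ReM: "Re (z ^ M) = Re (w ^ M)" and nz: "Re (z ^ M) \<noteq> 0"
    and less: "Im (z ^ M) < Im (w ^ M)"
    and i: "\<bar>lam z - of_int i * pi\<bar> < pi / 2" "\<bar>lam w - of_int i * pi\<bar> < pi / 2"
  shows "Im (H z) < Im (H w)"
proof -
  have zb: "z \<in> ball 0 R0" and z0: "z \<noteq> 0" and Yz: "0 \<le> Im (eta z)" 
    and wb: "w \<in> ball 0 R0" and w0: "w \<noteq> 0" and Yw: "0 \<le> Im (eta w)"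
    using z w by (auto simp: C_def)
  define a where "a = Re (z ^ M)"
  define s :: real where "s = (if even i then 1 else - 1)"
  have s2: "s * s = 1" by (simp add: s_def)
  have s_inv: "complex_of_real s * of_real s = 1" using s2 by (metis of_real_1 of_real_mult)
  have cis_s: "cis (of_int i * pi) = of_real s"
    by (simp add: complex_eq_iff s_def mult.commute [of _ pi])
  have "Re (z ^ M) = cmod z ^ M * cos (lam z)"
    by (subst power_polar [OF zb z0]) simp
  then have "sgn a = s" using cos_sector [OF i(1)] z0 by (simp add: sgn_mult a_def s_def)
  then have sa: "0 < s * a" using nz unfolding a_def by (metis sgn_mult_self_eq abs_sgn mult.commute zero_less_abs_iff)
  \<comment> \<open>The sign \<open>s\<close> moves the line of real part \<open>a\<close> into the
    right half plane, where \<open>Ln\<close> is holomorphic. In \<open>e\<close>, the factor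
    \<open>cis (of_int i * pi / M)\<close> is an \<open>M\<close>-th root of \<open>s\<close>; it
    selects the branch of the root that belongs to sector \<open>i\<close>.\<close>
  define L where "L t = Ln (of_real s * Complex a t)" for t
  define e where "e t = cis (of_int i * pi / M) * exp (L t / M)" for t
  have arg_pos: "0 < Re (of_real s * Complex a t)" for t using sa by simp
  then have arg: "of_real s * Complex a t \<noteq> 0" "of_real s * Complex a t \<notin> \<real>\<^sub>\<le>\<^sub>0" for t
    by (metis order_less_irrefl zero_complex.sel(1), metis complex_nonpos_Reals_iff not_le)
  have e_pow: "e t ^ M = Complex a t" for t
  proof -
    have "e t ^ M = cis (of_int i * pi) * exp (L t)"
      using M_pos by (simp add: e_def power_mult_distrib Complex.DeMoivre flip: exp_of_nat_mult)
    also have "\<dots> = Complex a t"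
      using arg(1) [of t] s2 by (simp add: cis_s L_def mult.assoc [symmetric] flip: of_real_mult)
    finally show ?thesis .
  qed
  have e_nz: "e t \<noteq> 0" for t by (simp add: e_def)
  have back_eq: "e (Im (v ^ M)) = v" 
    if v: "v \<in> ball 0 R0" "v \<noteq> 0" "Re (v ^ M) = a" "\<bar>lam v - of_int i * pi\<bar> < pi / 2" for v
  proof -
    have "of_real s * Complex a (Im (v ^ M)) = of_real s * v ^ M"
      using v(3) by (simp add: complex_eq_iff)
    also have "\<dots> = of_real (cmod v ^ M) * cis (lam v - of_int i * pi)"
    proof -
      have "cis (lam v - of_int i * pi) = cis (lam v) * of_real s"
      proof -
        have "cis (lam v - of_int i * pi) = cis (lam v) * (of_real s * of_real s) / of_real s"
          using cis_s s_inv by (simp add: cis_divide [symmetric])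
        then show ?thesis by (auto simp: s_def)
      qed
      then show ?thesis using power_polar [OF v(1,2)] by simp
    qed
    also have "\<dots> = exp (Complex (M * ln (cmod v)) (lam v - of_int i * pi))"
      using v(2) by (simp add: exp_eq_polar exp_of_nat_mult)
    finally have "L (Im (v ^ M)) = Complex (M * ln (cmod v)) (lam v - of_int i * pi)"
      unfolding L_def by (simp only:) (rule Ln_exp; use v(4) pi_gt_zero in \<open>simp; linarith\<close>)
    then have "e (Im (v ^ M)) = cis (of_int i * pi / M) * (of_real (cmod v) * cis ((lam v - of_int i * pi) / M))"
      unfolding e_def using M_pos v(2) by (simp add: exp_eq_polar)
    also have "\<dots> = of_real (cmod v) * cis (lam v / M)"
      by (simp add: cis_mult diff_divide_distrib)
    finally show ?thesis using polar [OF v(1,2)] by simp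
  qed
  define t0 where "t0 = Im (z ^ M)"
  define t1 where "t1 = Im (w ^ M)"
  have t01: "t0 < t1" using less by (simp add: t0_def t1_def)
  have e0: "e t0 = z" unfolding t0_def by (rule back_eq [OF zb z0 _ i(1)]) (simp add: a_def)
  have e1: "e t1 = w" unfolding t1_def by (rule back_eq [OF wb w0 _ i(2)]) (simp only: a_def ReM)
  \<comment> \<open>On a vertical segment the modulus is largest at an end, and both ends lie in the
    ball.\<close>
  have inb: "e t \<in> ball 0 R0" if "t0 \<le> t" "t \<le> t1" for t
  proof -
    have "\<bar>t\<bar> \<le> \<bar>t0\<bar> \<or> \<bar>t\<bar> \<le> \<bar>t1\<bar>" using that by linarith
    then have "t\<^sup>2 \<le> t0\<^sup>2 \<or> t\<^sup>2 \<le> t1\<^sup>2" by (simp only: abs_le_square_iff)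
    then have "cmod (Complex a t) \<le> cmod (Complex a t0) \<or> cmod (Complex a t) \<le> cmod (Complex a t1)"
      by (auto simp: cmod_def)
    then have "cmod (e t) ^ M \<le> cmod z ^ M \<or> cmod (e t) ^ M \<le> cmod w ^ M"
      by (metis e0 e1 e_pow norm_power)
    then have "cmod (e t) \<le> cmod z \<or> cmod (e t) \<le> cmod w"
      using M_pos by (auto simp: power_mono_iff)
    then show ?thesis using zb wb by auto
  qed
  have e_der: "(e has_vector_derivative \<i> / (of_nat M * e t ^ (M - 1))) (at t)" for t
  proof -
    have "((\<lambda>t. of_real s * Complex a t) has_vector_derivative of_real s * \<i>) (at t)"
      unfolding Complex_eq by (auto intro!: derivative_eq_intros)
    from field_vector_diff_chain_at [OF this has_field_derivative_Ln [OF arg(2) [of t]]]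
    have "((\<lambda>t. Ln (of_real s * Complex a t)) has_vector_derivative 
        (of_real s * \<i>) * inverse (of_real s * Complex a t)) (at t)"
      by (simp add: o_def)
    then have L': "(L has_vector_derivative \<i> / Complex a t) (at t)"
      unfolding L_def using arg(1) [of t] by (cases "s = 0") (simp_all add: field_simps)
    have "((\<lambda>l. cis (of_int i * pi / M) * exp (l / M)) has_field_derivative e t / M) (at (L t))"
      unfolding e_def using M_pos by (auto intro!: derivative_eq_intros)
    from field_vector_diff_chain_at [OF L' this]
    have "(e has_vector_derivative \<i> / Complex a t * (e t / M)) (at t)"
      by (simp add: o_def e_def [abs_def])
    also have "\<i> / Complex a t * (e t / M) = \<i> / (of_nat M * e t ^ (M - 1))"
    proof -
      have "Complex a t = e t * e t ^ (M - 1)" using e_pow M_pos by (metis power_minus_mult mult.commute)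
      then show ?thesis using e_nz [of t] M_pos by (simp add: field_simps)
    qed
    finally show ?thesis .
  qed
  have cont_e: "continuous_on {t0..t1} e"
    by (meson continuous_at_imp_continuous_on e_der has_vector_derivative_continuous)
  define Y where "Y t = Im (eta (e t))" for t
  have cont_Y: "continuous_on {t0..t1} Y"
    unfolding Y_def by (intro continuous_intros continuous_on_compose2 [OF cont_eta cont_e]) (use inb in auto)
  have uniq: "x = y" if "t0 \<le> x" "x \<le> t1" "t0 \<le> y" "y \<le> t1" "Y x = 0" "Y y = 0" for x y
  proof -
    have "Re (eta (e x)) = Re (eta (e y))"
      using crit_mono [OF inb [of x] inb [of y]] crit_mono [OF inb [of y] inb [of x]] that
      unfolding Y_def e_pow by (metis complex.sel(1) linorder_less_linear order_less_irrefl)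
    then have "e x = e y"
      using inj_eta inb that unfolding Y_def by (metis complex_eq_iff inj_onD)
    then show "x = y" by (metis e_pow complex.sel(2))
  qed
  have Y_nonneg: "0 \<le> Y t" if t: "t0 \<le> t" "t \<le> t1" for t
  proof (rule ccontr)
    assume n: "\<not> 0 \<le> Y t"
    have "continuous_on {t0..t} Y" "continuous_on {t..t1} Y" 
      using cont_Y t by (auto intro: continuous_on_subset)
    moreover have "0 \<le> Y t0" "0 \<le> Y t1" using Yz Yw by (simp_all add: Y_def e0 e1)
    moreover have "Y t \<le> 0" using n by simp
    ultimately have "\<exists>x\<ge>t0. x \<le> t \<and> Y x = 0" "\<exists>y\<ge>t. y \<le> t1 \<and> Y y = 0"
      using t IVT2' [of Y t 0 t0] IVT' [of Y t 0 t1] by blast+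
    then obtain x y where xy: "t0 \<le> x" "x \<le> t" "Y x = 0" "t \<le> y" "y \<le> t1" "Y y = 0" by blast
    then have "x = y" using t uniq [of x y] by simp
    then have "t = x" using xy by simp
    then show False using n xy by simp
  qed
  define f where "f t = Im (B (e t))" for t
  define f' where "f' t = Re (deriv B (e t) / (of_nat M * e t ^ (M - 1)))" for t
  have f_der: "(f has_real_derivative f' t) (at t)" if t: "t0 \<le> t" "t \<le> t1" for t
  proof -
    have "(B has_field_derivative deriv B (e t)) (at (e t))"
      using hol_B inb [OF t] by (meson holomorphic_derivI open_ball)
    from field_vector_diff_chain_at [OF e_der this]
    have "((\<lambda>t. B (e t)) has_vector_derivative \<i> / (of_nat M * e t ^ (M - 1)) * deriv B (e t)) (at t)"
      by (simp add: o_def)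
    then have "((\<lambda>t. Im (B (e t))) has_vector_derivative Im (\<i> / (of_nat M * e t ^ (M - 1)) * deriv B (e t))) (at t)"
      by (rule bounded_linear.has_vector_derivative [OF bounded_linear_Im])
    moreover have "\<i> / (of_nat M * e t ^ (M - 1)) * deriv B (e t) = \<i> * (deriv B (e t) / (of_nat M * e t ^ (M - 1)))"
      by simp
    ultimately show ?thesis
      unfolding f_def f'_def has_real_derivative_iff_has_vector_derivative by (metis Im_i_times)
  qed
  have sgn_f': "sgn (f' t) = sgn (Y t)" if "t0 \<le> t" "t \<le> t1" for t
    using sgn_B [OF inb [OF that] e_nz] by (simp add: f'_def Y_def)
  have f'_nonneg: "0 \<le> f' t" if "t0 \<le> t" "t \<le> t1" for t
    using sgn_f' [OF that] Y_nonneg [OF that] by (auto simp: sgn_real_def split: if_splits)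
  have f_le: "f x \<le> f y" if "t0 \<le> x" "x \<le> y" "y \<le> t1" for x y
  proof (rule DERIV_nonneg_imp_nondecreasing [OF that(2)])
    fix t assume "x \<le> t" "t \<le> y"
    then have "t0 \<le> t" "t \<le> t1" using that by auto
    then show "\<exists>d. (f has_real_derivative d) (at t) \<and> 0 \<le> d" using f_der f'_nonneg by blast
  qed
  \<comment> \<open>The derivative may vanish at the one possible crossing of the critical curve.
    Strictness needs only a subinterval without it: the first half, or the last quarter if the
    crossing is in the first half.\<close>
  obtain x y where xy: "t0 \<le> x" "x < y" "y \<le> t1" "\<And>t. x \<le> t \<Longrightarrow> t \<le> y \<Longrightarrow> Y t \<noteq> 0"
  proof (cases "\<exists>t. t0 \<le> t \<and> t \<le> (t0 + t1) / 2 \<and> Y t = 0")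
    case False
    then show ?thesis using that [of t0 "(t0 + t1)/2"] t01 by auto
  next
    case True
    then obtain t where t: "t0 \<le> t" "t \<le> (t0 + t1) / 2" "Y t = 0" by auto
    show ?thesis
    proof (rule that [of "(t0 + 3 * t1) / 4" t1])
      show "Y v \<noteq> 0" if "(t0 + 3 * t1) / 4 \<le> v" "v \<le> t1" for v
      proof
        assume "Y v = 0"
        then have "v = t" using uniq [of v t] t that t01 by auto
        then show False using t that t01 by auto
      qed
    qed (use t01 in auto)
  qed
  have "f x < f y"
  proof (rule DERIV_pos_imp_increasing [OF xy(2)])
    fix t assume t: "x \<le> t" "t \<le> y"
    have "0 < Y t" using xy(4) [OF t] Y_nonneg [of t] t xy(1,3) by linarith
    then have "0 < f' t" using sgn_f' [of t] t xy(1,3) by (simp add: sgn_1_pos)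
    then show "\<exists>d. (f has_real_derivative d) (at t) \<and> 0 < d" using f_der [of t] t xy by auto
  qed
  then have "f t0 < f t1" using f_le [of t0 x] f_le [of y t1] xy by auto
  then show ?thesis 
    using H_eq [OF zb] H_eq [OF wb] ReM unfolding f_def e0 e1 by simp
qed

text \<open>Equal images over real part 0 lie on one ray, where \<open>ray_mono\<close> separates
  them. Over any other real part they lie in one sector above the same vertical line, where
  \<open>vertical_mono\<close> does so. In both cases \<open>lam\<close> then singles out the
  point.\<close>

lemma inj_polar:
  assumes z: "z \<in> C" and w: "w \<in> C" and HH: "cmod (H z) = cmod (H w)" and TT: "Theta z = Theta w"
  shows "z = w"
proof -
  have zb: "z \<in> ball 0 R0" and z0: "z \<noteq> 0" and wb: "w \<in> ball 0 R0" and w0: "w \<noteq> 0"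
    using z w by (auto simp: C_def)
  have Heq: "H z = H w" using H_polar [OF z] H_polar [OF w] HH TT by metis
  then have ReM: "Re (z ^ M) = Re (w ^ M)" using Re_H zb wb by metis
  show ?thesis
  proof (cases "Re (z ^ M) = 0")
    case True
    have "lam z = lam w" 
      using TT H_over_power(2) [OF z True] H_over_power(2) [OF w] True ReM by (simp add: Theta_def)
    then obtain u where u: "z = of_real (cmod z) * u" "w = of_real (cmod w) * u"
      using polar [OF zb z0] polar [OF wb w0] by metis
    have u': "u = z / of_real (cmod z)" "u = w / of_real (cmod w)"
      using u z0 w0 by (simp_all add: field_simps)
    have "\<not> cmod w < cmod z"
      using ray_mono [OF z True _ _ u'(1), of "cmod w"] u Heq by (metis diff_self mult_zero_right norm_ge_zero order_less_irrefl)
    moreover have "\<not> cmod z < cmod w"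
      using ray_mono [OF w _ _ _ u'(2), of "cmod z"] True ReM u Heq by (metis diff_self mult_zero_right norm_ge_zero order_less_irrefl)
    ultimately show ?thesis using u by (metis linorder_less_linear)
  next
    case False
    have "Re (H z) = cmod (H z) * cos (Theta z)"
      using arg_cong [OF H_polar [OF z], of Re] by simp
    then have "cos (Theta z) \<noteq> 0" using False Re_H [OF zb] by auto
    then obtain i :: int where i: "\<bar>Theta z - of_int i * pi\<bar> < pi / 2" by (rule sector_exists)
    have lz: "\<bar>lam z - of_int i * pi\<bar> < pi / 2" using same_sector [OF z False i] .
    have lw: "\<bar>lam w - of_int i * pi\<bar> < pi / 2" using same_sector [OF w] i False ReM TT by simp
    have "\<not> Im (z ^ M) < Im (w ^ M)" "\<not> Im (w ^ M) < Im (z ^ M)"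
      using vertical_mono [OF z w ReM False _ lz lw] vertical_mono [OF w z _ _ _ lw lz] ReM False Heq by auto
    then have "z ^ M = w ^ M" using ReM by (simp add: complex_eq_iff)
    then have eq: "of_real (cmod z ^ M) * cis (lam z) = of_real (cmod w ^ M) * cis (lam w)" "cmod z = cmod w"
      using power_polar zb z0 wb w0 M_pos
       apply (metis)
      using \<open>z ^ M = w ^ M\<close> M_pos by (metis norm_ge_zero norm_power power_eq_imp_eq_base)
    then have "cis (lam z - lam w) = 1"
      using w0 by (simp add: cis_divide [symmetric])
    then obtain n :: int where n: "lam z - lam w = of_int n * 2 * pi"
      by (rule cis_eq_1)
    have "\<bar>of_int n * 2 * pi\<bar> < pi" using n lz lw by linarith
    then have "\<bar>real_of_int n\<bar> < 1" by (simp add: abs_mult)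
    then have "n = 0" by linarith
    then have "lam z = lam w" using n by simp
    then show ?thesis using polar [OF zb z0] polar [OF wb w0] eq(2) by metis
  qed
qed


section \<open>The strip of moduli and angles filled by the open half\<close>

definition "T = {z \<in> ball 0 R. 0 < Im (eta z) \<and> cmod (H z) < \<rho>}"

lemma T_subset: "T \<subseteq> C" 
  using R_less eta_0 by (force simp: T_def C_def)

lemma open_T: "open T"
proof -
  have "continuous_on (ball 0 R) eta" "continuous_on (ball 0 R) H"
    using cont_eta cont_H R_less by (auto intro: continuous_on_subset)
  then have "open (ball 0 R \<inter> (\<lambda>z. (Im (eta z), cmod (H z))) -` ({0<..} \<times> {..<\<rho>}))"
    by (intro continuous_open_preimage continuous_intros open_Times) auto
  also have "\<dots> = T" by (auto simp: T_def)
  finally show ?thesis .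
qed

definition "Psi z = Complex (cmod (H z)) (Theta z)"

lemma cont_Psi: "continuous_on C Psi"
proof -
  have "continuous_on C H" using cont_H by (auto intro: continuous_on_subset simp: C_def)
  then show ?thesis
    unfolding Psi_def Complex_eq by (intro continuous_intros cont_Theta)
qed

lemma inj_Psi: "inj_on Psi C"
  by (intro inj_onI inj_polar) (auto simp: Psi_def)

lemma Re_eta_pos:
  assumes "z \<in> ball 0 R0" "Im (eta z) = 0"
  shows "0 < Re (z ^ M) \<Longrightarrow> 0 < Re (eta z)" "Re (z ^ M) < 0 \<Longrightarrow> Re (eta z) < 0"
proof -
  have "Re (eta z) = 0 \<Longrightarrow> z = 0" 
    using eta_nz [OF assms(1)] assms(2) by (metis complex_eq_iff zero_complex.sel)
  then show "0 < Re (z ^ M) \<Longrightarrow> 0 < Re (eta z)" "Re (z ^ M) < 0 \<Longrightarrow> Re (eta z) < 0"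
    using crit_mono [of z 0] crit_mono [of 0 z] assms R0_pos M_pos
    by (fastforce simp: zero_power)+
qed

lemma H_crit:
  assumes "z \<in> ball 0 R0" "Im (eta z) = 0"
  shows "H z = of_real (Re (z ^ M))"
  using crit_real [OF assms] Re_H [OF assms(1)] by (simp add: complex_eq_iff)

text \<open>The critical curve already contains a point with the same modulus of \<open>H\<close>
  and with this extreme angle. By injectivity it would be \<open>z\<close>, but \<open>z\<close>
  lies off the curve.\<close>

lemma Theta_T_nz:
  assumes "z \<in> T"
  shows "Theta z \<noteq> 0" "Theta z \<noteq> k * pi"
proof -
  have zC: "z \<in> C" and r: "0 < cmod (H z)" "cmod (H z) < \<rho>"
    using assms T_subset H_over_power(3) by (auto simp: T_def)
  show "Theta z \<noteq> 0"
  proof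
    assume *: "Theta z = 0"
    obtain w where w: "w \<in> ball 0 R" "Im (eta w) = 0" "Re (w ^ M) = cmod (H z)"
      using crit_surj [of "cmod (H z)"] r by auto
    then have wb: "w \<in> ball 0 R0" using R_less by auto
    have p: "0 < Re (eta w)" using Re_eta_pos [OF wb w(2)] w r by simp
    then have "w \<in> C" using w wb eta_0 by (force simp: C_def)
    then have "z = w"
      using inj_polar [OF zC] * Theta_right [OF wb w(2) p] H_crit [OF wb w(2)] w(3) by simp
    then show False using w assms by (auto simp: T_def)
  qed
  show "Theta z \<noteq> k * pi"
  proof
    assume *: "Theta z = k * pi"
    obtain w where w: "w \<in> ball 0 R" "Im (eta w) = 0" "Re (w ^ M) = - cmod (H z)"
      using crit_surj [of "- cmod (H z)"] r by auto
    then have wb: "w \<in> ball 0 R0" using R_less by auto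
    have p: "Re (eta w) < 0" using Re_eta_pos [OF wb w(2)] w r by simp
    then have "w \<in> C" using w wb eta_0 by (force simp: C_def)
    then have "z = w"
      using inj_polar [OF zC] * Theta_left [OF wb w(2) p] H_crit [OF wb w(2)] w(3) by simp
    then show False using w assms by (auto simp: T_def)
  qed
qed

text \<open>The image of \<open>T\<close> is open by invariance of domain and relatively closed off the lines
  \<open>\<theta> = 0\<close> and \<open>\<theta> = k \<pi>\<close>, to which the boundary is sent.\<close>

lemma Psi_clopen:
  assumes S: "connected S" "S \<subseteq> {w. 0 < Re w \<and> Re w < \<rho> \<and> Im w \<noteq> 0 \<and> Im w \<noteq> k * pi}"
    and meet: "S \<inter> Psi ` T \<noteq> {}"
  shows "S \<subseteq> Psi ` T"
proof (rule ccontr)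
  assume "\<not> S \<subseteq> Psi ` T"
  \<comment> \<open>The interior of the complement of the image. It has to absorb every point of
    \<open>S\<close> that the image misses.\<close>
  define N where "N = \<Union> {V. open V \<and> V \<inter> Psi ` T = {}}"
  have "open (Psi ` T)"
    by (rule invariance_of_domain [OF _ open_T])
       (auto intro: continuous_on_subset [OF cont_Psi] inj_on_subset [OF inj_Psi] T_subset [THEN subsetD])
  moreover have "open N" by (auto simp: N_def)
  moreover have "S \<subseteq> Psi ` T \<union> N"
  proof
    fix w assume w: "w \<in> S"
    show "w \<in> Psi ` T \<union> N"
    proof (cases "w \<in> Psi ` T")
      case False
      have wr: "0 < Re w" "Re w < \<rho>" "Im w \<noteq> 0" "Im w \<noteq> k * pi" using S(2) w by auto
      define \<epsilon> where "\<epsilon> = Re w / 2"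
      define K where "K = {z \<in> cball 0 R. 0 \<le> Im (eta z) \<and> \<epsilon> \<le> cmod (H z)}"
      have sub: "cball 0 R \<subseteq> ball 0 R0" using R_less by auto
      have "closed (cball 0 R \<inter> (\<lambda>z. (Im (eta z), cmod (H z))) -` ({0..} \<times> {\<epsilon>..}))"
        by (intro continuous_closed_preimage continuous_intros closed_Times 
              continuous_on_subset [OF cont_eta sub] continuous_on_subset [OF cont_H sub]) auto
      moreover have "K = cball 0 R \<inter> (\<lambda>z. (Im (eta z), cmod (H z))) -` ({0..} \<times> {\<epsilon>..})"
        by (auto simp: K_def)
      moreover have "bounded K" by (rule bounded_subset [of "cball 0 R"]) (auto simp: K_def)
      ultimately have "compact K" by (simp add: compact_eq_bounded_closed)
      have KC: "K \<subseteq> C"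
        using wr R_less H_0 by (auto simp: K_def C_def \<epsilon>_def)
      have "closed (Psi ` K)"
        by (intro compact_imp_closed compact_continuous_image continuous_on_subset [OF cont_Psi KC] \<open>compact K\<close>)
      define V where "V = {v. \<epsilon> < Re v} \<inter> - Psi ` K"
      have "open V" unfolding V_def
        using \<open>closed (Psi ` K)\<close> by (intro open_Int open_halfspace_Re_gt) auto
      moreover have "V \<inter> Psi ` T = {}"
        by (auto simp: V_def T_def K_def Psi_def)
      moreover have "w \<in> V"
      proof -
        have "w \<noteq> Psi z" if "z \<in> K" for z
        proof
          assume eq: "w = Psi z"
          have zb: "z \<in> ball 0 R0" using that KC by (auto simp: C_def)
          have Hz: "cmod (H z) < \<rho>" "Theta z \<noteq> 0" "Theta z \<noteq> k * pi"
            using eq wr by (auto simp: Psi_def)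
          then have "cmod z < R" using far [of z] that by (force simp: K_def)
          moreover have "Im (eta z) \<noteq> 0"
          proof
            assume "Im (eta z) = 0"
            moreover from this have "Re (eta z) \<noteq> 0"
              using eta_nz [OF zb] that KC by (auto simp: C_def complex_eq_iff)
            ultimately show False
              using Theta_left [OF zb] Theta_right [OF zb] Hz by linarith
          qed
          ultimately have "z \<in> T" using that Hz by (auto simp: K_def T_def)
          with False eq show False by auto
        qed
        then show ?thesis using wr by (auto simp: V_def \<epsilon>_def)
      qed
      ultimately show ?thesis by (auto simp: N_def)
    qed auto
  qed
  moreover have "Psi ` T \<inter> N \<inter> S = {}" by (auto simp: N_def)
  moreover have "N \<inter> S \<noteq> {}" using \<open>S \<subseteq> Psi ` T \<union> N\<close> \<open>\<not> S \<subseteq> Psi ` T\<close> by auto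
  ultimately show False
    using connectedD [OF S(1), of "Psi ` T" N] meet by auto
qed

lemma Theta_bounded: obtains N where "\<And>z. z \<in> T \<Longrightarrow> \<bar>Theta z\<bar> < N"
proof -
  have "compact (ell ` cball 0 R)"
    using cont_ell R_less by (intro compact_continuous_image) (auto intro: continuous_on_subset)
  then obtain L where L: "\<And>z. z \<in> cball 0 R \<Longrightarrow> cmod (ell z) \<le> L"
    by (meson bounded_iff compact_imp_bounded imageI)
  have "\<bar>Theta z\<bar> < M * (pi + L) + pi" if z: "z \<in> T" for z
  proof -
    have zC: "z \<in> C" using z T_subset by auto
    have "\<bar>Im (ell z)\<bar> \<le> L" using L [of z] z abs_Im_le_cmod [of "ell z"] by (auto simp: T_def)
    moreover have "0 \<le> upper_arg (eta z)" "upper_arg (eta z) \<le> pi"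
      using upper_arg_bounds_strict [of "eta z"] z by (auto simp: T_def)
    ultimately have "\<bar>upper_arg (eta z) + Im (ell z)\<bar> \<le> pi + L" by linarith
    then have "\<bar>lam z\<bar> \<le> M * (pi + L)" unfolding lam_def by (simp add: abs_mult mult_left_mono)
    then show ?thesis using Theta_near [OF zC] by linarith
  qed
  then show ?thesis by (rule that)
qed

text \<open>A value below 0 or above \<open>k * pi\<close> lies in an unbounded half-strip, which
  \<open>Psi_clopen\<close> would fill completely with values of \<open>Psi\<close>, against the
  boundedness of \<open>Theta\<close>.\<close>

lemma Theta_range:
  assumes "z \<in> T"
  shows "0 < Theta z" "Theta z < k * pi"
proof -
  obtain N where N: "\<And>z. z \<in> T \<Longrightarrow> \<bar>Theta z\<bar> < N" by (rule Theta_bounded) blast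
  have N0: "0 < N" using N [OF assms] by linarith
  have zC: "z \<in> C" and r: "0 < cmod (H z)" "cmod (H z) < \<rho>"
    using assms T_subset H_over_power(3) by (auto simp: T_def)
  have *: "Complex (\<rho> / 2) y \<notin> Psi ` T" if "N \<le> \<bar>y\<bar>" for y
    using N that by (force simp: Psi_def)
  have kp: "0 < k * pi" using k_pos by simp
  show "0 < Theta z"
  proof (rule ccontr)
    assume "\<not> 0 < Theta z"
    then have neg: "Theta z < 0" using Theta_T_nz [OF assms] by linarith
    define S where "S = {w. 0 < Re w} \<inter> {w. Re w < \<rho>} \<inter> {w. Im w < 0}"
    have "convex S" unfolding S_def
      by (intro convex_Int convex_halfspace_Re_gt convex_halfspace_Re_lt convex_halfspace_Im_lt)
    then have "connected S" by (rule convex_connected)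
    moreover have "S \<subseteq> {w. 0 < Re w \<and> Re w < \<rho> \<and> Im w \<noteq> 0 \<and> Im w \<noteq> k * pi}"
      using kp by (auto simp: S_def)
    moreover have "Psi z \<in> S" using r neg by (simp add: S_def Psi_def)
    ultimately have "S \<subseteq> Psi ` T" using assms by (intro Psi_clopen) auto
    moreover have "Complex (\<rho> / 2) (- N) \<in> S" using rho_pos N0 by (simp add: S_def)
    ultimately show False using * [of "- N"] abs_ge_self [of N] by auto
  qed
  show "Theta z < k * pi"
  proof (rule ccontr)
    assume "\<not> Theta z < k * pi"
    then have neg: "k * pi < Theta z" using Theta_T_nz [OF assms] by linarith
    define S where "S = {w. 0 < Re w} \<inter> {w. Re w < \<rho>} \<inter> {w. k * pi < Im w}"
    have "convex S" unfolding S_def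
      by (intro convex_Int convex_halfspace_Re_gt convex_halfspace_Re_lt convex_halfspace_Im_gt)
    then have "connected S" by (rule convex_connected)
    moreover have "S \<subseteq> {w. 0 < Re w \<and> Re w < \<rho> \<and> Im w \<noteq> 0 \<and> Im w \<noteq> k * pi}"
      using kp by (auto simp: S_def)
    moreover have "Psi z \<in> S" using r neg by (simp add: S_def Psi_def)
    ultimately have "S \<subseteq> Psi ` T" using assms by (intro Psi_clopen) auto
    moreover have "Complex (\<rho> / 2) (N + k * pi) \<in> S" using rho_pos N0 by (simp add: S_def)
    ultimately show False using * [of "N + k * pi"] kp abs_ge_self [of "N + k * pi"] by auto
  qed
qed

lemma Theta_surj:
  assumes "0 < r" "r < \<rho>" "0 < t" "t < k * pi"
  obtains z where "z \<in> T" "cmod (H z) = r" "Theta z = t"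
proof -
  define S where "S = {w. 0 < Re w} \<inter> {w. Re w < \<rho>} \<inter> {w. 0 < Im w} \<inter> {w. Im w < k * pi}"
  have "convex S" unfolding S_def
    by (intro convex_Int convex_halfspace_Re_gt convex_halfspace_Re_lt convex_halfspace_Im_gt convex_halfspace_Im_lt)
  then have "connected S" by (rule convex_connected)
  moreover have "S \<subseteq> {w. 0 < Re w \<and> Re w < \<rho> \<and> Im w \<noteq> 0 \<and> Im w \<noteq> k * pi}"
    by (auto simp: S_def)
  moreover obtain z where z: "z \<in> T" using upper_nonempty by (auto simp: T_def)
  moreover have "Psi z \<in> S" 
    using Theta_range [OF z] z H_over_power(3) T_subset by (auto simp: S_def Psi_def T_def)
  ultimately have "S \<subseteq> Psi ` T" by (intro Psi_clopen) auto
  moreover have "Complex r t \<in> S" using assms by (simp add: S_def)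
  ultimately show ?thesis using that by (auto simp: Psi_def)
qed

section \<open>Dividing the angle by \<open>k\<close>: the chart onto a closed half disc\<close>

definition "h z = (if z = 0 then 0 else of_real (cmod (H z)) * cis (Theta z / k))"
definition "D = {z \<in> ball 0 R. 0 \<le> Im (eta z) \<and> cmod (H z) < \<rho>}"

lemma D_cases:
  assumes "z \<in> D"
  obtains "z = 0" | "z \<in> C" "Im (eta z) = 0" "0 < Re (eta z)" "Theta z = 0"
    | "z \<in> C" "Im (eta z) = 0" "Re (eta z) < 0" "Theta z = k * pi"
    | "z \<in> C" "z \<in> T" "0 < Theta z" "Theta z < k * pi"
proof -
  have zb: "z \<in> ball 0 R0" using assms R_less by (auto simp: D_def)
  consider "z = 0" | "z \<in> T" | "z \<in> C" "Im (eta z) = 0"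
    using assms zb by (force simp: D_def C_def T_def)
  then show ?thesis
  proof cases
    case 3
    then have "Re (eta z) \<noteq> 0" using eta_nz [OF zb] by (auto simp: C_def complex_eq_iff)
    then consider "0 < Re (eta z)" | "Re (eta z) < 0" by linarith
    then show ?thesis using that(2,3) 3 Theta_right [OF zb] Theta_left [OF zb] by cases auto
  qed (use that T_subset Theta_range in auto)
qed

lemma D_nz:
  assumes "z \<in> D" "z \<noteq> 0"
  shows "z \<in> C" "0 \<le> Theta z" "Theta z \<le> k * pi"
proof -
  have "z \<in> C \<and> 0 \<le> Theta z \<and> Theta z \<le> k * pi"
    by (cases rule: D_cases [OF assms(1)]) (use assms(2) in auto)
  then show "z \<in> C" "0 \<le> Theta z" "Theta z \<le> k * pi" by auto
qed

lemma norm_h: "cmod (h z) = cmod (H z)"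
  by (simp add: h_def norm_mult H_0)

lemma h_crit:
  assumes "z \<in> ball 0 R0" "Im (eta z) = 0"
  shows "h z = H z"
proof (cases "z = 0")
  case False
  then have zC: "z \<in> C" using assms by (auto simp: C_def)
  have "Re (eta z) \<noteq> 0" using eta_nz [OF assms(1) False] assms(2) by (auto simp: complex_eq_iff)
  then consider "0 < Re (eta z)" | "Re (eta z) < 0" by linarith
  then show ?thesis
  proof cases
    case 1
    then show ?thesis using Theta_right [OF assms 1] H_polar [OF zC] False by (simp add: h_def)
  next
    case 2
    have "cis (k * pi) = - 1" using k_odd by (simp add: cis_conv_exp complex_eq_iff Re_exp Im_exp)
    then show ?thesis using Theta_left [OF assms 2] H_polar [OF zC] False k_pos by (simp add: h_def)
  qed
qed (simp add: h_def H_0)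

lemma Im_h_pos:
  assumes "z \<in> T" shows "0 < Im (h z)"
proof -
  have "0 < Theta z / k" "Theta z / k < pi"
    using Theta_range [OF assms] k_pos by (auto simp: field_simps)
  then have "0 < sin (Theta z / k)" by (rule sin_gt_zero)
  moreover have "z \<noteq> 0" "H z \<noteq> 0" using assms T_subset H_over_power(3) by (auto simp: C_def)
  ultimately show ?thesis by (simp add: h_def)
qed

lemma h_model:
  assumes "z \<in> D"
  shows "\<exists>t::real. 0 \<le> t \<and> t \<le> pi \<and> h z = of_real (cmod (H z)) * cis t \<and>
           H z = of_real (cmod (H z)) * cis (real k * t)"
proof (cases "z = 0")
  case True then show ?thesis by (auto simp: h_def H_0 intro!: exI [of _ 0])
next
  case False
  have "z \<in> C" "0 \<le> Theta z" "Theta z \<le> k * pi"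
    using D_nz [OF assms False] by auto
  then show ?thesis
    using False k_pos H_polar [of z] by (intro exI [of _ "Theta z / k"]) (simp add: h_def field_simps)
qed

lemma inj_h: "inj_on h D"
proof (rule inj_onI)
  fix z w assume z: "z \<in> D" and w: "w \<in> D" and eq: "h z = h w"
  have HH: "cmod (H z) = cmod (H w)" using eq norm_h by metis
  show "z = w"
  proof (cases "z = 0 \<or> w = 0")
    case True
    have "v = 0" if "v \<in> D" "H v = 0" for v
      using that H_over_power(3) by (cases rule: D_cases [OF that(1)]) auto
    then show ?thesis using True HH z w H_0 by auto
  next
    case False
    have zC: "z \<in> C" and tz: "0 \<le> Theta z" "Theta z \<le> k * pi"
      using D_nz [OF z] False by auto
    have wC: "w \<in> C" and tw: "0 \<le> Theta w" "Theta w \<le> k * pi"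
      using D_nz [OF w] False by auto
    have "cis (Theta z / k) = cis (Theta w / k)"
      using eq HH False H_over_power(3) [OF zC] by (auto simp: h_def)
    then have "cis (Theta z / k - Theta w / k) = 1" by (simp add: cis_divide [symmetric])
    then obtain n :: int where n: "Theta z / k - Theta w / k = of_int n * 2 * pi"
      by (rule cis_eq_1)
    have "0 \<le> Theta z / k" "Theta z / k \<le> pi" "0 \<le> Theta w / k" "Theta w / k \<le> pi"
      using tz tw k_pos by (auto simp: field_simps)
    then have "\<bar>of_int n * 2 * pi\<bar> < 2 * pi" using n pi_gt_zero by linarith
    then have "\<bar>real_of_int n\<bar> < 1" by (simp add: abs_mult)
    then have "n = 0" by linarith
    then have "Theta z = Theta w" using n k_pos by simp
    then show ?thesis using inj_polar [OF zC wC HH] by simp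
  qed
qed

lemma image_h: "h ` D = {w. cmod w < \<rho> \<and> 0 \<le> Im w}"
proof
  show "h ` D \<subseteq> {w. cmod w < \<rho> \<and> 0 \<le> Im w}"
  proof (clarify, intro conjI)
    fix z assume z: "z \<in> D"
    then show "cmod (h z) < \<rho>" by (simp add: norm_h D_def)
    obtain t where "0 \<le> t" "t \<le> pi" "h z = of_real (cmod (H z)) * cis t" using h_model [OF z] by auto
    then show "0 \<le> Im (h z)" by (simp add: sin_ge_zero)
  qed
  show "{w. cmod w < \<rho> \<and> 0 \<le> Im w} \<subseteq> h ` D"
  proof clarify
    fix w assume w: "cmod w < \<rho>" "0 \<le> Im w"
    show "w \<in> h ` D"
    proof (cases "Im w = 0")
      case True
      then have "\<bar>Re w\<bar> < \<rho>" using w by (simp add: cmod_eq_Re)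
      then obtain z where z: "z \<in> ball 0 R" "Im (eta z) = 0" "Re (z ^ M) = Re w"
        using crit_surj by blast
      then have zb: "z \<in> ball 0 R0" using R_less by auto
      have "h z = w" using h_crit [OF zb z(2)] H_crit [OF zb z(2)] z(3) True by (simp add: complex_eq_iff)
      moreover have "z \<in> D" using z \<open>h z = w\<close> norm_h [of z] w by (simp add: D_def)
      ultimately show ?thesis by blast
    next
      case False
      then have Iw: "0 < Im w" "w \<noteq> 0" using w by auto
      have "0 < upper_arg w" "upper_arg w < pi" using upper_arg_bounds_strict [OF Iw(1)] by auto
      then obtain z where z: "z \<in> T" "cmod (H z) = cmod w" "Theta z = k * upper_arg w"
        using Theta_surj [of "cmod w" "k * upper_arg w"] w(1) Iw k_pos by auto
      then have "h z = w" 
        using cis_upper_arg [OF Iw(2)] k_pos T_subset by (auto simp: h_def C_def)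
      moreover have "z \<in> D" using z by (auto simp: T_def D_def)
      ultimately show ?thesis by blast
    qed
  qed
qed

text \<open>At the origin nothing is known about the angle; continuity comes from
  \<open>norm_h\<close> alone, as \<open>cmod (H z)\<close> tends to 0. Elsewhere
  \<open>Theta\<close> is continuous.\<close>

lemma cont_h: "continuous_on D h"
  unfolding continuous_on_eq_continuous_within
proof
  fix z assume z: "z \<in> D"
  have DR: "D \<subseteq> ball 0 R0" using R_less by (auto simp: D_def)
  have cH: "continuous_on D H" using cont_H DR by (rule continuous_on_subset)
  show "continuous (at z within D) h"
  proof (cases "z = 0")
    case True
    have "((\<lambda>v. cmod (H v)) \<longlongrightarrow> cmod (H z)) (at z within D)"
      using cH z by (intro tendsto_intros) (auto simp: continuous_on_def)
    then have "((\<lambda>v. cmod (h v)) \<longlongrightarrow> 0) (at z within D)"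
      using True H_0 by (simp add: norm_h)
    then show ?thesis
      using True tendsto_norm_zero_iff [of h] by (simp add: continuous_within h_def [of 0])
  next
    case False
    have DC: "D - {0} \<subseteq> C" using DR by (auto simp: D_def C_def)
    have "continuous_on (D - {0}) (\<lambda>z. of_real (cmod (H z)) * cis (Theta z / k))"
      using k_pos by (intro continuous_intros continuous_on_subset [OF cH] continuous_on_subset [OF cont_Theta DC]) auto
    then have "continuous_on (D - {0}) h"
      by (rule continuous_on_eq) (auto simp: h_def)
    then have "continuous (at z within (D - {0})) h"
      using z False by (auto simp: continuous_on_eq_continuous_within)
    moreover have "at z within (D - {0}) = at z within D"
      using False by (intro at_within_nhd [of z "- {0}"]) auto
    ultimately show ?thesis by (simp add: continuous_within)
  qed
qed

end

section \<open>Gluing the two halves\<close>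

lemma model_map_upper:
  assumes "0 \<le> r" "0 \<le> t" "t \<le> pi"
  shows "model_map n1 n2 (of_real r * cis t) = of_real r * cis ((2 * real n1 - 1) * t)"
proof (cases "r = 0")
  case False
  then have r: "0 < r" using assms by simp
  have "Arg2pi (of_real r * cis t) = t"
    by (rule Arg2pi_unique [OF _ r]) (use assms pi_gt_zero in \<open>auto simp: cis_conv_exp intro: le_less_trans\<close>)
  then show ?thesis using r assms by (simp add: model_map_def norm_mult)
qed (simp add: model_map_def)

lemma cis_odd_pi:
  assumes "odd k" shows "cis (real k * pi) = -1"
  using assms by (simp add: complex_eq_iff)

text \<open>The argument of the reflected point is \<open>2 * pi - t\<close>, and the resulting
  integer multiple of \<open>2 * pi\<close> drops out. The ends \<open>t = 0\<close> and
  \<open>t = pi\<close> fall under the first clause of \<open>model_map\<close>; at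
  \<open>pi\<close> the two values agree because both speeds are odd.\<close>

lemma model_map_lower:
  assumes "0 \<le> r" "0 \<le> t" "t \<le> pi" "1 \<le> n1" "1 \<le> n2"
  shows "model_map n1 n2 (cnj (of_real r * cis t)) = of_real r * cis ((2 * real n2 - 1) * t)"
proof -
  have odd: "cis ((2 * real n - 1) * pi) = -1" if "1 \<le> n" for n
    using cis_odd_pi [of "2 * n - 1"] that by (simp add: of_nat_diff)
  consider "r = 0" | "r > 0" "t = 0" | "r > 0" "t = pi" | "r > 0" "0 < t" "t < pi"
    using assms by linarith
  then show ?thesis
  proof cases
    case 1 then show ?thesis by (simp add: model_map_def)
  next
    case 2 then show ?thesis using model_map_upper [of r 0 n1 n2] by simp
  next
    case 3
    then show ?thesis using model_map_upper [of r pi n1 n2] odd [OF assms(4)] odd [OF assms(5)] by simp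
  next
    case 4
    have eq: "cnj (of_real r * cis t) = of_real r * cis (2 * pi - t)"
      by (simp add: cis_cnj complex_eq_iff)
    have "Arg2pi (of_real r * cis (2 * pi - t)) = 2 * pi - t"
      by (rule Arg2pi_unique [OF _ 4(1)]) (use 4 in \<open>auto simp: cis_conv_exp\<close>)
    moreover have "cis (- (2 * real n2 - 1) * (2 * pi - t)) = cis ((2 * real n2 - 1) * t)"
    proof -
      have "- (2 * real n2 - 1) * (2 * pi - t) = (2 * real n2 - 1) * t + 2 * pi * of_int (1 - 2 * int n2)"
        by (simp add: algebra_simps)
      then show ?thesis 
        using cis_multiple_2pi [of "of_int (1 - 2 * int n2)"] by (simp only: cis_mult [symmetric]) simp
    qed
    ultimately show ?thesis using 4 unfolding eq by (simp add: model_map_def norm_mult)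
  qed
qed

text \<open>Only the source is reflected. The minus sign before \<open>cnj (B (cnj z))\<close>
  preserves the imaginary part, hence the target map, and reverses the sign in \<open>sgn_B\<close>;
  so the side of negative Jacobian satisfies the assumptions made for the upper side.\<close>

lemma upper_half_base_conj:
  assumes "upper_half_base M R0 ell eta B H c"
  shows "upper_half_base M R0 (\<lambda>z. cnj (ell (cnj z))) (\<lambda>z. cnj (eta (cnj z)))
    (\<lambda>z. - cnj (B (cnj z))) (\<lambda>z. H (cnj z)) c"
proof -
  interpret up: upper_half_base M R0 ell eta B H c by (rule assms)
  show ?thesis
  proof
    have cb: "cnj z \<in> ball 0 r \<longleftrightarrow> z \<in> ball 0 r" for z r by simp
    have Re_pow: "Re (cnj z ^ M) = Re (z ^ M)" for z by (metis complex_cnj_power complex_cnj(1) cnj.sel(1))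
    show "0 < M" "0 < R0" by (rule up.M_pos up.R0_pos)+
    show "continuous_on (ball 0 R0) (\<lambda>z. cnj (ell (cnj z)))"
      by (intro continuous_intros continuous_on_compose2 [OF up.cont_ell]) auto
    show "continuous_on (ball 0 R0) (\<lambda>z. H (cnj z))"
      by (intro continuous_intros continuous_on_compose2 [OF up.cont_H]) auto
    show "cnj (eta (cnj z)) = z * exp (- cnj (ell (cnj z)))" if "z \<in> ball 0 R0" for z
      using up.eta_eq [of "cnj z"] that by (simp add: exp_cnj)
    show "inj_on (\<lambda>z. cnj (eta (cnj z))) (ball 0 R0)"
      using up.inj_eta unfolding inj_on_def by (metis cb complex_cnj_cnj)
    have "(cnj \<circ> B \<circ> cnj) holomorphic_on (ball 0 R0)"
      by (rule holomorphic_on_compose_cnj_cnj) (use up.hol_B in \<open>auto simp: image_def intro: holomorphic_on_subset\<close>)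
    then show "(\<lambda>z. - cnj (B (cnj z))) holomorphic_on ball 0 R0"
      by (simp add: o_def holomorphic_on_minus)
    show "H (cnj z) = Complex (Re (z ^ M)) (Im (- cnj (B (cnj z))) - c (Re (z ^ M)))" if "z \<in> ball 0 R0" for z
      using up.H_eq [of "cnj z"] that Re_pow by simp
    show "Im (H (cnj z)) = 0" if "z \<in> ball 0 R0" "Im (cnj (eta (cnj z))) = 0" for z
      using up.crit_real [of "cnj z"] that by simp
    show "Re (z ^ M) < Re (w ^ M)"
      if "z \<in> ball 0 R0" "w \<in> ball 0 R0" "Im (cnj (eta (cnj z))) = 0" "Im (cnj (eta (cnj w))) = 0"
        "Re (cnj (eta (cnj z))) < Re (cnj (eta (cnj w)))" for z w
      using up.crit_mono [of "cnj z" "cnj w"] that Re_pow by simp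
    show "sgn (Re (deriv (\<lambda>z. - cnj (B (cnj z))) z / (of_nat M * z ^ (M - 1)))) = sgn (Im (cnj (eta (cnj z))))"
      if "z \<in> ball 0 R0" "z \<noteq> 0" for z
    proof -
      have "(B has_field_derivative deriv B (cnj z)) (at (cnj z))"
        using up.hol_B that by (meson cb holomorphic_derivI open_ball)
      then have "((\<lambda>z. - cnj (B (cnj z))) has_field_derivative - cnj (deriv B (cnj z))) (at z)"
        using has_field_derivative_cnj_cnj [of B "deriv B (cnj z)" z]
        by (intro DERIV_minus) (simp add: o_def)
      then have "deriv (\<lambda>z. - cnj (B (cnj z))) z = - cnj (deriv B (cnj z))" by (rule DERIV_imp_deriv)
      then have "deriv (\<lambda>z. - cnj (B (cnj z))) z / (of_nat M * z ^ (M - 1)) =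
          - cnj (deriv B (cnj z) / (of_nat M * cnj z ^ (M - 1)))" by simp
      then have "Re (deriv (\<lambda>z. - cnj (B (cnj z))) z / (of_nat M * z ^ (M - 1))) =
          - Re (deriv B (cnj z) / (of_nat M * cnj z ^ (M - 1)))" by (simp del: complex_cnj_divide)
      then show ?thesis using up.sgn_B [of "cnj z"] that by (simp add: sgn_minus)
    qed
  qed
qed

text \<open>\<open>k_sum\<close> carries \<open>ell_left\<close> over to the reflected half: the
  quantity bounded there is the negative of the one above. It also makes \<open>k'\<close> odd. The
  \<open>2 * M\<close> half turns of the power are shared between the two sides of the critical
  curve.\<close>

locale fold_chart = up: upper_half M R0 ell eta B H c k R \<rho>
  for M :: nat and R0 :: real and ell eta B H :: "complex \<Rightarrow> complex" and c :: "real \<Rightarrow> real"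
    and k :: nat and R \<rho> :: real +
  fixes k' :: nat
  assumes k'_pos: "0 < k'" and k_sum: "k + k' = 2 * M"
    and lower_nonempty: "\<exists>z\<in>ball 0 R. Im (eta z) < 0 \<and> cmod (H z) < \<rho>"
begin

sublocale low: upper_half M R0 "\<lambda>z. cnj (ell (cnj z))" "\<lambda>z. cnj (eta (cnj z))"
  "\<lambda>z. - cnj (B (cnj z))" "\<lambda>z. H (cnj z)" c k' R \<rho>
proof (intro upper_half.intro upper_half_axioms.intro upper_half_base_conj up.upper_half_base_axioms)
  have Re_pow: "Re (cnj z ^ M) = Re (z ^ M)" for z by (metis complex_cnj_power complex_cnj(1) cnj.sel(1))
  show "0 < k'" "0 < R" "R < R0" "0 < \<rho>" by (rule k'_pos up.R_pos up.R_less up.rho_pos)+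
  show "odd k'" using up.k_odd k_sum by presburger
  show "\<bar>M * Im (cnj (ell (cnj z)))\<bar> < pi / 2"
    if "z \<in> ball 0 R0" "Im (cnj (eta (cnj z))) = 0" "0 < Re (cnj (eta (cnj z)))" for z
    using up.ell_right [of "cnj z"] that by simp
  show "\<bar>M * (pi + Im (cnj (ell (cnj z)))) - k' * pi\<bar> < pi / 2"
    if "z \<in> ball 0 R0" "Im (cnj (eta (cnj z))) = 0" "Re (cnj (eta (cnj z))) < 0" for z
  proof -
    have "real k + real k' = 2 * real M" using k_sum by (metis of_nat_add of_nat_mult of_nat_numeral)
    then have "real k' * pi = 2 * real M * pi - real k * pi" by (metis add_diff_cancel_left' left_diff_distrib)
    then have "M * (pi + Im (cnj (ell (cnj z)))) - k' * pi = - (M * (pi + Im (ell (cnj z))) - k * pi)"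
      by (simp add: algebra_simps)
    then show ?thesis using up.ell_left [of "cnj z"] that by (simp add: abs_minus_commute)
  qed
  show "\<rho> \<le> cmod (H (cnj z))" if "cmod z = R" for z using up.far [of "cnj z"] that by simp
  show "\<exists>z\<in>ball 0 R. Im (cnj (eta (cnj z))) = 0 \<and> Re (z ^ M) = a" if a: "\<bar>a\<bar> < \<rho>" for a
  proof -
    obtain z where "z \<in> ball 0 R" "Im (eta z) = 0" "Re (z ^ M) = a" using up.crit_surj [OF a] by blast
    then show ?thesis using Re_pow [of z] by (intro bexI [of _ "cnj z"]) auto
  qed
  obtain z where "z \<in> ball 0 R" "Im (eta z) < 0" "cmod (H z) < \<rho>" using lower_nonempty by blast
  then show "\<exists>z\<in>ball 0 R. 0 < Im (cnj (eta (cnj z))) \<and> cmod (H (cnj z)) < \<rho>"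
    by (intro bexI [of _ "cnj z"]) auto
qed

definition "U = {z \<in> ball 0 R. cmod (H z) < \<rho>}"
definition "chart z = (if Im (eta z) \<le> 0 then cnj (low.h (cnj z)) else up.h z)"

lemma open_U: "open U"
proof -
  have "continuous_on (ball 0 R) H"
    using up.cont_H up.R_less by (auto intro: continuous_on_subset)
  then have "open (ball 0 R \<inter> (\<lambda>z. cmod (H z)) -` {..<\<rho>})"
    by (intro continuous_open_preimage continuous_intros) auto
  also have "\<dots> = U" by (auto simp: U_def)
  finally show ?thesis .
qed

lemma U_sub: "U \<subseteq> ball 0 R0" using up.R_less by (auto simp: U_def)

lemma chart_real:
  assumes "z \<in> ball 0 R0" "Im (eta z) = 0"
  shows "up.h z = of_real (Re (z ^ M))" "low.h (cnj z) = of_real (Re (z ^ M))" "chart z = of_real (Re (z ^ M))"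
proof -
  have *: "H z = of_real (Re (z ^ M))" using up.H_crit assms by auto
  then show "up.h z = of_real (Re (z ^ M))" using up.h_crit assms by auto
  show "low.h (cnj z) = of_real (Re (z ^ M))" using low.h_crit [of "cnj z"] assms * by simp
  then show "chart z = of_real (Re (z ^ M))" using assms by (simp add: chart_def)
qed

lemma chart_upper: "z \<in> U \<Longrightarrow> 0 < Im (eta z) \<Longrightarrow> 0 < Im (chart z)"
  using up.Im_h_pos [of z] by (simp add: chart_def U_def up.T_def)

lemma chart_lower: "z \<in> U \<Longrightarrow> Im (eta z) < 0 \<Longrightarrow> Im (chart z) < 0"
  using low.Im_h_pos [of "cnj z"] by (simp add: chart_def U_def low.T_def)

lemma sgn_chart: "z \<in> U \<Longrightarrow> sgn (Im (chart z)) = sgn (Im (eta z))"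
  using chart_upper [of z] chart_lower [of z] chart_real(3) [of z] U_sub
  by (cases "Im (eta z)" "0::real" rule: linorder_cases) auto

text \<open>The chart respects the two sides of the critical curve and, on it, both real half-axes,
  so it never points opposite to \<open>eta\<close>. On small circles it is therefore homotopic to a
  conformal map, which decides its orientation.\<close>

lemma chart_over_eta:
  assumes "z \<in> U" "z \<noteq> 0"
  shows "chart z / eta z \<notin> \<real>\<^sub>\<le>\<^sub>0"
proof
  assume "chart z / eta z \<in> \<real>\<^sub>\<le>\<^sub>0"
  then obtain t where t: "chart z / eta z = of_real t" "t \<le> 0" by (auto simp: nonpos_Reals_def)
  have zb: "z \<in> ball 0 R0" using assms U_sub by auto
  have nz: "eta z \<noteq> 0" using up.eta_nz zb assms by auto
  then have eq: "chart z = of_real t * eta z" using t by (simp add: divide_eq_eq)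
  then have "sgn (Im (chart z)) = sgn t * sgn (Im (eta z))" by (simp add: sgn_mult)
  with sgn_chart [OF assms(1)] t have Im0: "Im (eta z) = 0"
    by (auto simp: sgn_real_def split: if_splits)
  have "complex_of_real (Re (z ^ M)) = of_real t * eta z"
    using chart_real(3) [OF zb Im0] eq by simp
  from arg_cong [OF this, of Re] have Re_t: "Re (z ^ M) = t * Re (eta z)" by simp
  have "Re (z ^ M) \<noteq> 0" using up.crit_Re_0 [OF zb Im0] assms(2) by blast
  then consider "0 < Re (z ^ M)" | "Re (z ^ M) < 0" by linarith
  then show False
  proof cases
    case 1
    with up.Re_eta_pos(1) [OF zb Im0] show False
      using mult_nonpos_nonneg [OF t(2), of "Re (eta z)"] Re_t by linarith
  next
    case 2
    with up.Re_eta_pos(2) [OF zb Im0] show False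
      using mult_nonpos_nonpos [OF t(2), of "Re (eta z)"] Re_t by linarith
  qed
qed

lemma cont_chart: "continuous_on U chart"
  unfolding chart_def
proof (rule continuous_on_cases_le)
  show "continuous_on {z \<in> U. Im (eta z) \<le> 0} (\<lambda>z. cnj (low.h (cnj z)))"
    by (intro continuous_intros continuous_on_compose2 [OF low.cont_h]) (auto simp: U_def low.D_def)
  show "continuous_on {z \<in> U. 0 \<le> Im (eta z)} up.h"
    by (rule continuous_on_subset [OF up.cont_h]) (auto simp: U_def up.D_def)
  show "continuous_on U (\<lambda>z. Im (eta z))"
    by (intro continuous_intros continuous_on_subset [OF up.cont_eta U_sub])
  show "cnj (low.h (cnj z)) = up.h z" if "z \<in> U" "Im (eta z) = 0" for z
    using chart_real [of z] that U_sub by auto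
qed

lemma chart_eq:
  assumes "z \<in> U"
  shows "0 \<le> Im (eta z) \<Longrightarrow> chart z = up.h z \<and> z \<in> up.D" 
    "Im (eta z) \<le> 0 \<Longrightarrow> chart z = cnj (low.h (cnj z)) \<and> cnj z \<in> low.D"
  using assms chart_real [of z] U_sub by (auto simp: chart_def U_def up.D_def low.D_def)

lemma inj_chart: "inj_on chart U"
proof (rule inj_onI)
  fix z w assume z: "z \<in> U" and w: "w \<in> U" and eq: "chart z = chart w"
  have s: "sgn (Im (eta z)) = sgn (Im (eta w))" using sgn_chart z w eq by metis
  show "z = w"
  proof (cases "0 \<le> Im (eta z)")
    case True
    then have "0 \<le> Im (eta w)" using s by (auto simp: sgn_real_def split: if_splits)
    then show ?thesis using True chart_eq(1) z w eq up.inj_h by (metis inj_onD)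
  next
    case False
    then have "Im (eta w) \<le> 0" "Im (eta z) \<le> 0" using s by (auto simp: sgn_real_def split: if_splits)
    then show ?thesis using chart_eq(2) z w eq low.inj_h by (metis complex_cnj_cnj inj_onD)
  qed
qed

lemma image_chart: "chart ` U = ball 0 \<rho>"
proof
  show "chart ` U \<subseteq> ball 0 \<rho>"
  proof clarify
    fix z assume z: "z \<in> U"
    have "cmod (chart z) = cmod (H z)"
      unfolding chart_def using up.norm_h low.norm_h by auto
    then show "chart z \<in> ball 0 \<rho>" using z by (simp add: U_def)
  qed
  show "ball 0 \<rho> \<subseteq> chart ` U"
  proof
    fix w :: complex assume w: "w \<in> ball 0 \<rho>"
    show "w \<in> chart ` U"
    proof (cases "0 \<le> Im w")
      case True
      then have "w \<in> up.h ` up.D" unfolding up.image_h using w by simp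
      then obtain z where "z \<in> up.D" "up.h z = w" by blast
      then have "z \<in> U" "0 \<le> Im (eta z)" by (auto simp: U_def up.D_def)
      then show ?thesis using chart_eq(1) \<open>up.h z = w\<close> by (metis imageI)
    next
      case False
      then have "cnj w \<in> low.h ` low.D" unfolding low.image_h using w by simp
      then obtain z where "z \<in> low.D" "low.h z = cnj w" by (elim imageE) simp
      then have "cnj z \<in> U" "Im (eta (cnj z)) \<le> 0" by (auto simp: U_def low.D_def)
      then show ?thesis using chart_eq(2) [of "cnj z"] \<open>low.h z = cnj w\<close> by (metis complex_cnj_cnj imageI)
    qed
  qed
qed

lemma H_model:
  assumes z: "z \<in> U" and k: "k + 1 = 2 * n1" "k' + 1 = 2 * n2"
  shows "H z / of_real \<rho> = model_map n1 n2 (chart z / of_real \<rho>)"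
proof -
  have r: "real k = 2 * real n1 - 1" "real k' = 2 * real n2 - 1"
    using arg_cong [OF k(1), of real] arg_cong [OF k(2), of real] by auto
  have n: "1 \<le> n1" "1 \<le> n2" using k by auto
  define q where "q = cmod (H z) / \<rho>"
  have q: "0 \<le> q" using up.rho_pos by (simp add: q_def)
  show ?thesis
  proof (cases "0 \<le> Im (eta z)")
    case True
    then obtain t :: real where t: "0 \<le> t" "t \<le> pi" "chart z = of_real (cmod (H z)) * cis t" 
        "H z = of_real (cmod (H z)) * cis (real k * t)" using chart_eq(1) z up.h_model by metis
    have "chart z / of_real \<rho> = of_real q * cis t" by (subst t(3)) (simp add: q_def)
    moreover have "H z / of_real \<rho> = of_real q * cis (real k * t)" by (subst t(4)) (simp add: q_def)
    ultimately show ?thesis using model_map_upper [OF q t(1,2), of n1 n2] r by simp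
  next
    case False
    then obtain t :: real where t: "0 \<le> t" "t \<le> pi" "chart z = cnj (of_real (cmod (H z)) * cis t)" 
        "H z = of_real (cmod (H z)) * cis (real k' * t)" 
      using chart_eq(2) [OF z] low.h_model [of "cnj z"] by (auto simp: not_le less_imp_le)
    have "chart z / of_real \<rho> = cnj (of_real q * cis t)" by (subst t(3)) (simp add: q_def)
    moreover have "H z / of_real \<rho> = of_real q * cis (real k' * t)" by (subst t(4)) (simp add: q_def)
    ultimately show ?thesis using model_map_lower [OF q t(1,2) n] r by simp
  qed
qed

end

section \<open>Fibres of the model map\<close>

text \<open>While \<open>t\<close> runs through half a turn, the angle
  \<open>(2 * n - 1) * t\<close> makes \<open>2 * n - 1\<close> half turns. Of these
  \<open>n\<close> sweep the upper and \<open>n - 1\<close> the lower half plane, and each passes a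
  given direction of its half plane once.\<close>

lemma half_turn_solutions:
  assumes n: "1 \<le> n" and phi: "0 < \<phi>" "\<phi> < 2 * pi" "\<phi> \<noteq> pi"
  shows "{t. 0 < t \<and> t < pi \<and> cis ((2 * real n - 1) * t) = cis \<phi>} =
    (\<lambda>i::nat. (\<phi> + 2 * pi * i) / (2 * real n - 1)) ` {..<(if \<phi> < pi then n else n - 1)}"
proof -
  define k where "k = 2 * real n - 1"
  have k: "0 < k" using n by (simp add: k_def)
  have bound: "\<phi> + 2 * pi * real i < k * pi \<longleftrightarrow> i < (if \<phi> < pi then n else n - 1)" for i :: nat
  proof -
    have "\<phi> + 2 * pi * real i < k * pi \<longleftrightarrow> \<phi> - pi < 2 * pi * (real n - 1 - real i)"
      by (simp add: k_def algebra_simps)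
    also have "\<dots> \<longleftrightarrow> i < (if \<phi> < pi then n else n - 1)"
    proof (cases "\<phi> < pi")
      case True
      have "0 \<le> 2 * pi * (real n - 1 - real i)" if "i < n"
        using that by (intro mult_nonneg_nonneg) auto
      moreover have "2 * pi * (real n - 1 - real i) \<le> 2 * pi * (- 1)" if "\<not> i < n"
        using that by (intro mult_left_mono) auto
      ultimately have "\<phi> - pi < 2 * pi * (real n - 1 - real i) \<longleftrightarrow> i < n" using True phi by linarith
      then show ?thesis using True by simp
    next
      case False
      have "2 * pi * 1 \<le> 2 * pi * (real n - 1 - real i)" if "i < n - 1"
        using that by (intro mult_left_mono) auto
      moreover have "2 * pi * (real n - 1 - real i) \<le> 2 * pi * 0" if "\<not> i < n - 1"
        using that by (intro mult_left_mono) auto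
      ultimately have "\<phi> - pi < 2 * pi * (real n - 1 - real i) \<longleftrightarrow> i < n - 1" using False phi by linarith
      then show ?thesis using False by simp
    qed
    finally show ?thesis .
  qed
  show ?thesis
    unfolding k_def [symmetric]
  proof (intro set_eqI iffI)
    fix t assume "t \<in> {t. 0 < t \<and> t < pi \<and> cis (k * t) = cis \<phi>}"
    then have t: "0 < t" "t < pi" "cis (k * t) = cis \<phi>" by auto
    then have "cis (k * t - \<phi>) = 1" by (simp add: cis_divide [symmetric])
    then obtain j :: int where j: "k * t - \<phi> = of_int j * 2 * pi" by (rule cis_eq_1)
    have "0 < k * t" "k * t < k * pi" using t k by auto
    then have "- (2 * pi) < of_int j * 2 * pi" using j phi by linarith
    then have "pi * (- 1) < pi * real_of_int j" by simp
    then have "- 1 < real_of_int j" by (simp only: mult_less_cancel_left_pos pi_gt_zero)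
    then have "0 \<le> j" by linarith
    then obtain i :: nat where i: "j = int i" using nonneg_int_cases by blast
    have eq: "k * t = \<phi> + 2 * pi * real i" using j i by (simp add: algebra_simps)
    then have "i < (if \<phi> < pi then n else n - 1)" using bound \<open>k * t < k * pi\<close> by simp
    moreover have "t = (\<phi> + 2 * pi * real i) / k" using eq k by (simp add: field_simps)
    ultimately show "t \<in> (\<lambda>i::nat. (\<phi> + 2 * pi * i) / k) ` {..<(if \<phi> < pi then n else n - 1)}"
      by blast
  next
    fix t assume "t \<in> (\<lambda>i::nat. (\<phi> + 2 * pi * i) / k) ` {..<(if \<phi> < pi then n else n - 1)}"
    then obtain i :: nat where i: "i < (if \<phi> < pi then n else n - 1)" "t = (\<phi> + 2 * pi * i) / k" by auto
    then have kt: "k * t = \<phi> + 2 * pi * real i" using k by simp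
    moreover have "k * t < k * pi" using bound i(1) kt by simp
    moreover have "0 < t" unfolding i(2) using k phi by (intro divide_pos_pos add_pos_nonneg) auto
    moreover have "cis (\<phi> + 2 * pi * real i) = cis \<phi>"
      using cis_multiple_2pi [of "real i"] by (simp add: cis_mult [symmetric])
    ultimately show "t \<in> {t. 0 < t \<and> t < pi \<and> cis (k * t) = cis \<phi>}"
      using k mult_less_cancel_left_pos [of k t pi] by simp
  qed
qed

lemma card_half_turn_solutions:
  assumes n: "1 \<le> n" and phi: "0 < \<phi>" "\<phi> < 2 * pi" "\<phi> \<noteq> pi"
  shows "finite {t. 0 < t \<and> t < pi \<and> cis ((2 * real n - 1) * t) = cis \<phi>}"
    "card {t. 0 < t \<and> t < pi \<and> cis ((2 * real n - 1) * t) = cis \<phi>} = (if \<phi> < pi then n else n - 1)"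
proof -
  have "inj_on (\<lambda>i::nat. (\<phi> + 2 * pi * i) / (2 * real n - 1)) X" for X
    using n by (auto simp: inj_on_def divide_simps)
  then show "finite {t. 0 < t \<and> t < pi \<and> cis ((2 * real n - 1) * t) = cis \<phi>}"
    "card {t. 0 < t \<and> t < pi \<and> cis ((2 * real n - 1) * t) = cis \<phi>} = (if \<phi> < pi then n else n - 1)"
    unfolding half_turn_solutions [OF assms] by (simp_all add: card_image)
qed

lemma inj_on_half_circle: "0 < r \<Longrightarrow> inj_on (\<lambda>t. of_real r * cis t) {0..pi}"
  by (auto simp: inj_on_def complex_eq_iff cos_inj_pi)

lemma model_fibre:
  assumes n: "1 \<le> n1" "1 \<le> n2" and w: "w \<in> ball 0 1" "Im w \<noteq> 0"
  shows "finite {v \<in> ball 0 1. model_map n1 n2 v = w}"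
    "card {v \<in> ball 0 1. model_map n1 n2 v = w} = (if 0 < Im w then n1 + n2 else n1 + n2 - 2)"
proof -
  define r where "r = cmod w"
  define \<phi> where "\<phi> = Arg2pi w"
  have w0: "w \<noteq> 0" using w by auto
  have r: "0 < r" "r < 1" using w w0 by (auto simp: r_def)
  have wr: "w = of_real r * cis \<phi>"
    using Arg2pi_eq [of w] by (simp add: r_def \<phi>_def cis_conv_exp)
  have Imw: "Im w = r * sin \<phi>" by (simp add: wr)
  have phi: "0 < \<phi>" "\<phi> < 2 * pi" "\<phi> \<noteq> pi"
  proof -
    show "\<phi> < 2 * pi" unfolding \<phi>_def by (rule Arg2pi_lt_2pi)
    show "\<phi> \<noteq> pi" using w(2) Imw by auto
    have "0 \<le> \<phi>" unfolding \<phi>_def by (rule Arg2pi_ge_0)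
    moreover have "\<phi> \<noteq> 0" using w(2) Imw by auto
    ultimately show "0 < \<phi>" by simp
  qed
  have pos: "0 < Im w \<longleftrightarrow> \<phi> < pi"
  proof
    assume "0 < Im w"
    then have "0 < sin \<phi>" using Imw r by (simp add: zero_less_mult_iff)
    then show "\<phi> < pi" using sin_lt_zero [of \<phi>] phi by (metis linorder_neqE_linordered_idom not_less_iff_gr_or_eq)
  next
    assume "\<phi> < pi" then show "0 < Im w" using Imw r phi sin_gt_zero by simp
  qed
  define A where "A n = {t. 0 < t \<and> t < pi \<and> cis ((2 * real n - 1) * t) = cis \<phi>}" for n :: nat
  have A: "finite (A n)" "card (A n) = (if \<phi> < pi then n else n - 1)" if "1 \<le> n" for n
    using card_half_turn_solutions [OF that phi] by (simp_all add: A_def)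
  define X where "X = (\<lambda>t. of_real r * cis t) ` A n1"
  define Y where "Y = (\<lambda>t. cnj (of_real r * cis t)) ` A n2"
  have sub: "A n \<subseteq> {0..pi}" for n by (auto simp: A_def)
  have cX: "card X = card (A n1)" unfolding X_def
    by (intro card_image inj_on_subset [OF inj_on_half_circle [OF r(1)] sub])
  have "inj_on (\<lambda>t. cnj (of_real r * cis t)) (A n2)"
    using inj_on_subset [OF inj_on_half_circle [OF r(1)] sub [of n2]] by (auto simp: inj_on_def)
  then have cY: "card Y = card (A n2)" unfolding Y_def by (rule card_image)
  have "X \<inter> Y = {}"
  proof -
    have "0 < Im v" if "v \<in> X" for v using that r by (auto simp: X_def A_def sin_gt_zero)
    moreover have "Im v < 0" if "v \<in> Y" for v using that r by (auto simp: Y_def A_def sin_gt_zero)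
    ultimately show ?thesis by fastforce
  qed
  have eq: "{v \<in> ball 0 1. model_map n1 n2 v = w} = X \<union> Y"
  proof (intro equalityI subsetI)
    fix v assume "v \<in> X \<union> Y"
    then show "v \<in> {v \<in> ball 0 1. model_map n1 n2 v = w}"
    proof
      assume "v \<in> X"
      then obtain t where t: "t \<in> A n1" "v = of_real r * cis t" by (auto simp: X_def)
      then have "model_map n1 n2 v = w" 
        using model_map_upper [of r t n1 n2] r wr by (simp add: A_def)
      then show ?thesis using t r by (simp add: norm_mult)
    next
      assume "v \<in> Y"
      then obtain t where t: "t \<in> A n2" "v = cnj (of_real r * cis t)" by (auto simp: Y_def)
      then have "model_map n1 n2 v = w" 
        using model_map_lower [of r t n1 n2] n r wr by (simp add: A_def)
      then show ?thesis using t r by (simp add: norm_mult)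
    qed
  next
    fix v assume "v \<in> {v \<in> ball 0 1. model_map n1 n2 v = w}"
    then have v: "model_map n1 n2 v = w" by auto
    have v0: "v \<noteq> 0" using v w0 by (auto simp: model_map_def)
    show "v \<in> X \<union> Y"
    proof (cases "0 \<le> Im v")
      case True
      define t where "t = upper_arg v"
      have t: "v = of_real (cmod v) * cis t" "0 \<le> t" "t \<le> pi"
        using cis_upper_arg [OF v0] upper_arg_bounds [OF v0 True] by (auto simp: t_def)
      then have m: "w = of_real (cmod v) * cis ((2 * real n1 - 1) * t)"
        using model_map_upper [of "cmod v" t n1 n2] v by simp
      then have cv: "cmod v = r" by (simp add: r_def norm_mult)
      have "t \<noteq> 0" using m w(2) by auto
      moreover have "t \<noteq> pi"
      proof
        assume "t = pi"
        then have "w = of_real (cmod v) * cis (real (2 * n1 - 1) * pi)" using m n by (simp add: of_nat_diff)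
        then show False using cis_odd_pi [of "2 * n1 - 1"] n w(2) by simp
      qed
      moreover have "cis ((2 * real n1 - 1) * t) = cis \<phi>" using m cv wr r by simp
      ultimately have "t \<in> A n1" using t by (simp add: A_def)
      then show ?thesis using t(1) cv by (auto simp: X_def)
    next
      case False
      define t where "t = upper_arg (cnj v)"
      have "cnj v = of_real (cmod v) * cis t" and t: "0 \<le> t" "t \<le> pi"
        using cis_upper_arg [of "cnj v"] upper_arg_bounds [of "cnj v"] v0 False by (auto simp: t_def)
      then have vt: "v = cnj (of_real (cmod v) * cis t)" by (metis complex_cnj_cnj)
      then have m: "w = of_real (cmod v) * cis ((2 * real n2 - 1) * t)"
        using model_map_lower [of "cmod v" t n1 n2] v t n by simp
      then have cv: "cmod v = r" by (simp add: r_def norm_mult)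
      have "t \<noteq> 0" using m w(2) by auto
      moreover have "t \<noteq> pi"
      proof
        assume "t = pi"
        then have "w = of_real (cmod v) * cis (real (2 * n2 - 1) * pi)" using m n by (simp add: of_nat_diff)
        then show False using cis_odd_pi [of "2 * n2 - 1"] n w(2) by simp
      qed
      moreover have "cis ((2 * real n2 - 1) * t) = cis \<phi>" using m cv wr r by simp
      ultimately have "t \<in> A n2" using t by (simp add: A_def)
      then show ?thesis using vt cv by (auto simp: Y_def)
    qed
  qed
  have fin: "finite X" "finite Y" using A n by (auto simp: X_def Y_def)
  then show "finite {v \<in> ball 0 1. model_map n1 n2 v = w}" unfolding eq by simp
  have "card (X \<union> Y) = card (A n1) + card (A n2)"
    using card_Un_disjoint [OF fin \<open>X \<inter> Y = {}\<close>] cX cY by simp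
  then show "card {v \<in> ball 0 1. model_map n1 n2 v = w} = (if 0 < Im w then n1 + n2 else n1 + n2 - 2)"
    unfolding eq using A n pos by (auto simp: numeral_2_eq_2)
qed

lemma norm_model_map: "cmod (model_map n1 n2 v) = cmod v"
  by (simp add: model_map_def norm_mult)

text \<open>In the model the critical values form the real diameter and the sectors are half discs.
  The homeomorphisms transport components and fibres, and the larger fibres sit over the upper half
  disc. The fold is the case where the smaller fibres are empty.\<close>

lemma fibre_cardinalities_model:
  assumes n: "1 \<le> n1" "1 \<le> n2"
    and h1: "homeomorphism U (ball 0 1) h1 g1" and h2: "homeomorphism UNIV UNIV h2 g2"
    and model: "\<forall>z\<in>ball 0 1. h2 (f (g1 z)) = model_map n1 n2 z"
    and \<beta>: "\<beta> = h2 -` {w \<in> ball 0 1. Im w = 0}"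
  shows "fibre_cardinalities f U (h2 -` ball 0 1) \<beta> n1 n2"
proof -
  define S1 where "S1 = h2 -` (ball 0 1 \<inter> {w. 0 < Im w})"
  define S2 where "S2 = h2 -` (ball 0 1 \<inter> {w. Im w < 0})"
  have g2: "g2 (h2 x) = x" "h2 (g2 y) = y" for x y
    using h2 by (auto simp: homeomorphism_def)
  have cont: "continuous_on UNIV h2" "continuous_on UNIV g2" using h2 by (auto simp: homeomorphism_def)
  have vimage: "h2 -` A = g2 ` A" for A
    using g2 by (auto intro: rev_image_eqI)
  have conn: "connected (h2 -` A)" if "convex A" for A
    unfolding vimage using that by (intro connected_continuous_image continuous_on_subset [OF cont(2)] convex_connected) auto
  have op: "open (h2 -` A)" if "open A" for A
    using cont(1) that by (metis continuous_on_open_vimage open_UNIV inf_top.right_neutral Int_UNIV_right)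
  have S: "connected S1" "connected S2" "open S1" "open S2" unfolding S1_def S2_def
    by (intro conn op convex_Int open_Int convex_ball convex_halfspace_Im_gt convex_halfspace_Im_lt 
         open_halfspace_Im_gt open_halfspace_Im_lt open_ball)+
  have "g2 (\<i> / 2) \<in> S1" "g2 (- \<i> / 2) \<in> S2"
    using g2 by (auto simp: S1_def S2_def norm_divide)
  then have ne: "S1 \<noteq> {}" "S2 \<noteq> {}" by auto
  have disj: "S1 \<inter> S2 = {}" by (auto simp: S1_def S2_def)
  have Vb: "h2 -` ball 0 1 - \<beta> = S1 \<union> S2"
    unfolding \<beta> by (auto simp: S1_def S2_def)
  have comp: "components (h2 -` ball 0 1 - \<beta>) = {S1, S2}"
    by (rule components_open_unique) (use S ne disj Vb in \<open>auto simp: pairwise_def disjnt_def\<close>)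
  have fib: "{w \<in> U. f w = z} = g1 ` {v \<in> ball 0 1. model_map n1 n2 v = h2 z}" for z
  proof (intro equalityI subsetI)
    fix w assume "w \<in> {w \<in> U. f w = z}"
    then have "h1 w \<in> ball 0 1" "g1 (h1 w) = w" "f w = z" using h1 by (auto simp: homeomorphism_def)
    then show "w \<in> g1 ` {v \<in> ball 0 1. model_map n1 n2 v = h2 z}" using model 
      by (intro rev_image_eqI [of "h1 w"]) (auto dest: bspec [of _ _ "h1 w"])
  next
    fix w assume "w \<in> g1 ` {v \<in> ball 0 1. model_map n1 n2 v = h2 z}"
    then obtain v where v: "w = g1 v" "v \<in> ball 0 1" "model_map n1 n2 v = h2 z" by auto
    then have "w \<in> U" using h1 by (auto simp: homeomorphism_def)
    moreover have "h2 (f w) = h2 z" using model v by auto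
    then have "f w = z" using g2 by metis
    ultimately show "w \<in> {w \<in> U. f w = z}" by auto
  qed
  have "inj_on g1 (ball 0 1)" using h1 by (auto simp: homeomorphism_def intro: inj_on_inverseI)
  then have card: "finite {w \<in> U. f w = z} = finite {v \<in> ball 0 1. model_map n1 n2 v = h2 z}"
    "card {w \<in> U. f w = z} = card {v \<in> ball 0 1. model_map n1 n2 v = h2 z}" for z
    unfolding fib by (auto intro!: finite_image_iff card_image elim: inj_on_subset)
  have c1: "finite {w \<in> U. f w = z} \<and> card {w \<in> U. f w = z} = n1 + n2" if "z \<in> S1" for z
    using model_fibre [OF n, of "h2 z"] that card by (simp add: S1_def)
  have c2: "finite {w \<in> U. f w = z} \<and> card {w \<in> U. f w = z} = n1 + n2 - 2" if "z \<in> S2" for z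
    using model_fibre [OF n, of "h2 z"] that card by (simp add: S2_def)
  have sub: "f ` U - \<beta> \<subseteq> S1 \<union> S2"
  proof
    fix z assume z: "z \<in> f ` U - \<beta>"
    then obtain w where w: "w \<in> U" "z = f w" by auto
    then have "h1 w \<in> ball 0 1" "g1 (h1 w) = w" using h1 by (auto simp: homeomorphism_def)
    then have "h2 z \<in> ball 0 1" using model w norm_model_map by (metis mem_ball_0)
    then show "z \<in> S1 \<union> S2" using z Vb by auto
  qed
  have mem: "z \<in> f ` U \<longleftrightarrow> {w \<in> U. f w = z} \<noteq> {}" for z by auto
  have img1: "S1 \<subseteq> f ` U - \<beta>"
  proof
    fix z assume "z \<in> S1"
    then have "card {w \<in> U. f w = z} \<noteq> 0" using c1 n by auto
    then have "z \<in> f ` U" using mem by (metis card.empty)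
    then show "z \<in> f ` U - \<beta>" using \<open>z \<in> S1\<close> Vb by auto
  qed
  have img2: "if n1 + n2 = 2 then S2 \<inter> f ` U = {} else S2 \<subseteq> f ` U - \<beta>"
  proof (cases "n1 + n2 = 2")
    case True
    have "z \<notin> f ` U" if "z \<in> S2" for z
    proof -
      have "finite {w \<in> U. f w = z}" "card {w \<in> U. f w = z} = 0" using c2 [OF that] True by auto
      then have "{w \<in> U. f w = z} = {}" by (simp only: card_0_eq)
      then show ?thesis using mem by blast
    qed
    then show ?thesis using True by auto
  next
    case False
    have "z \<in> f ` U - \<beta>" if "z \<in> S2" for z
    proof -
      have "card {w \<in> U. f w = z} \<noteq> 0" using c2 [OF that] False n by simp
      then have "z \<in> f ` U" using mem by (metis card.empty)
      then show ?thesis using that Vb by auto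
    qed
    then show ?thesis using False by auto
  qed
  have img: "f ` U - \<beta> = (if n1 + n2 = 2 then S1 else S1 \<union> S2)"
  proof (cases "n1 + n2 = 2")
    case True
    then have "S2 \<inter> f ` U = {}" using img2 by simp
    then have "f ` U - \<beta> = S1" using sub img1 by blast
    then show ?thesis using True by simp
  next
    case False
    then have "S2 \<subseteq> f ` U - \<beta>" using img2 by simp
    then have "f ` U - \<beta> = S1 \<union> S2" using sub img1 by blast
    then show ?thesis using False by simp
  qed
  have "S1 \<noteq> S2" using disj ne by auto
  show ?thesis
    unfolding fibre_cardinalities_def
    by (intro exI [of _ S1] exI [of _ S2] conjI comp img \<open>S1 \<noteq> S2\<close> ballI)
       (use c1 c2 in auto)
qed

section \<open>Orientation\<close>

text \<open>A quotient off the nonpositive reals means that the segment from \<open>p t\<close> to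
  \<open>q t\<close> misses 0, so the linear homotopy is admissible.\<close>

lemma winding_number_ratio:
  assumes "path p" "path q" "pathfinish p = pathstart p" "pathfinish q = pathstart q"
    and "\<And>t. t \<in> {0..1} \<Longrightarrow> p t \<noteq> 0 \<and> q t / p t \<notin> \<real>\<^sub>\<le>\<^sub>0"
  shows "winding_number q 0 = winding_number p 0"
proof -
  have "0 \<notin> closed_segment (p t) (q t)" if t: "t \<in> {0..1}" for t
  proof
    assume "0 \<in> closed_segment (p t) (q t)"
    then obtain u where u: "0 \<le> u" "u \<le> 1" "0 = (1 - u) *\<^sub>R p t + u *\<^sub>R q t"
      by (auto simp: in_segment)
    have p: "p t \<noteq> 0" "q t / p t \<notin> \<real>\<^sub>\<le>\<^sub>0" using assms(5) [OF t] by auto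
    have "u \<noteq> 0" using u p by auto
    have "of_real u * q t = - (of_real (1 - u) * p t)"
      using u(3) by (simp add: scaleR_conv_of_real eq_neg_iff_add_eq_0 add.commute)
    then have "q t / p t = of_real (- (1 - u) / u)"
      using p \<open>u \<noteq> 0\<close> by (simp add: field_simps)
    moreover have "- (1 - u) / u \<le> 0" using u by (simp add: divide_nonpos_nonneg)
    ultimately show False using p(2) by (metis nonpos_Reals_of_real_iff)
  qed
  then have "homotopic_loops (- {0}) p q"
    using assms(1-4) by (intro homotopic_loops_linear) auto
  then show ?thesis by (simp add: winding_number_homotopic_loops)
qed

lemma csqrt_notin_nonpos_Reals: "a \<noteq> 0 \<Longrightarrow> csqrt a \<notin> \<real>\<^sub>\<le>\<^sub>0"
proof -
  assume "a \<noteq> 0"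
  have "c \<notin> \<real>\<^sub>\<le>\<^sub>0" if "0 < Re c \<or> Re c = 0 \<and> 0 \<le> Im c" "c \<noteq> 0" for c
    using that by (auto simp: complex_nonpos_Reals_iff complex_eq_iff)
  from this [OF csqrt_principal [of a]] \<open>a \<noteq> 0\<close> show ?thesis by simp
qed

text \<open>For negative real \<open>a\<close> the direct segment passes through 0. Multiplying
  twice by \<open>csqrt a\<close>, which avoids the nonpositive reals, gives two admissible
  steps.\<close>

lemma winding_number_scaled_circle:
  assumes "a \<noteq> 0" "0 < r"
  shows "winding_number (\<lambda>t. a * (circlepath z r t - z)) 0 = 1"
proof -
  have path: "path (\<lambda>t. b * (circlepath z r t - z))" for b
    unfolding path_def circlepath by (intro continuous_intros)
  have loop: "pathfinish (\<lambda>t. b * (circlepath z r t - z)) = pathstart (\<lambda>t. b * (circlepath z r t - z))" for b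
    by (simp add: pathfinish_def pathstart_def circlepath)
  have nz: "circlepath z r t - z \<noteq> 0" for t using assms by (simp add: circlepath)
  let ?c = "csqrt a"
  have c: "?c \<noteq> 0" "?c \<notin> \<real>\<^sub>\<le>\<^sub>0" using assms csqrt_notin_nonpos_Reals by auto
  have cc: "?c * ?c = a" by (metis power2_csqrt power2_eq_square)
  have "winding_number (\<lambda>t. a * (circlepath z r t - z)) 0 = winding_number (\<lambda>t. ?c * (circlepath z r t - z)) 0"
  proof (rule winding_number_ratio [OF path path loop loop])
    show "?c * (circlepath z r t - z) \<noteq> 0 \<and>
        a * (circlepath z r t - z) / (?c * (circlepath z r t - z)) \<notin> \<real>\<^sub>\<le>\<^sub>0" for t
      using nz [of t] c assms cc by (metis mult_divide_mult_cancel_right mult_eq_0_iff nonzero_mult_div_cancel_left)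
  qed
  also have "\<dots> = winding_number (\<lambda>t. 1 * (circlepath z r t - z)) 0"
    by (rule winding_number_ratio [OF path path loop loop]) (use nz c in auto)
  also have "\<dots> = winding_number (circlepath z r) z"
    by (simp add: winding_number_offset [of _ z])
  finally show ?thesis by (simp add: winding_number_circlepath_centre assms)
qed

text \<open>Centre and radius move linearly. By injectivity the values on the moving circle differ
  from the value at its centre, so the differences form a homotopy of loops off 0.\<close>

lemma winding_number_injective_segment:
  assumes h: "continuous_on U h" "inj_on h U"
    and r: "0 < r" "0 < r'"
    and sub: "\<And>u. u \<in> {0..1} \<Longrightarrow> cball ((1 - u) *\<^sub>R z + u *\<^sub>R z') ((1 - u) * r + u * r') \<subseteq> U"
  shows "winding_number (h \<circ> circlepath z r) (h z) = winding_number (h \<circ> circlepath z' r') (h z')"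
proof -
  define ce where "ce u = (1 - u) *\<^sub>R z + u *\<^sub>R z'" for u
  define ra where "ra u = (1 - u) * r + u * r'" for u
  have ra: "0 < ra u" if "u \<in> {0..1}" for u
    using that r unfolding ra_def by (cases "u = 1") (auto intro!: add_pos_nonneg mult_pos_pos)
  have cin: "ce u + of_real (ra u) * cis (2 * pi * t) \<in> U" "ce u \<in> U" if "u \<in> {0..1}" for u t
    using sub [OF that] ra [OF that] by (auto simp: ce_def ra_def [symmetric] subset_iff dist_norm norm_mult)
  define k where "k = (\<lambda>(u, t). h (ce u + of_real (ra u) * cis (2 * pi * t)) - h (ce u))"
  have circ: "circlepath w s t = w + of_real s * cis (2 * pi * t)" for w s t
    by (simp add: circlepath cis_conv_exp mult_ac)
  have cont: "continuous_on S (\<lambda>x. ce (fst x))" "continuous_on S (\<lambda>x. ra (fst x))" for S :: "(real \<times> real) set"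
    unfolding ce_def ra_def by (intro continuous_intros)+
  have "continuous_on ({0..1} \<times> {0..1}) k"
    unfolding k_def case_prod_beta
    by (intro continuous_intros continuous_on_compose2 [OF h(1)] cont) (use cin in auto)
  moreover have "k \<in> ({0..1} \<times> {0..1}) \<rightarrow> - {0}"
  proof -
    have "h (ce u + of_real (ra u) * cis (2 * pi * t)) \<noteq> h (ce u)" if "u \<in> {0..1}" for u t
      using inj_onD [OF h(2) _ cin [OF that]] ra [OF that] by fastforce
    then show ?thesis by (auto simp: k_def)
  qed
  ultimately have "homotopic_loops (- {0}) (\<lambda>t. (h \<circ> circlepath z r) t - h z) (\<lambda>t. (h \<circ> circlepath z' r') t - h z')"
    unfolding homotopic_loops
    by (intro exI [of _ k]) (auto simp: k_def ce_def ra_def circ pathstart_def pathfinish_def)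
  then have "winding_number (\<lambda>t. (h \<circ> circlepath z r) t - h z) 0 = winding_number (\<lambda>t. (h \<circ> circlepath z' r') t - h z') 0"
    by (rule winding_number_homotopic_loops)
  then show ?thesis
    using winding_number_offset [of "h \<circ> circlepath z r" "h z"] winding_number_offset [of "h \<circ> circlepath z' r'" "h z'"]
    by simp
qed

text \<open>The segment homotopy shows independence of the radius and local constancy in the centre;
  connectedness does the rest. \<open>e\<close> picks an admissible radius at each point.\<close>

lemma winding_number_injective_const:
  assumes "open U" "connected U" and h: "continuous_on U h" "inj_on h U"
    and z: "0 < r" "cball z r \<subseteq> U" and z': "0 < r'" "cball z' r' \<subseteq> U"
  shows "winding_number (h \<circ> circlepath z r) (h z) = winding_number (h \<circ> circlepath z' r') (h z')"
proof -
  define e where "e x = (SOME s. 0 < s \<and> cball x s \<subseteq> U)" for x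
  have e: "0 < e x" "cball x (e x) \<subseteq> U" if "x \<in> U" for x
  proof -
    obtain s where "0 < s \<and> cball x s \<subseteq> U" using \<open>open U\<close> \<open>x \<in> U\<close> open_contains_cball by blast
    then have "0 < e x \<and> cball x (e x) \<subseteq> U" unfolding e_def by (rule someI)
    then show "0 < e x" "cball x (e x) \<subseteq> U" by auto
  qed
  define W where "W x s = winding_number (h \<circ> circlepath x s) (h x)" for x s
  have radius: "W x s = W x s'" if "0 < s" "cball x s \<subseteq> U" "0 < s'" "cball x s' \<subseteq> U" for x s s'
    unfolding W_def
  proof (rule winding_number_injective_segment [OF h that(1,3)])
    fix u :: real assume u: "u \<in> {0..1}"
    have "(1 - u) * s + u * s' \<le> max s s'" using u by (intro convex_bound_le) auto
    then have "cball x ((1 - u) * s + u * s') \<subseteq> cball x (max s s')" by (rule subset_cball)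
    moreover have x: "(1 - u) *\<^sub>R x + u *\<^sub>R x = x" by (simp add: scaleR_left_diff_distrib)
    moreover have "cball x (max s s') \<subseteq> U" using that by (auto simp: max_def)
    ultimately show "cball ((1 - u) *\<^sub>R x + u *\<^sub>R x) ((1 - u) * s + u * s') \<subseteq> U"
      unfolding x by blast
  qed
  have "(\<lambda>x. W x (e x)) constant_on U"
  proof (rule locally_constant_imp_constant [OF \<open>connected U\<close>])
    fix a assume a: "a \<in> U"
    define s where "s = e a / 2"
    have s: "0 < s" "cball a (2 * s) \<subseteq> U" using e [OF a] by (auto simp: s_def)
    have sub: "cball y s \<subseteq> U" if "y \<in> ball a s" for y
    proof -
      have "cball y s \<subseteq> cball a (2 * s)" 
      proof
        fix w assume "w \<in> cball y s"
        then show "w \<in> cball a (2 * s)" using that dist_triangle [of a w y] by simp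
      qed
      then show ?thesis using s by auto
    qed
    have W: "W x (e x) = W a (e a)" if x: "x \<in> ball a s" for x
    proof -
      have xU: "x \<in> U" using sub [OF x] s by auto
      have "W a s = W x s"
        unfolding W_def
      proof (rule winding_number_injective_segment [OF h s(1) s(1)])
        fix u :: real assume u: "u \<in> {0..1}"
        have c: "(1 - u) *\<^sub>R a + u *\<^sub>R x \<in> ball a s"
          using convexD_alt [OF convex_ball [of a s], of a x u] x s u by simp
        have s': "(1 - u) * s + u * s = s" by (simp add: algebra_simps)
        show "cball ((1 - u) *\<^sub>R a + u *\<^sub>R x) ((1 - u) * s + u * s) \<subseteq> U"
          unfolding s' by (rule sub [OF c])
      qed
      moreover have "W a s = W a (e a)" by (rule radius) (use s(1) e [OF a] sub [of a] in auto)
      moreover have "W x s = W x (e x)" by (rule radius) (use s(1) e [OF xU] sub [OF x] in auto)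
      ultimately show ?thesis by simp
    qed
    have "ball a s \<subseteq> U"
    proof
      fix y assume "y \<in> ball a s"
      from sub [OF this] show "y \<in> U" using s by auto
    qed
    then have "openin (top_of_set U) (ball a s)" by (simp add: open_subset)
    moreover have "a \<in> ball a s" using s(1) by simp
    ultimately show "\<exists>T. openin (top_of_set U) T \<and> a \<in> T \<and> (\<forall>x\<in>T. W x (e x) = W a (e a))"
      using W by blast
  qed
  moreover have zU: "z \<in> U" "z' \<in> U" using z z' by auto
  ultimately have "W z (e z) = W z' (e z')" by (auto simp: constant_on_def)
  then show ?thesis
    using radius [OF z e [OF zU(1)]] radius [OF z' e [OF zU(2)]] unfolding W_def by argo
qed

text \<open>On a small circle \<open>h\<close>, \<open>g\<close> and the linear part of \<open>g\<close> are joined by segments avoiding 0.\<close>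

lemma orientation_preserving_near_conformal:
  assumes U: "open U" "connected U" "a \<in> U" and h: "continuous_on U h" "inj_on h U" "h a = 0"
    and g: "g holomorphic_on U" "inj_on g U" "g a = 0"
    and ratio: "\<And>z. z \<in> U \<Longrightarrow> z \<noteq> a \<Longrightarrow> h z / g z \<notin> \<real>\<^sub>\<le>\<^sub>0"
  shows "orientation_preserving_on U h"
proof -
  define d where "d = deriv g a"
  have d: "d \<noteq> 0" unfolding d_def
    using holomorphic_injective_imp_regular [OF g(1) U(1) g(2) U(3)] .
  have gd: "(g has_field_derivative d) (at a)" unfolding d_def
    using g(1) U by (meson holomorphic_derivI)
  then have "(\<lambda>z. (g z - g a) / (z - a)) \<midarrow>a\<rightarrow> d" by (simp add: has_field_derivative_iff)
  then have "(\<lambda>z. (g z / (z - a)) / d) \<midarrow>a\<rightarrow> d / d" 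
    using d g(3) by (intro tendsto_divide) auto
  then have "\<forall>\<^sub>F z in at a. dist ((g z / (z - a)) / d) 1 < 1" 
    using d by (intro tendstoD) auto
  then obtain s where s: "0 < s" "\<And>z. z \<noteq> a \<Longrightarrow> dist z a < s \<Longrightarrow> dist ((g z / (z - a)) / d) 1 < 1"
    by (auto simp: eventually_at)
  obtain r0 where r0: "0 < r0" "cball a r0 \<subseteq> U" using U open_contains_cball by blast
  define r where "r = min r0 (s / 2)"
  have r: "0 < r" "r < s" "cball a r \<subseteq> U" using r0 s(1) by (auto simp: r_def)
  have circ: "circlepath a r t \<noteq> a" "dist (circlepath a r t) a < s" "circlepath a r t \<in> U" for t
  proof -
    have "dist (circlepath a r t) a = r" using r by (simp add: circlepath dist_norm norm_mult)
    then show "circlepath a r t \<noteq> a" "dist (circlepath a r t) a < s" "circlepath a r t \<in> U"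
      using r by (auto simp: dist_commute)
  qed
  have contg: "continuous_on U g" using g(1) by (rule holomorphic_on_imp_continuous_on)
  have pc: "path (circlepath a r)" "pathfinish (circlepath a r) = pathstart (circlepath a r)" by auto
  have img: "path_image (circlepath a r) \<subseteq> U" using circ by (auto simp: path_image_def)
  have path: "path (h \<circ> circlepath a r)" "path (g \<circ> circlepath a r)"
    by (intro path_continuous_image pc continuous_on_subset [OF h(1) img] continuous_on_subset [OF contg img])+
  have pathd: "path (\<lambda>t. d * (circlepath a r t - a))"
    unfolding path_def circlepath by (intro continuous_intros)
  have gnz: "g z \<noteq> 0" if "z \<in> U" "z \<noteq> a" for z
    using g(2,3) that U(3) by (metis inj_onD)
  have "winding_number (h \<circ> circlepath a r) 0 = winding_number (g \<circ> circlepath a r) 0"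
    by (rule winding_number_ratio) (use path circ ratio gnz in \<open>auto simp: pathfinish_compose pathstart_compose\<close>)
  also have "\<dots> = winding_number (\<lambda>t. d * (circlepath a r t - a)) 0"
  proof (rule winding_number_ratio)
    fix t :: real
    let ?z = "circlepath a r t"
    have "dist ((g ?z / (?z - a)) / d) 1 < 1" using s(2) circ by auto
    then have "0 < Re ((g ?z / (?z - a)) / d)"
      using abs_Re_le_cmod [of "(g ?z / (?z - a)) / d - 1"] by (simp add: dist_norm) 
    then have "(g ?z / (?z - a)) / d \<notin> \<real>\<^sub>\<le>\<^sub>0" by (auto simp: complex_nonpos_Reals_iff)
    then show "d * (?z - a) \<noteq> 0 \<and> (g \<circ> circlepath a r) t / (d * (?z - a)) \<notin> \<real>\<^sub>\<le>\<^sub>0"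
      using d circ [of t] by (simp add: mult.commute)
  qed (use path pathd in \<open>auto simp: pathfinish_compose pathstart_compose pathfinish_def pathstart_def circlepath\<close>)
  also have "\<dots> = 1" by (rule winding_number_scaled_circle [OF d r(1)])
  finally have "winding_number (h \<circ> circlepath a r) (h a) = 1" using h(3) by simp
  then show ?thesis
    unfolding orientation_preserving_on_def
    using winding_number_injective_const [OF U(1,2) h(1,2) r(1,3)] by simp
qed

section \<open>Shears of the target plane\<close>

definition shear :: "(real \<Rightarrow> real) \<Rightarrow> complex \<Rightarrow> complex" where
  "shear c w = Complex (Re w) (Im w - c (Re w))"

lemma continuous_on_shear: "continuous_on UNIV c \<Longrightarrow> continuous_on S (shear c)"
  unfolding shear_def Complex_eq
  by (intro continuous_intros continuous_on_compose2 [of UNIV c S Re]) auto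

text \<open>With \<open>c\<close> only continuous, orientation cannot be read off from a derivative.
  But the shear keeps real parts: an increment of \<open>h\<close> can oppose the increment of the
  linear map only if its real part is 0, and then the shear displaces both points equally.\<close>

lemma shear_homeomorphism:
  fixes b e :: complex and \<rho> :: real
  assumes c: "continuous_on UNIV c" "c 0 = 0" and e: "e \<noteq> 0" and \<rho>: "0 < \<rho>"
  defines "h \<equiv> \<lambda>w. shear c (e * (w - b)) / of_real \<rho>"
  obtains g where "homeomorphism UNIV UNIV h g" "orientation_preserving_on UNIV h" "h b = 0"
proof -
  define g where "g v = b + shear (\<lambda>x. - c x) (of_real \<rho> * v) / e" for v
  have inv: "shear (\<lambda>x. - c x) (shear c w) = w" "shear c (shear (\<lambda>x. - c x) w) = w" for w
    by (simp_all add: shear_def)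
  have cont: "continuous_on UNIV h" "continuous_on UNIV g"
  proof -
    have cc: "continuous_on UNIV (shear c)" "continuous_on UNIV (shear (\<lambda>x. - c x))"
      using c by (auto intro!: continuous_on_shear continuous_intros)
    show "continuous_on UNIV h" "continuous_on UNIV g"
      unfolding h_def g_def using e \<rho>
      by (intro continuous_intros continuous_on_compose2 [OF cc(1)] continuous_on_compose2 [OF cc(2)]; auto)+
  qed
  have hg: "g (h w) = w" "h (g w) = w" for w
    using e \<rho> by (simp_all add: h_def g_def inv)
  have "homeomorphism UNIV UNIV h g"
    unfolding homeomorphism_def using cont hg surjI [of h g] surjI [of g h] by simp
  moreover have "orientation_preserving_on UNIV h"
    unfolding orientation_preserving_on_def
  proof (intro ballI allI impI)
    fix z r assume r: "(0::real) < r"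
    have pathe: "path (\<lambda>t. e * (circlepath z r t - z))"
      unfolding path_def circlepath by (intro continuous_intros)
    have "path (h \<circ> circlepath z r)"
      by (intro path_continuous_image continuous_on_subset [OF cont(1)]) auto
    then have pathh: "path (\<lambda>t. (h \<circ> circlepath z r) t - h z)"
      unfolding path_def by (rule continuous_on_diff [OF _ continuous_on_const])
    have "winding_number (\<lambda>t. (h \<circ> circlepath z r) t - h z) 0 = winding_number (\<lambda>t. e * (circlepath z r t - z)) 0"
    proof (rule winding_number_ratio [OF pathe pathh])
      fix t
      let ?w = "circlepath z r t"
      define p where "p = e * (?w - z)"
      define q where "q = h ?w - h z"
      have p: "p \<noteq> 0" using e r by (simp add: p_def circlepath)
      have pd: "e * (?w - b) = e * (z - b) + p" by (simp add: p_def algebra_simps)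
      have q: "q = Complex (Re p) (Im p - (c (Re (e * (z - b) + p)) - c (Re (e * (z - b))))) / of_real \<rho>"
        unfolding q_def h_def pd shear_def by (simp add: complex_eq_iff diff_divide_distrib add_divide_distrib)
      have "q / p \<notin> \<real>\<^sub>\<le>\<^sub>0"
      proof
        assume "q / p \<in> \<real>\<^sub>\<le>\<^sub>0"
        then obtain s where s: "s \<le> 0" "q / p = of_real s" by (auto simp: nonpos_Reals_def)
        then have qs: "q = of_real s * p" using p by (simp add: field_simps)
        have "Re p / \<rho> = s * Re p" using arg_cong [OF qs, of Re] by (simp add: q)
        then have Re0: "Re p = 0" using s(1) \<rho> 
        proof -
          have "(1 / \<rho> - s) * Re p = 0" using \<open>Re p / \<rho> = s * Re p\<close> by (simp add: left_diff_distrib)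
          moreover have "0 < 1 / \<rho>" using \<rho> by simp
          then have "1 / \<rho> - s \<noteq> 0" using s(1) by linarith
          ultimately show ?thesis using mult_eq_0_iff by blast
        qed
        then have "q = p / of_real \<rho>" unfolding q by (simp add: complex_eq_iff)
        then have "of_real s * p = of_real (1 / \<rho>) * p" using qs by simp
        then have "s = 1 / \<rho>" using p by (metis mult_cancel_right of_real_eq_iff)
        then show False using s(1) \<rho> by simp
      qed
      then show "e * (?w - z) \<noteq> 0 \<and> ((h \<circ> circlepath z r) t - h z) / (e * (?w - z)) \<notin> \<real>\<^sub>\<le>\<^sub>0"
        using p by (simp add: p_def q_def)
    qed (auto simp: pathstart_def pathfinish_def circlepath)
    then show "winding_number (h \<circ> circlepath z r) (h z) = 1"
      using winding_number_scaled_circle [OF e r, of z] winding_number_offset [of "h \<circ> circlepath z r" "h z"] by simp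
  qed
  moreover have "h b = 0" by (simp add: h_def shear_def c(2) complex_eq_iff)
  ultimately show ?thesis by (rule that)
qed

section \<open>Partial derivatives and orders\<close>

lemma harmonic_directional:
  assumes "p field_differentiable at z" "q field_differentiable at z"
  shows "((\<lambda>t. p (z + c * of_real t) + cnj (q (z + c * of_real t))) has_vector_derivative
            c * deriv p z + cnj (c * deriv q z)) (at 0)"
proof -
  have line: "((\<lambda>t. z + c * of_real t) has_vector_derivative c) (at 0)"
    by (auto intro!: derivative_eq_intros)
  have "((\<lambda>t. r (z + c * of_real t)) has_vector_derivative c * deriv r z) (at 0)"
    if "r field_differentiable at z" for r
    using field_vector_diff_chain_at [OF line, of r "deriv r z"] that
    by (simp add: o_def field_differentiable_derivI)
  note this [OF assms(1)] this [OF assms(2)]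
  then show ?thesis
    by (intro has_vector_derivative_add bounded_linear.has_vector_derivative [OF bounded_linear_cnj])
qed

lemma pd_local:
  assumes W: "open W" "z \<in> W" and hol: "p holomorphic_on W" "q holomorphic_on W"
    and F: "\<And>w. w \<in> W \<Longrightarrow> F w = p w + cnj (q w)"
  shows "pdx F z = deriv p z + cnj (deriv q z)" "pdy F z = \<i> * deriv p z + cnj (\<i> * deriv q z)"
proof -
  have fd: "p field_differentiable at z" "q field_differentiable at z"
    using hol W holomorphic_on_imp_differentiable_at by blast+
  have main: "((\<lambda>t. F (z + c * of_real t)) has_vector_derivative
            c * deriv p z + cnj (c * deriv q z)) (at 0)" for c
  proof (rule has_vector_derivative_transform_within_open [OF harmonic_directional [OF fd]])
    have "continuous_on UNIV (\<lambda>t::real. z + c * of_real t)" by (intro continuous_intros)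
    then show "open ((\<lambda>t::real. z + c * of_real t) -` W)"
      using W(1) open_vimage by blast
    show "0 \<in> (\<lambda>t::real. z + c * of_real t) -` W" using W by simp
  qed (use F in auto)
  show "pdx F z = deriv p z + cnj (deriv q z)"
    unfolding pdx_def using main [of 1] by (simp add: vector_derivative_at)
  show "pdy F z = \<i> * deriv p z + cnj (\<i> * deriv q z)"
    unfolding pdy_def using main [of "\<i>"] by (simp add: vector_derivative_at)
qed

lemma jacobian_local:
  assumes W: "open W" "z \<in> W" and hol: "p holomorphic_on W" "q holomorphic_on W"
    and F: "\<And>w. w \<in> W \<Longrightarrow> F w = p w + cnj (q w)"
  shows "jacobian F z = (cmod (deriv p z))\<^sup>2 - (cmod (deriv q z))\<^sup>2"
proof -
  have pd: "pdx F z = deriv p z + cnj (deriv q z)" "pdy F z = \<i> * deriv p z + cnj (\<i> * deriv q z)"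
    by (rule pd_local [OF W hol F]; assumption)+
  show ?thesis
    unfolding jacobian_def cmod_power2 pd by (simp add: power2_eq_square algebra_simps)
qed

lemma pdy_iter:
  assumes W: "open W" and hol: "p holomorphic_on W" "q holomorphic_on W"
    and F: "\<And>w. w \<in> W \<Longrightarrow> F w = p w + cnj (q w)"
  shows "z \<in> W \<Longrightarrow> (pdy ^^ l) F z = \<i> ^ l * (deriv ^^ l) p z + cnj (\<i> ^ l * (deriv ^^ l) q z)"
proof (induction l arbitrary: z)
  case (Suc l)
  have h: "(deriv ^^ l) p holomorphic_on W" "(deriv ^^ l) q holomorphic_on W"
    using holomorphic_higher_deriv hol W by auto
  have d: "deriv (\<lambda>z. \<i> ^ l * r z) z = \<i> ^ l * deriv r z" if "r holomorphic_on W" for r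
    using that Suc.prems W by (intro deriv_cmult) (auto intro: holomorphic_on_imp_differentiable_at)
  have "pdy ((pdy ^^ l) F) z = \<i> * deriv (\<lambda>z. \<i> ^ l * (deriv ^^ l) p z) z 
      + cnj (\<i> * deriv (\<lambda>z. \<i> ^ l * (deriv ^^ l) q z) z)"
    by (rule pd_local(2) [OF W Suc.prems]) (use h Suc.IH in \<open>auto intro!: holomorphic_intros\<close>)
  then show ?case by (simp add: d [OF h(1)] d [OF h(2)] mult.assoc)
qed (use F in simp)

lemma pdx_iter:
  assumes W: "open W" and hol: "p holomorphic_on W" "q holomorphic_on W"
    and F: "\<And>w. w \<in> W \<Longrightarrow> F w = p w + cnj (q w)"
  shows "z \<in> W \<Longrightarrow> (pdx ^^ l) F z = (deriv ^^ l) p z + cnj ((deriv ^^ l) q z)"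
proof (induction l arbitrary: z)
  case (Suc l)
  have h: "(deriv ^^ l) p holomorphic_on W" "(deriv ^^ l) q holomorphic_on W"
    using holomorphic_higher_deriv hol W by auto
  have "pdx ((pdx ^^ l) F) z = deriv ((deriv ^^ l) p) z + cnj (deriv ((deriv ^^ l) q) z)"
    by (rule pd_local(1) [OF W Suc.prems h]) (use Suc.IH in auto)
  then show ?case by simp
qed (use F in simp)

lemma pd_iter:
  assumes W: "open W" and hol: "p holomorphic_on W" "q holomorphic_on W"
    and F: "\<And>w. w \<in> W \<Longrightarrow> F w = p w + cnj (q w)" and z: "z \<in> W"
  shows "(pdx ^^ k) ((pdy ^^ l) F) z = \<i> ^ l * (deriv ^^ (k + l)) p z + cnj (\<i> ^ l * (deriv ^^ (k + l)) q z)"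
proof -
  have h: "(deriv ^^ l) p holomorphic_on W" "(deriv ^^ l) q holomorphic_on W"
    using holomorphic_higher_deriv hol W by auto
  have "(pdx ^^ k) ((pdy ^^ l) F) z = (deriv ^^ k) (\<lambda>z. \<i> ^ l * (deriv ^^ l) p z) z
      + cnj ((deriv ^^ k) (\<lambda>z. \<i> ^ l * (deriv ^^ l) q z) z)"
    by (rule pdx_iter [OF W _ _ _ z]) 
       (use h pdy_iter [OF W hol F] in \<open>auto intro!: holomorphic_intros\<close>)
  then show ?thesis
    using h W z by (simp add: higher_deriv_cmult funpow_add)
qed

lemma Inf_enat_mem:
  assumes "Inf (A :: enat set) = enat m"
  shows "enat m \<in> A" "x \<in> A \<Longrightarrow> enat m \<le> x"
proof -
  have "A \<noteq> {}" using assms by (auto simp: Inf_enat_def)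
  then show "enat m \<in> A" using assms unfolding Inf_enat_def by (metis LeastI ex_in_conv)
  show "x \<in> A \<Longrightarrow> enat m \<le> x" using assms by (metis Inf_lower)
qed

text \<open>The partial derivatives of order \<open>i\<close> with no \<open>pdy\<close> and with
  one \<open>pdy\<close> give the sum and the difference of the \<open>i\<close>-th derivative of
  \<open>p\<close> and the conjugate of that of \<open>q\<close>; so both vanish when these
  do.\<close>

lemma map_order_local:
  assumes W: "open W" and hol: "p holomorphic_on W" "q holomorphic_on W"
    and F: "\<And>w. w \<in> W \<Longrightarrow> F w = p w + cnj (q w)" and z: "z \<in> W"
    and m: "map_order F z = enat m"
  shows "0 < m" "\<And>i. 0 < i \<Longrightarrow> i < m \<Longrightarrow> (deriv ^^ i) p z = 0 \<and> (deriv ^^ i) q z = 0"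
    "(deriv ^^ m) p z \<noteq> 0 \<or> (deriv ^^ m) q z \<noteq> 0"
proof -
  note pd = pd_iter [OF W hol F z]
  let ?A = "{enat (k + l) | k l. k + l > 0 \<and> (pdx ^^ k) ((pdy ^^ l) F) z \<noteq> 0}"
  have A: "enat m \<in> ?A" "\<And>x. x \<in> ?A \<Longrightarrow> enat m \<le> x"
    using Inf_enat_mem [OF m [unfolded map_order_def]] by auto
  obtain k l where kl: "m = k + l" "k + l > 0" "(pdx ^^ k) ((pdy ^^ l) F) z \<noteq> 0"
    using A(1) by auto
  then show "0 < m" by simp
  show "(deriv ^^ m) p z \<noteq> 0 \<or> (deriv ^^ m) q z \<noteq> 0"
    using kl by (auto simp: pd)
  show "(deriv ^^ i) p z = 0 \<and> (deriv ^^ i) q z = 0" if i: "0 < i" "i < m" for i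
  proof -
    have zero: "(pdx ^^ k) ((pdy ^^ l) F) z = 0" if "k + l = i" for k l
    proof (rule ccontr)
      assume "(pdx ^^ k) ((pdy ^^ l) F) z \<noteq> 0"
      then have "enat i \<in> ?A" using that i by blast
      then show False using A(2) [of "enat i"] i by simp
    qed
    define x where "x = (deriv ^^ i) p z"
    define y where "y = cnj ((deriv ^^ i) q z)"
    have "x + y = 0" using zero [of i 0] pd [of i 0] by (simp add: x_def y_def)
    moreover have "\<i> * x - \<i> * y = 0"
      using zero [of "i - 1" 1] pd [of "i - 1" 1] i by (simp add: x_def y_def)
    then have "\<i> * (x - y) = 0" by (simp add: algebra_simps)
    then have "x = y" by simp
    ultimately have "x = 0" "y = 0" by auto
    then show ?thesis by (simp add: x_def y_def)
  qed
qed

text \<open>Real derivatives of the curve are complex derivatives of its extension \<open>G\<close>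
  at real points, so the order of the curve becomes the order of a zero of
  \<open>G - G 0\<close>.\<close>

lemma curve_order_holomorphic:
  assumes r: "0 < r" and hol: "G holomorphic_on ball 0 r" and b: "\<And>t. \<bar>t\<bar> < r \<Longrightarrow> b t = G (of_real t)"
    and j: "curve_order b 0 = enat j"
  shows "0 < j" "\<And>i. 0 < i \<Longrightarrow> i < j \<Longrightarrow> (deriv ^^ i) G 0 = 0" "(deriv ^^ j) G 0 \<noteq> 0"
proof -
  have iter: "((\<lambda>g s. vector_derivative g (at s)) ^^ n) b t = (deriv ^^ n) G (of_real t)" if "\<bar>t\<bar> < r" for n t
    using that
  proof (induction n arbitrary: t)
    case (Suc n)
    have "(deriv ^^ n) G holomorphic_on ball 0 r" using hol by (intro holomorphic_higher_deriv) auto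
    then have "((deriv ^^ n) G has_field_derivative deriv ((deriv ^^ n) G) (of_real t)) (at (of_real t))"
      by (rule holomorphic_derivI) (use Suc.prems in auto)
    moreover have "(of_real has_vector_derivative (1::complex)) (at t)"
      by (auto intro!: derivative_eq_intros)
    ultimately have "(((deriv ^^ n) G \<circ> of_real) has_vector_derivative deriv ((deriv ^^ n) G) (of_real t)) (at t)"
      using field_vector_diff_chain_at by fastforce
    then have "(((\<lambda>g s. vector_derivative g (at s)) ^^ n) b has_vector_derivative deriv ((deriv ^^ n) G) (of_real t)) (at t)"
      by (rule has_vector_derivative_transform_within_open [of _ _ _ "{-r<..<r}"])
         (use Suc in \<open>auto simp: abs_less_iff\<close>)
    then show ?case by (simp add: vector_derivative_at)
  qed (use b in simp)
  let ?A = "{enat n | n. n > 0 \<and> ((\<lambda>g s. vector_derivative g (at s)) ^^ n) b 0 \<noteq> 0}"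
  have A: "enat j \<in> ?A" "\<And>x. x \<in> ?A \<Longrightarrow> enat j \<le> x"
    using Inf_enat_mem [OF j [unfolded curve_order_def]] by auto
  show "0 < j" "(deriv ^^ j) G 0 \<noteq> 0" using A(1) iter [of 0 j] r by auto
  show "(deriv ^^ i) G 0 = 0" if "0 < i" "i < j" for i
  proof (rule ccontr)
    assume "(deriv ^^ i) G 0 \<noteq> 0"
    then have "enat i \<in> ?A" using iter [of 0 i] r that by auto
    then show False using A(2) [of "enat i"] that by simp
  qed
qed

text \<open>The witness is the point \<open>w0 + s / 2\<close> of the straightened curve, pulled
  back. It serves when both \<open>deriv p\<close> and \<open>deriv q\<close> vanish at
  \<open>a\<close>, where the Jacobian at \<open>a\<close> alone says nothing about
  \<open>\<psi> a\<close>.\<close>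

lemma curve_submanifold_not_isolated:
  assumes "curve_submanifold_at C a" "a \<in> C" "open N" "a \<in> N"
  shows "\<exists>z\<in>N. z \<noteq> a \<and> z \<in> C"
proof -
  obtain U V \<Phi> \<Psi> where U: "open U" "a \<in> U" and V: "open V" and hom: "homeomorphism U V \<Phi> \<Psi>"
    and im: "\<Phi> ` (C \<inter> U) = {w\<in>V. Im w = 0}"
    using assms(1) unfolding curve_submanifold_at_def by auto
  have h: "\<And>x. x \<in> U \<Longrightarrow> \<Psi> (\<Phi> x) = x" "\<Phi> ` U = V" "continuous_on V \<Psi>" 
    using hom by (auto simp: homeomorphism_def)
  define w0 where "w0 = \<Phi> a"
  have w0: "w0 \<in> V" "Im w0 = 0" using im assms(2) U by (auto simp: w0_def)
  have "open (V \<inter> \<Psi> -` N)" using h(3) V assms(3) by (rule continuous_open_preimage)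
  moreover have "w0 \<in> V \<inter> \<Psi> -` N" using w0 h(1) [OF U(2)] assms(4) by (simp add: w0_def)
  ultimately obtain s where s: "0 < s" "ball w0 s \<subseteq> V \<inter> \<Psi> -` N" using openE by blast
  define w where "w = w0 + of_real (s / 2)"
  have "w \<in> ball w0 s" using s by (simp add: w_def dist_norm)
  then have w: "w \<in> V" "\<Psi> w \<in> N" "Im w = 0" using s w0 by (auto simp: w_def)
  then obtain z where z: "z \<in> C" "z \<in> U" "w = \<Phi> z" using im by auto
  have "w \<noteq> w0" using s by (simp add: w_def)
  then have "z \<noteq> a" using z by (auto simp: w0_def)
  moreover have "z \<in> N" using w z h(1) by auto
  ultimately show ?thesis using z by blast
qed

section \<open>Existence of the chart\<close>

text \<open>All radii, the shear and the number of half turns are produced here. \<open>al\<close>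
  is the real part along the critical curve in the parameter \<open>eta\<close>; the shear function
  is \<open>Im B\<close> on the curve composed with the inverse of \<open>al\<close>.\<close>

lemma exists_fold_chart:
  fixes M :: nat and R1 :: real and ell eta B :: "complex \<Rightarrow> complex"
  assumes M: "0 < M" and R1: "0 < R1"
    and ell: "ell holomorphic_on ball 0 R1"
    and eta: "\<And>z. z \<in> ball 0 R1 \<Longrightarrow> eta z = z * exp (- ell z)"
    and inj: "inj_on eta (ball 0 R1)"
    and B: "B holomorphic_on ball 0 R1" "B 0 = 0"
    and mono: "\<And>z w. z \<in> ball 0 R1 \<Longrightarrow> w \<in> ball 0 R1 \<Longrightarrow> Im (eta z) = 0 \<Longrightarrow> Im (eta w) = 0 \<Longrightarrow>
           Re (eta z) < Re (eta w) \<Longrightarrow> Re (z ^ M) < Re (w ^ M)"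
    and sgn: "\<And>z. z \<in> ball 0 R1 \<Longrightarrow> z \<noteq> 0 \<Longrightarrow>
           sgn (Re (deriv B z / (of_nat M * z ^ (M - 1)))) = sgn (Im (eta z))"
    and osc: "\<And>z w. z \<in> ball 0 R1 \<Longrightarrow> w \<in> ball 0 R1 \<Longrightarrow> \<bar>M * Im (ell z) - M * Im (ell w)\<bar> < pi / 4"
    and right: "\<And>z. z \<in> ball 0 R1 \<Longrightarrow> Im (eta z) = 0 \<Longrightarrow> 0 < Re (eta z) \<Longrightarrow> \<bar>M * Im (ell z)\<bar> < pi / 2"
  obtains n1 n2 :: nat and c :: "real \<Rightarrow> real" and \<rho> a b :: real and U ch where
    "1 \<le> n1" "1 \<le> n2" "n1 + n2 = M + 1" "\<bar>2 * int n1 - 1 - int M\<bar> \<le> 1"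
    "continuous_on UNIV c" "c 0 = 0" "0 < \<rho>"
    "open U" "0 \<in> U" "U \<subseteq> ball 0 R1" "continuous_on U ch" "inj_on ch U" "ch ` U = ball 0 1" "ch 0 = 0"
    "\<And>z. z \<in> U \<Longrightarrow> z \<noteq> 0 \<Longrightarrow> ch z / eta z \<notin> \<real>\<^sub>\<le>\<^sub>0"
    "\<And>z. z \<in> U \<Longrightarrow> shear c (Complex (Re (z ^ M)) (Im (B z))) / of_real \<rho> = model_map n1 n2 (ch z)"
    "\<And>z. z \<in> U \<Longrightarrow> Im (ch z) = 0 \<longleftrightarrow> Im (eta z) = 0"
    "a < 0" "0 < b"
    "\<And>z. z \<in> U \<Longrightarrow> Im (eta z) = 0 \<Longrightarrow> a < Re (eta z) \<and> Re (eta z) < b"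
    "\<And>x. a < x \<Longrightarrow> x < b \<Longrightarrow> \<exists>z\<in>U. eta z = of_real x"
proof -
  have hol_eta: "eta holomorphic_on ball 0 R1"
    by (rule holomorphic_transform [of "\<lambda>z. z * exp (- ell z)"]) (auto intro!: holomorphic_intros ell simp: eta)
  have eta0: "eta 0 = 0" using eta [of 0] R1 by simp
  obtain zi where hol_zi: "zi holomorphic_on (eta ` ball 0 R1)" and zi: "\<And>z. z \<in> ball 0 R1 \<Longrightarrow> zi (eta z) = z"
    using holomorphic_has_inverse [OF hol_eta open_ball inj] by metis
  have "open (eta ` ball 0 R1)" by (rule open_mapping_thm3 [OF hol_eta open_ball inj])
  moreover have "0 \<in> eta ` ball 0 R1" using eta0 R1 by (intro image_eqI [of _ _ 0]) auto
  ultimately obtain x1 where x1: "0 < x1" "cball 0 x1 \<subseteq> eta ` ball 0 R1"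
    using open_contains_cball by blast
  have zi_in: "zi (of_real x) \<in> ball 0 R1" "eta (zi (of_real x)) = of_real x" if "\<bar>x\<bar> \<le> x1" for x
  proof -
    have "complex_of_real x \<in> eta ` ball 0 R1" using x1(2) that by (auto simp: subset_iff)
    then show "zi (of_real x) \<in> ball 0 R1" "eta (zi (of_real x)) = of_real x" using zi by auto
  qed
  have zi_0: "zi 0 = 0" using zi [of 0] eta0 R1 by simp
  have cont_zi: "continuous_on (eta ` ball 0 R1) zi" and cont_B: "continuous_on (ball 0 R1) B"
    and cont_eta: "continuous_on (ball 0 R1) eta"
    using hol_zi B hol_eta by (auto intro: holomorphic_on_imp_continuous_on)
  have real_in: "complex_of_real ` {-x1..x1} \<subseteq> eta ` ball 0 R1"
    using x1(2) by (auto simp: subset_iff)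
  have cont_zr: "continuous_on {-x1..x1} (\<lambda>x. zi (of_real x))"
    by (rule continuous_on_compose2 [OF cont_zi _ real_in]) (intro continuous_intros)
  define al where "al x = Re (zi (of_real x) ^ M)" for x :: real
  have cont_al: "continuous_on {-x1..x1} al" unfolding al_def by (intro continuous_intros cont_zr)
  have al_0: "al 0 = 0" using M by (simp add: al_def zi_0)
  have al_mono: "al x < al y" if "- x1 \<le> x" "x < y" "y \<le> x1" for x y
    unfolding al_def by (rule mono) (use zi_in [of x] zi_in [of y] that in auto)
  have al_less: "al x < al y \<longleftrightarrow> x < y" if "- x1 \<le> x" "x \<le> x1" "- x1 \<le> y" "y \<le> x1" for x y
    using al_mono [of x y] al_mono [of y x] that by (cases x y rule: linorder_cases) auto
  have inj_al: "inj_on al {-x1..x1}"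
  proof (rule inj_onI)
    fix x y assume "x \<in> {-x1..x1}" "y \<in> {-x1..x1}" "al x = al y"
    then show "x = y" using al_less [of x y] al_less [of y x] by (cases x y rule: linorder_cases) auto
  qed
  define ali where "ali = inv_into {-x1..x1} al"
  have ali: "ali (al x) = x" if "x \<in> {-x1..x1}" for x
    using inj_al that by (simp add: ali_def)
  have cont_ali: "continuous_on (al ` {-x1..x1}) ali"
    by (rule continuous_on_inv [OF cont_al compact_Icc]) (use ali in auto)
  \<comment> \<open>The change of coordinates in the target must live on the whole plane; clamping
    extends \<open>c\<close> continuously, by constants beyond the range of
    \<open>al\<close>.\<close>
  define clamp where "clamp y = max (al (- x1)) (min (al x1) y)" for y
  have clamp: "clamp y \<in> al ` {-x1..x1}" for y
  proof -
    have "al (- x1) \<le> clamp y" "clamp y \<le> al x1"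
      using al_mono [of "-x1" x1] x1(1) by (auto simp: clamp_def)
    then obtain x where "-x1 \<le> x" "x \<le> x1" "al x = clamp y"
      using IVT' [of al "-x1" "clamp y" x1] cont_al x1(1) by auto
    then show ?thesis by (metis atLeastAtMost_iff imageI)
  qed
  define c where "c y = Im (B (zi (of_real (ali (clamp y)))))" for y
  have ali_in: "ali (clamp y) \<in> {-x1..x1}" for y
    unfolding ali_def by (rule inv_into_into [OF clamp])
  have cont_c: "continuous_on UNIV c"
  proof -
    have "continuous_on UNIV clamp" unfolding clamp_def by (intro continuous_intros)
    then have "continuous_on UNIV (\<lambda>y. ali (clamp y))"
      by (rule continuous_on_compose2 [OF cont_ali]) (use clamp in auto)
    then have "continuous_on UNIV (\<lambda>y. zi (of_real (ali (clamp y))))"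
      by (rule continuous_on_compose2 [OF cont_zr]) (use ali_in in auto)
    then have "continuous_on UNIV (\<lambda>y. B (zi (of_real (ali (clamp y)))))"
      by (rule continuous_on_compose2 [OF cont_B]) (use ali_in zi_in in \<open>force simp: abs_le_iff\<close>)
    then show ?thesis unfolding c_def by (intro continuous_intros)
  qed
  have c_al: "c (al x) = Im (B (zi (of_real x)))" if x: "x \<in> {-x1..x1}" for x
  proof -
    have "al (-x1) \<le> al x" "al x \<le> al x1"
      using al_mono [of "-x1" x] al_mono [of x x1] x by (cases "x = -x1"; cases "x = x1"; force)+
    then have "clamp (al x) = al x" by (simp add: clamp_def)
    then show ?thesis using ali [OF x] by (simp add: c_def)
  qed
  have c_0: "c 0 = 0" using c_al [of 0] al_0 zi_0 B(2) x1(1) by simp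
  \<comment> \<open>Critical points in this ball have their parameter in \<open>{-x1..x1}\<close>,
    where the clamp has no effect and the shear makes \<open>H\<close> exactly real.\<close>
  obtain R0 where R0: "0 < R0" "R0 \<le> R1" "\<And>z. z \<in> ball 0 R0 \<Longrightarrow> cmod (eta z) < x1"
  proof -
    have "open (ball 0 R1 \<inter> eta -` ball 0 x1)"
      by (rule continuous_open_preimage [OF cont_eta]) auto
    moreover have "0 \<in> ball 0 R1 \<inter> eta -` ball 0 x1" using R1 x1(1) eta0 by simp
    ultimately obtain r where r: "0 < r" "ball 0 r \<subseteq> ball 0 R1 \<inter> eta -` ball 0 x1" using openE by blast
    show ?thesis
      by (rule that [of "min r R1"]) (use r R1 in \<open>auto simp: subset_iff\<close>)
  qed
  have sub: "ball 0 R0 \<subseteq> ball 0 R1" using R0 by auto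
  define H where "H z = shear c (Complex (Re (z ^ M)) (Im (B z)))" for z
  have H_eq: "H z = Complex (Re (z ^ M)) (Im (B z) - c (Re (z ^ M)))" for z
    by (simp add: H_def shear_def)
  have cont_H: "continuous_on (ball 0 R1) H"
    unfolding H_eq Complex_eq
    by (intro continuous_intros cont_B continuous_on_compose2 [OF cont_c]) auto
  have real_pt: "eta z = of_real (Re (eta z))" "Re (eta z) \<in> {-x1..x1}" "zi (of_real (Re (eta z))) = z"
    "al (Re (eta z)) = Re (z ^ M)"
    if z: "z \<in> ball 0 R0" "Im (eta z) = 0" for z
  proof -
    show e: "eta z = of_real (Re (eta z))" using z by (simp add: complex_eq_iff)
    have "\<bar>Re (eta z)\<bar> < x1" using R0(3) [OF z(1)] abs_Re_le_cmod [of "eta z"] by linarith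
    then show "Re (eta z) \<in> {-x1..x1}" by auto
    show "zi (of_real (Re (eta z))) = z" using zi [of z] z(1) R0(2) e by auto
    then show "al (Re (eta z)) = Re (z ^ M)" by (simp add: al_def)
  qed
  have crit: "Im (H z) = 0" if z: "z \<in> ball 0 R0" "Im (eta z) = 0" for z
    using c_al [OF real_pt(2) [OF z]] real_pt(3,4) [OF z] by (simp add: H_eq)
  have base: "upper_half_base M R0 ell eta B H c"
  proof
    show "continuous_on (ball 0 R0) ell"
      using ell sub by (meson continuous_on_subset holomorphic_on_imp_continuous_on)
    show "inj_on eta (ball 0 R0)" using inj sub by (rule inj_on_subset)
    show "B holomorphic_on ball 0 R0" using B(1) sub by (rule holomorphic_on_subset)
    show "continuous_on (ball 0 R0) H" using cont_H sub by (rule continuous_on_subset)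
  qed (use M R0 eta mono sgn H_eq crit sub in \<open>auto simp: subset_iff\<close>)
  interpret u: upper_half_base M R0 ell eta B H c by (rule base)
  interpret l: upper_half_base M R0 "\<lambda>z. cnj (ell (cnj z))" "\<lambda>z. cnj (eta (cnj z))"
    "\<lambda>z. - cnj (B (cnj z))" "\<lambda>z. H (cnj z)" c
    by (rule upper_half_base_conj [OF base])
  have H_nz: "H z \<noteq> 0" if "z \<in> ball 0 R0" "z \<noteq> 0" for z
  proof (cases "0 \<le> Im (eta z)")
    case True
    then have "z \<in> u.C" using that by (simp add: u.C_def)
    then show ?thesis by (rule u.H_over_power(3))
  next
    case False
    then have "cnj z \<in> l.C" using that by (simp add: l.C_def)
    from l.H_over_power(3) [OF this] show ?thesis by simp
  qed
  define R where "R = R0 / 2"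
  have R: "0 < R" "R < R0" using R0 by (auto simp: R_def)
  have subR: "ball 0 R \<subseteq> ball 0 R1" using R R0 by auto
  have "compact (sphere (0::complex) R)" "sphere (0::complex) R \<noteq> {}" using R by auto
  moreover have "continuous_on (sphere 0 R) (\<lambda>z. cmod (H z))"
    by (intro continuous_intros continuous_on_subset [OF cont_H]) (use R R0 in auto)
  ultimately obtain v where v: "v \<in> sphere 0 R" "\<And>z. z \<in> sphere 0 R \<Longrightarrow> cmod (H v) \<le> cmod (H z)"
    using continuous_attains_inf by metis
  define r0 where "r0 = cmod (H v)"
  have r0: "0 < r0" "\<And>z. cmod z = R \<Longrightarrow> r0 \<le> cmod (H z)"
    using v R H_nz [of v] by (auto simp: r0_def)
  obtain x2 where x2: "0 < x2" "x2 \<le> x1" "\<And>x. \<bar>x\<bar> \<le> x2 \<Longrightarrow> zi (of_real x) \<in> ball 0 R"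
  proof -
    have "open (eta ` ball 0 R)"
      by (rule open_mapping_thm3 [OF holomorphic_on_subset [OF hol_eta subR] open_ball inj_on_subset [OF inj subR]])
    moreover have "0 \<in> eta ` ball 0 R" using eta0 R by (intro image_eqI [of _ _ 0]) auto
    ultimately obtain s where s: "0 < s" "cball 0 s \<subseteq> eta ` ball 0 R" using open_contains_cball by blast
    have "zi (of_real x) \<in> ball 0 R" if "\<bar>x\<bar> \<le> s" for x
    proof -
      have "complex_of_real x \<in> eta ` ball 0 R" using s(2) that by (auto simp: subset_iff)
      then obtain z where "z \<in> ball 0 R" "of_real x = eta z" by auto
      moreover from this have "zi (eta z) = z" using subR by (intro zi) blast
      ultimately show ?thesis by simp
    qed
    then show ?thesis using s(1) x1(1) by (intro that [of "min s x1"]) auto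
  qed
  have x2_in: "zi (of_real x) \<in> ball 0 R0" "eta (zi (of_real x)) = of_real x" if "\<bar>x\<bar> \<le> x2" for x
  proof -
    have "cmod (zi (of_real x)) < R" using x2(3) [OF that] by simp
    then show "zi (of_real x) \<in> ball 0 R0" using R by simp
    show "eta (zi (of_real x)) = of_real x" by (rule zi_in(2)) (use that x2(2) in linarith)
  qed
  \<comment> \<open>\<open>r0\<close> is the minimum of \<open>cmod (H z)\<close> on the circle of
    radius \<open>R\<close> and gives \<open>far\<close>. The other two bounds ensure that the piece
    of the critical curve with parameter in \<open>{-x2..x2}\<close>, which lies in the ball of
    radius \<open>R\<close>, reaches all real parts up to \<open>\<rho>\<close>.\<close>
  define \<rho> where "\<rho> = min r0 (min (al x2) (- al (- x2)))"
  have al_x2: "al (- x2) < 0" "0 < al x2"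
    using al_mono [of "-x2" 0] al_mono [of 0 x2] x2 al_0 by auto
  have \<rho>: "0 < \<rho>" "\<rho> \<le> r0" "\<rho> \<le> al x2" "al (- x2) \<le> - \<rho>"
    using r0 al_x2 by (auto simp: \<rho>_def min_def)
  have al_surj: "\<exists>x. - x2 \<le> x \<and> x \<le> x2 \<and> al x = y" if "\<bar>y\<bar> \<le> \<rho>" for y
  proof (rule IVT')
    show "continuous_on {-x2..x2} al" by (rule continuous_on_subset [OF cont_al]) (use x2 in auto)
  qed (use that \<rho> x2 in auto)
  have H_zi: "H (zi (of_real x)) = of_real (al x)" if "\<bar>x\<bar> \<le> x2" for x
  proof -
    have z: "zi (of_real x) \<in> ball 0 R0" "Im (eta (zi (of_real x))) = 0"
      using x2_in [OF that] by auto
    then show ?thesis using crit [OF z] by (simp add: H_eq al_def complex_eq_iff)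
  qed
  have cos_neg: "cos (M * (pi + Im (ell z))) < 0" if z: "z \<in> ball 0 R0" "Im (eta z) = 0" "Re (eta z) < 0" for z
  proof -
    have z0: "z \<noteq> 0" using z(3) eta0 by auto
    have "upper_arg (eta z) = pi"
      using upper_arg_of_real(2) [OF z(3)] real_pt(1) [OF z(1,2)] by simp
    then have "u.lam z = M * (pi + Im (ell z))" by (simp add: u.lam_def)
    then have "Re (z ^ M) = cmod z ^ M * cos (M * (pi + Im (ell z)))"
      using arg_cong [OF u.power_polar [OF z(1) z0], of Re] by simp
    moreover have "Re (z ^ M) < 0" using u.crit_mono [of z 0] z R0(1) eta0 M by (simp add: zero_power)
    ultimately show ?thesis using z0 by (simp add: mult_less_0_iff)
  qed
  define zm where "zm = zi (of_real (- x2))"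
  define zp where "zp = zi (of_real x2)"
  have zm: "zm \<in> ball 0 R0" "Im (eta zm) = 0" "Re (eta zm) < 0"
    using x2(1) x2_in [of "-x2"] unfolding zm_def by auto
  have zp: "zp \<in> ball 0 R0" "Im (eta zp) = 0" "0 < Re (eta zp)"
    using x2(1) x2_in [of "x2"] unfolding zp_def by auto
  \<comment> \<open>The number of half turns is read off at one point of the left branch. There the
    real part of the power is negative, so the sector is odd.\<close>
  obtain i :: int where i: "\<bar>M * (pi + Im (ell zm)) - of_int i * pi\<bar> < pi / 2"
    using sector_exists [of "M * (pi + Im (ell zm))"] cos_neg [OF zm] by auto
  have odd_i: "odd i" using cos_sector [OF i] cos_neg [OF zm] by (auto split: if_splits)
  \<comment> \<open>The errors are \<open>pi / 4\<close> from the variation of \<open>ell\<close>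
    between the ends, \<open>pi / 2\<close> from the bound on the right branch and
    \<open>pi / 2\<close> from the sector. The sum is below \<open>2 * pi\<close>, so the integers
    differ by at most 1.\<close>
  have near: "\<bar>i - int M\<bar> \<le> 1"
  proof -
    have o: "\<bar>M * Im (ell zm) - M * Im (ell zp)\<bar> < pi / 4" 
      by (rule osc) (use zm(1) zp(1) sub in blast)+
    have r: "\<bar>M * Im (ell zp)\<bar> < pi / 2" by (rule right) (use zp sub in blast)+
    have "\<bar>real M * pi - of_int i * pi\<bar> < 2 * pi"
      using o r i [unfolded distrib_left] unfolding abs_less_iff by linarith
    then have "\<bar>real_of_int (int M - i) * pi\<bar> < 2 * pi"
      by (simp only: of_int_diff left_diff_distrib of_int_of_nat_eq)
    then have "\<bar>real_of_int (int M - i)\<bar> < 2" by (simp only: abs_mult) simp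
    then show ?thesis by linarith
  qed
  define k where "k = nat i"
  define k' where "k' = 2 * M - k"
  have k: "0 < k" "odd k" "0 < k'" "k + k' = 2 * M" "int k = i"
  proof -
    have "0 \<le> i" using near M by linarith
    then show ik: "int k = i" by (simp add: k_def)
    then show "odd k" using odd_i by (metis even_of_nat)
    then show "0 < k" by (rule odd_pos)
    have "k \<le> M + 1" using near ik by linarith
    moreover have "k \<noteq> 2 * M" using \<open>odd k\<close> by auto
    ultimately show "0 < k'" "k + k' = 2 * M" using M by (auto simp: k'_def)
  qed
  \<comment> \<open>The single point \<open>zm\<close> speaks for the whole left branch: the small
    oscillation of \<open>ell\<close> leaves no room for another odd sector.\<close>
  have left: "\<bar>M * (pi + Im (ell z)) - k * pi\<bar> < pi / 2"
    if z: "z \<in> ball 0 R0" "Im (eta z) = 0" "Re (eta z) < 0" for z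
  proof -
    obtain i' :: int where i': "\<bar>M * (pi + Im (ell z)) - of_int i' * pi\<bar> < pi / 2"
      using sector_exists [of "M * (pi + Im (ell z))"] cos_neg [OF z] by auto
    have odd_i': "odd i'" using cos_sector [OF i'] cos_neg [OF z] by (auto split: if_splits)
    have "\<bar>M * Im (ell z) - M * Im (ell zm)\<bar> < pi / 4"
      by (rule osc) (use z(1) zm(1) sub in blast)+
    then have "\<bar>M * (pi + Im (ell zm)) - M * (pi + Im (ell z))\<bar> < pi"
      unfolding distrib_left abs_less_iff using pi_gt_zero by linarith
    then have "i = i'" using sector_unique [OF i i'] odd_i odd_i' by blast
    then show ?thesis using i' k(5) by (metis of_int_of_nat_eq)
  qed
  define N where "N = {z \<in> ball 0 R. cmod (H z) < \<rho>}"
  have subN: "N \<subseteq> ball 0 R1" using subR by (auto simp: N_def)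
  have "open N"
  proof -
    have "open (ball 0 R \<inter> (\<lambda>z. cmod (H z)) -` {..<\<rho>})"
      by (intro continuous_open_preimage continuous_intros continuous_on_subset [OF cont_H]) (use R R0 in auto)
    also have "\<dots> = N" by (auto simp: N_def)
    finally show ?thesis .
  qed
  have H0: "H 0 = 0" by (rule u.H_0)
  have "open (eta ` N)"
    by (rule open_mapping_thm3 [OF holomorphic_on_subset [OF hol_eta subN] \<open>open N\<close> inj_on_subset [OF inj subN]])
  moreover have "0 \<in> eta ` N" using eta0 H0 R \<rho> by (intro image_eqI [of _ _ 0]) (auto simp: N_def)
  ultimately obtain s where s: "0 < s" "cball 0 s \<subseteq> eta ` N" using open_contains_cball by blast
  have "\<i> * of_real s \<in> eta ` N" "- (\<i> * of_real s) \<in> eta ` N" 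
    using s by (auto simp: subset_iff norm_mult)
  then obtain y y' where y: "y \<in> N" "eta y = \<i> * of_real s" "y' \<in> N" "eta y' = - (\<i> * of_real s)" by (metis imageE)
  have up: "upper_half M R0 ell eta B H c k R \<rho>"
  proof (intro upper_half.intro base upper_half_axioms.intro)
    show "\<bar>M * Im (ell z)\<bar> < pi / 2" if "z \<in> ball 0 R0" "Im (eta z) = 0" "0 < Re (eta z)" for z
      by (rule right) (use that sub in blast)+
    show "\<rho> \<le> cmod (H z)" if "cmod z = R" for z using r0(2) [OF that] \<rho> by linarith
    show "\<exists>z\<in>ball 0 R. Im (eta z) = 0 \<and> Re (z ^ M) = v" if v: "\<bar>v\<bar> < \<rho>" for v
    proof -
      obtain x where x: "-x2 \<le> x" "x \<le> x2" "al x = v" using al_surj [of v] v by auto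
      then show ?thesis using x2(3) [of x] x2_in(2) [of x]
        by (intro bexI [of _ "zi (of_real x)"]) (auto simp: al_def)
    qed
    show "\<exists>z\<in>ball 0 R. 0 < Im (eta z) \<and> cmod (H z) < \<rho>"
      using y s by (intro bexI [of _ y]) (auto simp: N_def)
  qed (use k R \<rho> left in auto)
  interpret fc: fold_chart M R0 ell eta B H c k R \<rho> k'
  proof (intro fold_chart.intro up fold_chart_axioms.intro)
    show "\<exists>z\<in>ball 0 R. Im (eta z) < 0 \<and> cmod (H z) < \<rho>"
      using y s by (intro bexI [of _ y']) (auto simp: N_def)
  qed (use k in auto)
  define n1 where "n1 = (k + 1) div 2"
  define n2 where "n2 = (k' + 1) div 2"
  have odd_k': "odd k'" using k(2,4) by presburger
  have n12: "k + 1 = 2 * n1" "k' + 1 = 2 * n2" using k(2) odd_k' by (auto simp: n1_def n2_def)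
  \<comment> \<open>The ends of the critical arc inside the neighbourhood, where the straightened
    curve reaches \<open>- \<rho>\<close> and \<open>\<rho>\<close>.\<close>
  obtain a where a: "-x2 \<le> a" "a \<le> x2" "al a = - \<rho>" using al_surj [of "-\<rho>"] \<rho> by auto
  obtain b where b: "-x2 \<le> b" "b \<le> x2" "al b = \<rho>" using al_surj [of "\<rho>"] \<rho> by auto
  have ab: "a < 0" "0 < b"
    using al_less [of a 0] al_less [of 0 b] a b x2 \<rho> al_0 by auto
  have U_sub: "fc.U \<subseteq> ball 0 R0" by (rule fc.U_sub)
  show ?thesis
  proof (rule that [of n1 n2 c \<rho> fc.U "\<lambda>z. fc.chart z / of_real \<rho>" a b])
    show "1 \<le> n1" "1 \<le> n2" "n1 + n2 = M + 1" using n12 k by auto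
    show "\<bar>2 * int n1 - 1 - int M\<bar> \<le> 1" using n12 near k(5) by linarith
    show "continuous_on UNIV c" "c 0 = 0" "0 < \<rho>" "a < 0" "0 < b" by (fact cont_c c_0 \<rho>(1) ab)+
    show "open fc.U" by (rule fc.open_U)
    show "0 \<in> fc.U" using R \<rho> H0 by (simp add: fc.U_def)
    show "fc.U \<subseteq> ball 0 R1" using U_sub sub by auto
    show "continuous_on fc.U (\<lambda>z. fc.chart z / of_real \<rho>)"
      using \<rho> by (intro continuous_intros fc.cont_chart) auto
    show "inj_on (\<lambda>z. fc.chart z / of_real \<rho>) fc.U"
      using fc.inj_chart \<rho> by (auto simp: inj_on_def)
    show "(\<lambda>z. fc.chart z / of_real \<rho>) ` fc.U = ball 0 1"
    proof -
      have "(\<lambda>z. fc.chart z / of_real \<rho>) ` fc.U = (\<lambda>w. w / of_real \<rho>) ` ball 0 \<rho>"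
        unfolding fc.image_chart [symmetric] image_image ..
      also have "\<dots> = ball 0 1"
      proof (intro equalityI subsetI)
        fix w :: complex assume "w \<in> ball 0 1"
        then show "w \<in> (\<lambda>w. w / of_real \<rho>) ` ball 0 \<rho>"
          using \<rho> by (intro rev_image_eqI [of "w * of_real \<rho>"]) (auto simp: norm_mult)
      qed (use \<rho> in \<open>auto simp: norm_divide divide_simps\<close>)
      finally show ?thesis .
    qed
    show "fc.chart 0 / of_real \<rho> = 0" 
      using fc.chart_real(3) [of 0] R0(1) eta0 M by (simp add: zero_power)
    show "fc.chart z / of_real \<rho> / eta z \<notin> \<real>\<^sub>\<le>\<^sub>0" if "z \<in> fc.U" "z \<noteq> 0" for z
    proof
      assume "fc.chart z / of_real \<rho> / eta z \<in> \<real>\<^sub>\<le>\<^sub>0"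
      then obtain t where t: "t \<le> 0" "fc.chart z / of_real \<rho> / eta z = of_real t" by (auto simp: nonpos_Reals_def)
      have "fc.chart z / eta z = of_real \<rho> * (fc.chart z / of_real \<rho> / eta z)" using \<rho>(1) by simp
      then have "fc.chart z / eta z = of_real (\<rho> * t)" by (simp only: t(2) of_real_mult)
      moreover have "\<rho> * t \<le> 0" using \<rho> t by (simp add: mult_nonneg_nonpos)
      ultimately show False using fc.chart_over_eta [OF that] by (metis nonpos_Reals_of_real_iff)
    qed
    show "shear c (Complex (Re (z ^ M)) (Im (B z))) / of_real \<rho> = model_map n1 n2 (fc.chart z / of_real \<rho>)"
      if "z \<in> fc.U" for z
      using fc.H_model [OF that n12] by (simp add: H_def)
    show "Im (fc.chart z / of_real \<rho>) = 0 \<longleftrightarrow> Im (eta z) = 0" if "z \<in> fc.U" for z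
      using fc.sgn_chart [OF that] \<rho> by (auto simp: sgn_real_def split: if_splits)
    show "a < Re (eta z) \<and> Re (eta z) < b" if z: "z \<in> fc.U" "Im (eta z) = 0" for z
    proof -
      have zb: "z \<in> ball 0 R0" using z U_sub by auto
      have "H z = of_real (Re (z ^ M))" by (rule fc.up.H_crit [OF zb z(2)])
      then have "\<bar>al (Re (eta z))\<bar> < \<rho>" using z real_pt(4) [OF zb z(2)] by (simp add: fc.U_def)
      then have "al a < al (Re (eta z))" "al (Re (eta z)) < al b" using a b by auto
      then show ?thesis using al_less [of a "Re (eta z)"] al_less [of "Re (eta z)" b] real_pt(2) [OF zb z(2)] a b x2 by auto
    qed
    show "\<exists>z\<in>fc.U. eta z = of_real x" if x: "a < x" "x < b" for x
    proof -
      have x': "\<bar>x\<bar> \<le> x2" using x a b by auto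
      have "al a < al x" "al x < al b" using al_less [of a x] al_less [of x b] x a b x2 by auto
      then have "cmod (H (zi (of_real x))) < \<rho>" using H_zi [OF x'] a b by auto
      then show ?thesis
        using x2(3) [OF x'] x2_in(2) [OF x'] by (intro bexI [of _ "zi (of_real x)"]) (auto simp: fc.U_def)
    qed
  qed
qed

section \<open>From the rotated harmonic map to conformal coordinates\<close>

lemma Re_cayley:
  assumes "T \<noteq> (-1::complex)"
  shows "sgn (Re ((T - 1) / (T + 1))) = sgn (cmod T - 1)"
proof -
  have nz: "T + 1 \<noteq> 0" using assms by (simp add: add_eq_0_iff2)
  have "Re ((T - 1) / (T + 1)) = ((cmod T)\<^sup>2 - 1) / (cmod (T + 1))\<^sup>2"
    unfolding Re_divide cmod_power2 by (simp add: power2_eq_square algebra_simps)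
  also have "\<dots> = (cmod T - 1) * ((cmod T + 1) / (cmod (T + 1))\<^sup>2)"
    by (simp add: power2_eq_square algebra_simps diff_divide_distrib add_divide_distrib)
  finally have eq: "Re ((T - 1) / (T + 1)) = (cmod T - 1) * ((cmod T + 1) / (cmod (T + 1))\<^sup>2)" .
  have "0 < (cmod T + 1) / (cmod (T + 1))\<^sup>2" using nz by (intro divide_pos_pos add_nonneg_pos) auto
  then have "sgn ((cmod T + 1) / (cmod (T + 1))\<^sup>2) = 1" by (rule sgn_pos)
  then show ?thesis unfolding eq sgn_mult by (simp only: mult_1_right)
qed

lemma analytic_fold:
  fixes P Q T :: "complex \<Rightarrow> complex"
  assumes W: "open W" "z0 \<in> W" and hol: "P holomorphic_on W" "Q holomorphic_on W" "T holomorphic_on W"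
    and PQ0: "P z0 = 0" "Q z0 = 0"
    and dP: "\<And>z. z \<in> W \<Longrightarrow> deriv P z = T z * deriv Q z"
    and injT: "inj_on T W" and T0: "cmod (T z0) = 1"
    and M: "0 < M" "(deriv ^^ M) (\<lambda>z. P z + Q z) z0 \<noteq> 0"
      "\<And>i. 0 < i \<Longrightarrow> i < M \<Longrightarrow> (deriv ^^ i) (\<lambda>z. P z + Q z) z0 = 0"
    and \<delta>: "0 < \<delta>"
    and mono: "\<And>z w x y. z \<in> W \<Longrightarrow> w \<in> W \<Longrightarrow> T z = T z0 * cis (- x) \<Longrightarrow> T w = T z0 * cis (- y) \<Longrightarrow>
        - \<delta> < x \<Longrightarrow> x < y \<Longrightarrow> y < \<delta> \<Longrightarrow> Re (P z + Q z) < Re (P w + Q w)"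
  obtains n1 n2 :: nat and c :: "real \<Rightarrow> real" and \<rho> a b :: real and U h where
    "1 \<le> n1" "1 \<le> n2" "n1 + n2 = M + 1" "\<bar>2 * int n1 - 1 - int M\<bar> \<le> 1"
    "continuous_on UNIV c" "c 0 = 0" "0 < \<rho>"
    "open U" "z0 \<in> U" "U \<subseteq> W" "continuous_on U h" "inj_on h U" "h ` U = ball 0 1" "h z0 = 0"
    "orientation_preserving_on U h"
    "\<And>z. z \<in> U \<Longrightarrow> shear c (P z + cnj (Q z)) / of_real \<rho> = model_map n1 n2 (h z)"
    "\<And>z. z \<in> U \<Longrightarrow> Im (h z) = 0 \<longleftrightarrow> cmod (T z) = 1"
    "a < 0" "0 < b"
    "\<And>z. z \<in> U \<Longrightarrow> cmod (T z) = 1 \<Longrightarrow> \<exists>x. a < x \<and> x < b \<and> T z = T z0 * cis (- x)"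
    "\<And>x. a < x \<Longrightarrow> x < b \<Longrightarrow> \<bar>x\<bar> < \<delta> \<and> (\<exists>z\<in>U. T z = T z0 * cis (- x))"
proof -
  \<comment> \<open>Chosen so that \<open>T z = T z0 * exp (- \<i> * eta z)\<close> near
    \<open>z0\<close>: \<open>Im (eta z)\<close> is the logarithm of \<open>cmod (T z)\<close>, the
    critical curve is real, and the upper half is the side \<open>cmod (T z) > 1\<close>. In return
    \<open>Re (eta z)\<close> runs against the angle of \<open>T\<close>, whence the
    \<open>cis (- x)\<close> in the statement.\<close>
  define eta where "eta z = \<i> * Ln (T z / T z0)" for z
  define A where "A z = P z + Q z" for z
  define B where "B z = P z - Q z" for z
  have T0nz: "T z0 \<noteq> 0" using T0 by auto
  have holA: "A holomorphic_on W" and holB: "B holomorphic_on W"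
    unfolding A_def B_def by (intro holomorphic_intros hol)+
  have A0: "A z0 = 0" and B0: "B z0 = 0" by (simp_all add: A_def B_def PQ0)
  have eta0: "eta z0 = 0" using T0nz by (simp add: eta_def)
  have contT: "continuous_on W (\<lambda>z. T z / T z0)"
    by (intro continuous_intros holomorphic_on_imp_continuous_on hol) (use T0nz in simp)
  obtain s0 where s0: "0 < s0" "ball z0 s0 \<subseteq> W" "\<And>z. z \<in> ball z0 s0 \<Longrightarrow> 0 < Re (T z / T z0)"
  proof -
    have "open (W \<inter> (\<lambda>z. T z / T z0) -` {w. 0 < Re w})"
      by (rule continuous_open_preimage [OF contT W(1) open_halfspace_Re_gt])
    moreover have "z0 \<in> W \<inter> (\<lambda>z. T z / T z0) -` {w. 0 < Re w}" using W T0nz by simp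
    ultimately obtain s where "0 < s" "ball z0 s \<subseteq> W \<inter> (\<lambda>z. T z / T z0) -` {w. 0 < Re w}" using openE by blast
    then show ?thesis using that by blast
  qed
  have hol_eta: "eta holomorphic_on ball z0 s0"
    unfolding eta_def
  proof (intro holomorphic_intros holomorphic_on_subset [OF hol(3) s0(2)] T0nz)
    fix z assume "z \<in> ball z0 s0"
    then show "T z / T z0 \<notin> \<real>\<^sub>\<le>\<^sub>0" using s0(3) by (metis complex_nonpos_Reals_iff not_le)
  qed
  have T_eta: "T z = T z0 * exp (- \<i> * eta z)" if "z \<in> ball z0 s0" for z
  proof -
    have "T z / T z0 \<noteq> 0" using s0(3) [OF that] by auto
    then show ?thesis using T0nz by (simp add: eta_def mult.assoc [symmetric])
  qed
  have cmod_T: "cmod (T z) = exp (Im (eta z))" if "z \<in> ball z0 s0" for z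
    using arg_cong [OF T_eta [OF that], of cmod] T0 by (simp add: norm_mult)
  have inj_eta: "inj_on eta (ball z0 s0)"
    using injT s0(2) T_eta by (metis (no_types, lifting) inj_on_def subsetD)
  have T_real: "T z = T z0 * cis (- Re (eta z))" if "z \<in> ball z0 s0" "Im (eta z) = 0" for z
  proof -
    have "- \<i> * eta z = \<i> * of_real (- Re (eta z))" using that(2) by (simp add: complex_eq_iff)
    then show ?thesis using T_eta [OF that(1)] by (simp only: cis_conv_exp)
  qed
  have d_eta: "deriv eta z0 \<noteq> 0"
    by (rule holomorphic_injective_imp_regular [OF hol_eta open_ball inj_eta]) (use s0 in simp)
  have A_eq: "A = (\<lambda>z. P z + Q z)" by (rule ext) (rule A_def)
  have MA: "(deriv ^^ M) A z0 \<noteq> 0" "\<And>i. 0 < i \<Longrightarrow> i < M \<Longrightarrow> (deriv ^^ i) A z0 = 0"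
    unfolding A_eq by (fact M(2), fact M(3))
  have d_eta1: "(deriv ^^ 1) eta z0 \<noteq> 0" and z0s: "z0 \<in> ball z0 s0" using d_eta s0(1) by simp_all
  obtain g r1 where g: "0 < r1" "g holomorphic_on ball z0 r1"
      "\<And>w. w \<in> ball z0 r1 \<Longrightarrow> A w - A z0 = (w - z0) ^ M * g w" "\<And>w. w \<in> ball z0 r1 \<Longrightarrow> g w \<noteq> 0"
    by (rule holomorphic_factor_order_of_zero [OF holA W M(1) MA(1) MA(2)]) meson+
  obtain v r2 where v: "0 < r2" "v holomorphic_on ball z0 r2"
      "\<And>w. w \<in> ball z0 r2 \<Longrightarrow> eta w - eta z0 = (w - z0) ^ 1 * v w" "\<And>w. w \<in> ball z0 r2 \<Longrightarrow> v w \<noteq> 0"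
    by (rule holomorphic_factor_order_of_zero [OF hol_eta open_ball z0s zero_less_one d_eta1]) (simp, meson)
  \<comment> \<open>\<open>A\<close> and \<open>eta ^ M\<close> vanish at \<open>z0\<close> to the
    same order, so their quotient extends without zeros; an \<open>M\<close>-th root of it turns
    \<open>eta\<close> into \<open>\<kappa>\<close>.\<close>
  define u where "u z = g z / v z ^ M" for z
  define r3 where "r3 = min s0 (min r1 r2)"
  have r3: "0 < r3" "ball z0 r3 \<subseteq> ball z0 s0" "ball z0 r3 \<subseteq> ball z0 r1" "ball z0 r3 \<subseteq> ball z0 r2"
    using s0 g v by (auto simp: r3_def)
  have hol_u: "u holomorphic_on ball z0 r3"
    unfolding u_def
    by (intro holomorphic_intros holomorphic_on_subset [OF g(2) r3(3)] holomorphic_on_subset [OF v(2) r3(4)])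
       (use v(4) r3(4) in auto)
  have u_nz: "u z \<noteq> 0" if "z \<in> ball z0 r3" for z
    using that g(4) v(4) r3 by (auto simp: u_def)
  have A_u: "A z = eta z ^ M * u z" if "z \<in> ball z0 r3" for z
  proof -
    have "A z = (z - z0) ^ M * g z" "eta z = (z - z0) * v z" "v z \<noteq> 0"
      using g(3) [of z] v(3) [of z] v(4) [of z] that r3 A0 eta0 by auto
    then show ?thesis by (simp add: u_def power_mult_distrib)
  qed
  define u0 where "u0 = u z0"
  have u0: "u0 \<noteq> 0" using u_nz r3 by (simp add: u0_def)
  \<comment> \<open>A logarithm of \<open>u\<close> near \<open>z0\<close> even when
    \<open>u0\<close> lies on the cut, because only \<open>u z / u0\<close>, which is close to 1,
    has to avoid it.\<close>
  define L where "L z = Ln (u z / u0) + Ln u0" for z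
  \<comment> \<open>A deviation below \<open>pi / 8\<close> from the centre at each of two points
    yields the oscillation bound \<open>pi / 4\<close> required of \<open>ell\<close>.\<close>
  obtain r4 where r4: "0 < r4" "r4 \<le> r3" "\<And>z. z \<in> ball z0 r4 \<Longrightarrow> u z / u0 \<notin> \<real>\<^sub>\<le>\<^sub>0"
     "\<And>z. z \<in> ball z0 r4 \<Longrightarrow> \<bar>Im (Ln (u z / u0))\<bar> < pi / 8"
     "\<And>z. z \<in> ball z0 r4 \<Longrightarrow> cmod (eta z) < \<delta>"
  proof -
    have ev: "\<forall>\<^sub>F z in nhds z0. f z < e" if "isCont f z0" "f z0 < e" for f :: "complex \<Rightarrow> real" and e
      using that by (auto simp: isCont_def tendsto_at_iff_tendsto_nhds dest: order_tendstoD(2))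
    have "isCont u z0"
      by (rule field_differentiable_imp_continuous_at, rule holomorphic_on_imp_differentiable_at [OF hol_u open_ball])
         (use r3 in simp)
    then have cu: "isCont (\<lambda>z. u z / u0) z0" using u0 by (intro continuous_intros)
    have u1: "u z0 / u0 = 1" using u0 by (simp add: u0_def)
    have "isCont (\<lambda>z. - Re (u z / u0)) z0" by (intro isCont_minus isCont_Re cu)
    moreover have "- Re (u z0 / u0) < 0" unfolding u1 by simp
    ultimately have e1: "\<forall>\<^sub>F z in nhds z0. - Re (u z / u0) < 0" by (rule ev)
    have "isCont (\<lambda>z. Ln (u z / u0)) z0" by (rule isCont_Ln' [OF cu]) (simp add: u1)
    then have "isCont (\<lambda>z. \<bar>Im (Ln (u z / u0))\<bar>) z0" by (intro isCont_rabs isCont_Im)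
    moreover have "\<bar>Im (Ln (u z0 / u0))\<bar> < pi / 8" unfolding u1 by simp
    ultimately have e2: "\<forall>\<^sub>F z in nhds z0. \<bar>Im (Ln (u z / u0))\<bar> < pi / 8" by (rule ev)
    have "isCont eta z0"
      by (rule field_differentiable_imp_continuous_at, rule holomorphic_on_imp_differentiable_at [OF hol_eta open_ball])
         (use s0 in simp)
    then have "isCont (\<lambda>z. cmod (eta z)) z0" by (rule isCont_norm)
    moreover have "cmod (eta z0) < \<delta>" using eta0 \<delta> by simp
    ultimately have e3: "\<forall>\<^sub>F z in nhds z0. cmod (eta z) < \<delta>" by (rule ev)
    obtain d where d: "0 < d" "\<And>z. dist z z0 < d \<Longrightarrow>
        - Re (u z / u0) < 0 \<and> \<bar>Im (Ln (u z / u0))\<bar> < pi / 8 \<and> cmod (eta z) < \<delta>"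
      using eventually_conj [OF e1 eventually_conj [OF e2 e3]] unfolding eventually_nhds_metric by blast
    show ?thesis
    proof (rule that [of "min d r3"])
      fix z assume "z \<in> ball z0 (min d r3)"
      then have "dist z z0 < d" by (simp add: dist_commute)
      note d' = d(2) [OF this]
      have nn: "w \<notin> \<real>\<^sub>\<le>\<^sub>0" if "- Re w < 0" for w :: complex
        using that by (simp add: complex_nonpos_Reals_iff)
      show "u z / u0 \<notin> \<real>\<^sub>\<le>\<^sub>0" by (rule nn) (use d' in blast)
      show "\<bar>Im (Ln (u z / u0))\<bar> < pi / 8" "cmod (eta z) < \<delta>" using d' by blast+
    qed (use d r3 in auto)
  qed
  have sub43: "ball z0 r4 \<subseteq> ball z0 r3" by (rule subset_ball [OF r4(2)])
  note sub4 = sub43 order_trans [OF sub43 r3(2)] order_trans [OF order_trans [OF sub43 r3(2)] s0(2)]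
  have hol_L: "L holomorphic_on ball z0 r4"
    unfolding L_def
    by (intro holomorphic_intros holomorphic_on_subset [OF hol_u sub4(1)] u0) (use r4(3) in auto)
  have exp_L: "exp (L z) = u z" if "z \<in> ball z0 r4" for z
  proof -
    have "u z \<noteq> 0" by (rule u_nz) (use that sub43 in blast)
    then show ?thesis using u0 by (simp add: L_def exp_add)
  qed
  have osc_L: "\<bar>Im (L z) - Im (L w)\<bar> < pi / 4" if "z \<in> ball z0 r4" "w \<in> ball z0 r4" for z w
    using r4(4) [OF that(1)] r4(4) [OF that(2)] unfolding L_def plus_complex.sel abs_less_iff by linarith
  have mono': "Re (A z) < Re (A w)"
    if z: "z \<in> ball z0 r4" "w \<in> ball z0 r4" "Im (eta z) = 0" "Im (eta w) = 0" "Re (eta z) < Re (eta w)" for z w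
    unfolding A_def
  proof (rule mono [OF _ _ T_real T_real])
    show "- \<delta> < Re (eta z)" "Re (eta w) < \<delta>"
      using r4(5) [OF z(1)] r4(5) [OF z(2)] abs_Re_le_cmod [of "eta z"] abs_Re_le_cmod [of "eta w"] by linarith+
    show "z \<in> W" "w \<in> W" "z \<in> ball z0 s0" "w \<in> ball z0 s0" using z(1,2) sub4(2,3) by blast+
  qed (use z in auto)
  have cos_pos: "0 < cos (Im (L z))" if z: "z \<in> ball z0 r4" "Im (eta z) = 0" "0 < Re (eta z)" for z
  proof -
    have pos: "0 < Re (A z)" using mono' [of z0 z] z r4(1) eta0 A0 by simp
    have "eta z = of_real (Re (eta z))" using z(2) by (simp add: complex_eq_iff)
    then have "eta z ^ M = of_real (Re (eta z) ^ M)" by (metis of_real_power)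
    moreover have "A z = eta z ^ M * u z" by (rule A_u) (use z(1) sub43 in blast)
    ultimately have "A z = of_real (Re (eta z) ^ M) * exp (L z)" using exp_L [OF z(1)] by simp
    then have "Re (A z) = Re (eta z) ^ M * (exp (Re (L z)) * cos (Im (L z)))" by (simp add: Re_exp)
    then show ?thesis using z(3) pos by (simp add: zero_less_mult_iff)
  qed
  obtain zs where zs: "zs \<in> ball z0 r4" "Im (eta zs) = 0" "0 < Re (eta zs)"
  proof -
    have "open (eta ` ball z0 r4)"
      by (rule open_mapping_thm3 [OF holomorphic_on_subset [OF hol_eta sub4(2)] open_ball inj_on_subset [OF inj_eta sub4(2)]])
    moreover have "0 \<in> eta ` ball z0 r4" using eta0 r4 by (intro image_eqI [of _ _ z0]) auto
    ultimately obtain s where s: "0 < s" "cball 0 s \<subseteq> eta ` ball z0 r4" using open_contains_cball by blast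
    have "complex_of_real s \<in> eta ` ball z0 r4" using s by (auto simp: subset_iff)
    then obtain z where "z \<in> ball z0 r4" "complex_of_real s = eta z" by (elim imageE)
    then show ?thesis using s(1) by (intro that [of z]) (metis Im_complex_of_real Re_complex_of_real)+
  qed
  \<comment> \<open>On the right branch \<open>A\<close> has positive real part, so
    \<open>Im (L z)\<close> lies in an even sector. Subtracting \<open>\<i> * i * pi\<close>
    recentres it at 0 and leaves \<open>exp (L z)\<close> unchanged, since \<open>i\<close> is even.
    This fixes the root in \<open>\<kappa>\<close>.\<close>
  obtain i :: int where i: "\<bar>Im (L zs) - of_int i * pi\<bar> < pi / 2"
    using sector_exists [of "Im (L zs)"] cos_pos [OF zs] by auto
  have even_i: "even i" using cos_sector [OF i] cos_pos [OF zs] by (auto split: if_splits)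
  have right: "\<bar>Im (L z) - of_int i * pi\<bar> < pi / 2"
    if z: "z \<in> ball z0 r4" "Im (eta z) = 0" "0 < Re (eta z)" for z
  proof -
    obtain i' :: int where i': "\<bar>Im (L z) - of_int i' * pi\<bar> < pi / 2"
      using sector_exists [of "Im (L z)"] cos_pos [OF z] by auto
    have even_i': "even i'" using cos_sector [OF i'] cos_pos [OF z] by (auto split: if_splits)
    have "\<bar>Im (L zs) - Im (L z)\<bar> < pi" using osc_L [OF zs(1) z(1)] pi_gt_zero by linarith
    then have "i = i'" using sector_unique [OF i i'] even_i even_i' by blast
    then show ?thesis using i' by simp
  qed
  define l where "l z = (L z - \<i> * of_real (of_int i * pi)) / of_nat M" for z
  define \<kappa> where "\<kappa> z = eta z * exp (l z)" for z
  have hol_l: "l holomorphic_on ball z0 r4"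
    unfolding l_def using M(1) by (intro holomorphic_intros hol_L) auto
  have hol_\<kappa>: "\<kappa> holomorphic_on ball z0 r4"
    unfolding \<kappa>_def by (intro holomorphic_intros hol_l holomorphic_on_subset [OF hol_eta sub4(2)])
  have Im_l: "M * Im (l z) = Im (L z) - of_int i * pi" for z
    using M(1) by (simp add: l_def)
  have \<kappa>_pow: "\<kappa> z ^ M = A z" if z: "z \<in> ball z0 r4" for z
  proof -
    have "exp (l z) ^ M = exp (of_nat M * l z)" by (simp add: exp_of_nat_mult)
    also have "of_nat M * l z = L z - \<i> * of_real (of_int i * pi)" using M(1) by (simp add: l_def)
    also have "exp \<dots> = exp (L z) / exp (\<i> * of_real (of_int i * pi))" by (rule exp_diff)
    also have "exp (\<i> * of_real (of_int i * pi)) = 1"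
      unfolding cis_conv_exp [symmetric] using even_i by (simp add: complex_eq_iff mult.commute [of _ pi])
    finally have "exp (l z) ^ M = u z" using exp_L [OF z] by simp
    moreover have "A z = eta z ^ M * u z" by (rule A_u) (use z sub43 in blast)
    ultimately show ?thesis by (simp add: \<kappa>_def power_mult_distrib)
  qed
  have \<kappa>0: "\<kappa> z0 = 0" by (simp add: \<kappa>_def eta0)
  have d_\<kappa>: "deriv \<kappa> z0 \<noteq> 0"
  proof -
    have z0: "z0 \<in> ball z0 r4" using r4 by simp
    have "(eta has_field_derivative deriv eta z0) (at z0)"
      by (rule holomorphic_derivI [OF hol_eta open_ball]) (use s0 in simp)
    moreover have "((\<lambda>z. exp (l z)) has_field_derivative exp (l z0) * deriv l z0) (at z0)"
      using holomorphic_derivI [OF hol_l open_ball z0] by (auto intro!: derivative_eq_intros)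
    ultimately have "(\<kappa> has_field_derivative eta z0 * (exp (l z0) * deriv l z0) + deriv eta z0 * exp (l z0)) (at z0)"
      unfolding \<kappa>_def by (rule DERIV_mult')
    then have "deriv \<kappa> z0 = deriv eta z0 * exp (l z0)" using eta0 by (simp add: DERIV_imp_deriv)
    then show ?thesis using d_eta by simp
  qed
  obtain r5 where r5: "0 < r5" "ball z0 r5 \<subseteq> ball z0 r4" "inj_on \<kappa> (ball z0 r5)"
    using has_complex_derivative_locally_injective [OF hol_\<kappa> _ open_ball d_\<kappa>] r4(1) by auto
  have hol_\<kappa>5: "\<kappa> holomorphic_on ball z0 r5" using hol_\<kappa> r5(2) by (rule holomorphic_on_subset)
  obtain Z where Z: "Z holomorphic_on \<kappa> ` ball z0 r5" "\<And>z. z \<in> ball z0 r5 \<Longrightarrow> Z (\<kappa> z) = z"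
    using holomorphic_has_inverse [OF hol_\<kappa>5 open_ball r5(3)] by metis
  have "open (\<kappa> ` ball z0 r5)" by (rule open_mapping_thm3 [OF hol_\<kappa>5 open_ball r5(3)])
  moreover have "0 \<in> \<kappa> ` ball z0 r5" using \<kappa>0 r5 by (intro image_eqI [of _ _ z0]) auto
  ultimately obtain R1 where R1: "0 < R1" "ball 0 R1 \<subseteq> \<kappa> ` ball z0 r5" using openE by blast
  have Z_in: "Z k \<in> ball z0 r5" "\<kappa> (Z k) = k" if "k \<in> ball 0 R1" for k
  proof -
    have "k \<in> \<kappa> ` ball z0 r5" using R1 that by blast
    then show "Z k \<in> ball z0 r5" "\<kappa> (Z k) = k" using Z(2) by auto
  qed
  have Z_in4: "Z k \<in> ball z0 r4" "Z k \<in> W" if "k \<in> ball 0 R1" for k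
  proof -
    show "Z k \<in> ball z0 r4" using Z_in(1) [OF that] r5(2) by blast
    then show "Z k \<in> W" using sub4(3) by blast
  qed
  have hol_Z: "Z holomorphic_on ball 0 R1" using Z(1) R1(2) by (rule holomorphic_on_subset)
  have Z0: "Z 0 = z0" using Z(2) [of z0] \<kappa>0 r5 by simp
  have holc: "(\<lambda>k. G (Z k)) holomorphic_on ball 0 R1" if "G holomorphic_on ball z0 r4" for G
    using holomorphic_on_compose_gen [OF hol_Z that] Z_in4 by (auto simp: o_def image_subset_iff)
  have dZ: "((\<lambda>k. G (Z k)) has_field_derivative deriv G (Z k) * deriv Z k) (at k)"
    if "G holomorphic_on W" "k \<in> ball 0 R1" for G k
    by (rule DERIV_chain2 [OF holomorphic_derivI [OF that(1) W(1)] holomorphic_derivI [OF hol_Z open_ball]])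
       (use Z_in4 that in auto)
  have Im_eta_sgn: "sgn (Im (eta z)) = sgn (cmod (T z) - 1)" if "z \<in> ball z0 s0" for z
    using cmod_T [OF that] by (auto simp: sgn_real_def)
  have sgn: "sgn (Re (deriv (\<lambda>k. B (Z k)) k / (of_nat M * k ^ (M - 1)))) = sgn (Im (eta (Z k)))"
    if k: "k \<in> ball 0 R1" "k \<noteq> 0" for k
  proof -
    let ?z = "Z k"
    have zW: "?z \<in> W" and zs0: "?z \<in> ball z0 s0" using Z_in4 [OF k(1)] sub4(2) by blast+
    have fd: "P field_differentiable at ?z" "Q field_differentiable at ?z"
      using hol W zW holomorphic_on_imp_differentiable_at by blast+
    have dA: "deriv A ?z = (T ?z + 1) * deriv Q ?z" and dB: "deriv B ?z = (T ?z - 1) * deriv Q ?z"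
      unfolding A_def B_def using fd dP [OF zW] by (simp_all add: algebra_simps)
    have "((\<lambda>k. k ^ M) has_field_derivative of_nat M * k ^ (M - 1)) (at k)"
      by (auto intro!: derivative_eq_intros)
    moreover have "((\<lambda>k. k ^ M) has_field_derivative deriv A ?z * deriv Z k) (at k)"
      by (rule has_field_derivative_transform_within_open [OF dZ [OF holA k(1)] open_ball k(1)])
         (use \<kappa>_pow Z_in Z_in4 in metis)
    \<comment> \<open>The two derivatives of \<open>k ^ M = A (Z k)\<close>. For \<open>k\<close>
      other than 0 they are nonzero, which excludes \<open>T = -1\<close> and lets the common factor
      cancel from the quotient of \<open>deriv B\<close> and \<open>deriv A\<close>.\<close>
    ultimately have eq: "of_nat M * k ^ (M - 1) = (T ?z + 1) * (deriv Q ?z * deriv Z k)"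
      using DERIV_unique dA by (metis mult.assoc)
    moreover have "of_nat M * k ^ (M - 1) \<noteq> 0" using k(2) M(1) by simp
    ultimately have nz: "T ?z + 1 \<noteq> 0" "deriv Q ?z * deriv Z k \<noteq> 0" by auto
    have "deriv (\<lambda>k. B (Z k)) k = (T ?z - 1) * (deriv Q ?z * deriv Z k)"
      using DERIV_imp_deriv [OF dZ [OF holB k(1)]] dB by (simp add: mult.assoc)
    then have "deriv (\<lambda>k. B (Z k)) k / (of_nat M * k ^ (M - 1)) = (T ?z - 1) / (T ?z + 1)"
      unfolding eq using nz by simp
    moreover have "T ?z \<noteq> - 1" using nz(1) by auto
    ultimately show ?thesis using Re_cayley [of "T ?z"] Im_eta_sgn [OF zs0] by simp
  qed
  have A_Z: "k ^ M = A (Z k)" if "k \<in> ball 0 R1" for k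
    using \<kappa>_pow [OF Z_in4(1) [OF that]] Z_in(2) [OF that] by simp
  obtain n1 n2 :: nat and c :: "real \<Rightarrow> real" and \<rho> a b :: real and U' ch where fc:
    "1 \<le> n1" "1 \<le> n2" "n1 + n2 = M + 1" "\<bar>2 * int n1 - 1 - int M\<bar> \<le> 1"
    "continuous_on UNIV c" "c 0 = 0" "0 < \<rho>"
    "open U'" "0 \<in> U'" "U' \<subseteq> ball 0 R1" "continuous_on U' ch" "inj_on ch U'" "ch ` U' = ball 0 1" "ch 0 = 0"
    "\<And>z. z \<in> U' \<Longrightarrow> z \<noteq> 0 \<Longrightarrow> ch z / eta (Z z) \<notin> \<real>\<^sub>\<le>\<^sub>0"
    "\<And>z. z \<in> U' \<Longrightarrow> shear c (Complex (Re (z ^ M)) (Im (B (Z z)))) / of_real \<rho> = model_map n1 n2 (ch z)"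
    "\<And>z. z \<in> U' \<Longrightarrow> Im (ch z) = 0 \<longleftrightarrow> Im (eta (Z z)) = 0"
    "a < 0" "0 < b"
    "\<And>z. z \<in> U' \<Longrightarrow> Im (eta (Z z)) = 0 \<Longrightarrow> a < Re (eta (Z z)) \<and> Re (eta (Z z)) < b"
    "\<And>x. a < x \<Longrightarrow> x < b \<Longrightarrow> \<exists>z\<in>U'. eta (Z z) = of_real x"
  proof (rule exists_fold_chart [of M R1 "\<lambda>k. l (Z k)" "\<lambda>k. eta (Z k)" "\<lambda>k. B (Z k)"])
    show "0 < M" "0 < R1" using M R1 by auto
    show "(\<lambda>k. l (Z k)) holomorphic_on ball 0 R1" by (rule holc [OF hol_l])
    show "(\<lambda>k. B (Z k)) holomorphic_on ball 0 R1"
      by (rule holc) (rule holomorphic_on_subset [OF holB sub4(3)])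
    show "B (Z 0) = 0" by (simp add: Z0 B0)
    show "eta (Z z) = z * exp (- l (Z z))" if "z \<in> ball 0 R1" for z
    proof -
      have "z = eta (Z z) * exp (l (Z z))" using Z_in(2) [OF that] by (simp add: \<kappa>_def)
      then have "z * exp (- l (Z z)) = eta (Z z) * (exp (l (Z z)) * exp (- l (Z z)))" by (metis mult.assoc)
      then show ?thesis by (simp add: exp_minus_inverse)
    qed
    show "inj_on (\<lambda>k. eta (Z k)) (ball 0 R1)"
    proof (rule inj_onI)
      fix x y assume xy: "x \<in> ball 0 R1" "y \<in> ball 0 R1" "eta (Z x) = eta (Z y)"
      then have "Z x = Z y" using inj_onD [OF inj_eta] Z_in4 sub4(2) by blast
      then show "x = y" using Z_in(2) xy by metis
    qed
    show "Re (z ^ M) < Re (w ^ M)" if "z \<in> ball 0 R1" "w \<in> ball 0 R1" "Im (eta (Z z)) = 0"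
      "Im (eta (Z w)) = 0" "Re (eta (Z z)) < Re (eta (Z w))" for z w
      unfolding A_Z [OF that(1)] A_Z [OF that(2)] by (rule mono') (use that Z_in4 in auto)
    show "\<bar>M * Im (l (Z z)) - M * Im (l (Z w))\<bar> < pi / 4" if "z \<in> ball 0 R1" "w \<in> ball 0 R1" for z w
      unfolding Im_l using osc_L [of "Z z" "Z w"] that Z_in4 by simp
    show "\<bar>M * Im (l (Z z))\<bar> < pi / 2" if "z \<in> ball 0 R1" "Im (eta (Z z)) = 0" "0 < Re (eta (Z z))" for z
      unfolding Im_l using right [of "Z z"] that Z_in4 by simp
  qed (use sgn in auto)
  define U where "U = ball z0 r5 \<inter> \<kappa> -` U'"
  define h where "h z = ch (\<kappa> z)" for z
  have U': "Z k \<in> U \<and> \<kappa> (Z k) = k" if "k \<in> U'" for k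
    using that fc(10) Z_in [of k] by (auto simp: U_def)
  have U: "\<kappa> z \<in> U'" "Z (\<kappa> z) = z" "z \<in> W" "z \<in> ball z0 s0" "z \<in> ball z0 r4" if "z \<in> U" for z
  proof -
    have z5: "z \<in> ball z0 r5" and k: "\<kappa> z \<in> U'" using that by (auto simp: U_def)
    show "\<kappa> z \<in> U'" by (rule k)
    show "Z (\<kappa> z) = z" by (rule Z(2) [OF z5])
    show z4: "z \<in> ball z0 r4" using z5 r5(2) by blast
    show "z \<in> W" "z \<in> ball z0 s0" using z4 sub4(2,3) by blast+
  qed
  have cont_\<kappa>: "continuous_on (ball z0 r5) \<kappa>" using hol_\<kappa>5 by (rule holomorphic_on_imp_continuous_on)
  have openU: "open U" unfolding U_def by (rule continuous_open_preimage [OF cont_\<kappa> open_ball fc(8)])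
  have z0U: "z0 \<in> U" using r5 \<kappa>0 fc(9) by (simp add: U_def)
  have cont_h: "continuous_on U h" unfolding h_def
    by (rule continuous_on_compose2 [OF fc(11) continuous_on_subset [OF cont_\<kappa>]]) (auto simp: U_def)
  have inj_h: "inj_on h U"
  proof (rule inj_onI)
    fix x y assume xy: "x \<in> U" "y \<in> U" "h x = h y"
    then have "\<kappa> x = \<kappa> y" using inj_onD [OF fc(12)] U(1) by (auto simp: h_def)
    then show "x = y" using U(2) xy by metis
  qed
  have img: "h ` U = ball 0 1"
  proof -
    have "\<kappa> ` U = U'" using U(1) U' by (metis (no_types, lifting) image_eqI image_subsetI subsetI subset_antisym)
    then show ?thesis unfolding h_def fc(13) [symmetric] by (metis image_image)
  qed
  obtain g' where hom: "homeomorphism U (ball 0 1) h g'"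
    using invariance_of_domain_homeomorphism [OF openU cont_h _ inj_h] img by auto
  have "connected U"
  proof -
    have "U = g' ` ball 0 1" "continuous_on (ball 0 1) g'" using hom by (auto simp: homeomorphism_def)
    then show ?thesis by (metis connected_ball connected_continuous_image)
  qed
  have h0: "h z0 = 0" by (simp add: h_def \<kappa>0 fc(14))
  have sub0: "U \<subseteq> ball z0 s0" using U(4) by auto
  have orient: "orientation_preserving_on U h"
  proof (rule orientation_preserving_near_conformal
      [where g = eta, OF openU \<open>connected U\<close> z0U cont_h inj_h h0 _ _ eta0])
    show "eta holomorphic_on U" by (rule holomorphic_on_subset [OF hol_eta sub0])
    show "inj_on eta U" by (rule inj_on_subset [OF inj_eta sub0])
    show "h z / eta z \<notin> \<real>\<^sub>\<le>\<^sub>0" if "z \<in> U" "z \<noteq> z0" for z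
    proof -
      have "\<kappa> z \<noteq> 0" using U(2) [OF that(1)] Z0 that(2) by auto
      then show ?thesis using fc(15) [OF U(1) [OF that(1)]] U(2) [OF that(1)] by (simp add: h_def)
    qed
  qed
  have eta_T: "Im (eta z) = 0 \<longleftrightarrow> cmod (T z) = 1" if "z \<in> U" for z
    using cmod_T [OF U(4) [OF that]] by simp
  show ?thesis
  proof (rule that [of n1 n2 c \<rho> U h a b])
    show "shear c (P z + cnj (Q z)) / of_real \<rho> = model_map n1 n2 (h z)" if "z \<in> U" for z
    proof -
      have "\<kappa> z ^ M = A z" by (rule \<kappa>_pow [OF U(5) [OF that]])
      then have "Complex (Re (\<kappa> z ^ M)) (Im (B (Z (\<kappa> z)))) = P z + cnj (Q z)"
        unfolding U(2) [OF that] by (simp add: complex_eq_iff A_def B_def)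
      then show ?thesis using fc(16) [OF U(1) [OF that]] by (simp add: h_def)
    qed
    show "Im (h z) = 0 \<longleftrightarrow> cmod (T z) = 1" if "z \<in> U" for z
      using fc(17) [OF U(1) [OF that]] U(2) [OF that] eta_T [OF that] by (simp add: h_def)
    show "\<exists>x. a < x \<and> x < b \<and> T z = T z0 * cis (- x)" if "z \<in> U" "cmod (T z) = 1" for z
    proof -
      have e: "Im (eta z) = 0" using eta_T that by auto
      then show ?thesis
        using fc(20) [OF U(1) [OF that(1)]] U(2) [OF that(1)] T_real [OF U(4) [OF that(1)] e]
        by (intro exI [of _ "Re (eta z)"]) auto
    qed
    show "\<bar>x\<bar> < \<delta> \<and> (\<exists>z\<in>U. T z = T z0 * cis (- x))" if "a < x" "x < b" for x
    proof -
      obtain k where k: "k \<in> U'" "eta (Z k) = of_real x" using fc(21) [OF \<open>a < x\<close> \<open>x < b\<close>] by blast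
      then have ZU: "Z k \<in> U" using U' by auto
      have "cmod (eta (Z k)) < \<delta>" by (rule r4(5) [OF U(5) [OF ZU]])
      then have "\<bar>x\<bar> < \<delta>" by (simp add: k(2))
      moreover have "T (Z k) = T z0 * cis (- x)" using T_real [OF U(4) [OF ZU]] by (simp add: k(2))
      ultimately show ?thesis using ZU by blast
    qed
    show "U \<subseteq> W" using U(3) by auto
  qed (fact fc openU z0U cont_h inj_h img h0 orient)+
qed

section \<open>The critical value curve\<close>

text \<open>At order \<open>n\<close> only the term with every derivative on \<open>R\<close>
  survives. If also \<open>S z = 0\<close>, the next order keeps just the terms with one derivative
  on \<open>S\<close>. The two cases give the order of \<open>A\<close> for odd and for even
  \<open>j\<close>.\<close>

lemma leibniz_lowest:
  assumes W: "open W" "z \<in> W" and hol: "S holomorphic_on W" "R holomorphic_on W"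
    and R: "\<And>k. k < n \<Longrightarrow> (deriv ^^ k) R z = 0"
  shows "k < n \<Longrightarrow> (deriv ^^ k) (\<lambda>w. S w * R w) z = 0"
    and "(deriv ^^ n) (\<lambda>w. S w * R w) z = S z * (deriv ^^ n) R z"
    and "S z = 0 \<Longrightarrow> (deriv ^^ Suc n) (\<lambda>w. S w * R w) z = of_nat (Suc n) * deriv S z * (deriv ^^ n) R z"
proof -
  note mult = higher_deriv_mult [OF hol W]
  show "(deriv ^^ k) (\<lambda>w. S w * R w) z = 0" if "k < n"
    unfolding mult by (intro sum.neutral ballI) (use that R in auto)
  have "(\<Sum>i = 0..n. of_nat (n choose i) * (deriv ^^ i) S z * (deriv ^^ (n - i)) R z)
      = (\<Sum>i\<in>{0}. of_nat (n choose i) * (deriv ^^ i) S z * (deriv ^^ (n - i)) R z)"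
    by (rule sum.mono_neutral_right) (use R in auto)
  then show "(deriv ^^ n) (\<lambda>w. S w * R w) z = S z * (deriv ^^ n) R z"
    unfolding mult by simp
  assume S: "S z = 0"
  have "(\<Sum>i = 0..Suc n. of_nat (Suc n choose i) * (deriv ^^ i) S z * (deriv ^^ (Suc n - i)) R z)
      = (\<Sum>i\<in>{1}. of_nat (Suc n choose i) * (deriv ^^ i) S z * (deriv ^^ (Suc n - i)) R z)"
  proof (rule sum.mono_neutral_right)
    show "\<forall>i\<in>{0..Suc n} - {1}. of_nat (Suc n choose i) * (deriv ^^ i) S z * (deriv ^^ (Suc n - i)) R z = 0"
    proof
      fix i assume "i \<in> {0..Suc n} - {1}"
      then consider "i = 0" | "Suc n - i < n" by fastforce
      then show "of_nat (Suc n choose i) * (deriv ^^ i) S z * (deriv ^^ (Suc n - i)) R z = 0"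
        by cases (use S R in auto)
    qed
  qed auto
  then show "(deriv ^^ Suc n) (\<lambda>w. S w * R w) z = of_nat (Suc n) * deriv S z * (deriv ^^ n) R z"
    unfolding mult by simp
qed

lemma isCont_zero_punctured:
  fixes f :: "'a::{perfect_space,metric_space} \<Rightarrow> 'b::real_normed_vector"
  assumes "isCont f a" "\<forall>\<^sub>F x in at a. f x = 0"
  shows "f a = 0"
proof -
  have "(f \<longlongrightarrow> f a) (at a)" using assms(1) by (simp add: isCont_def)
  moreover have "(f \<longlongrightarrow> 0) (at a)" using assms(2) by (rule tendsto_eventually)
  ultimately show ?thesis using tendsto_unique by (metis trivial_limit_at)
qed

text \<open>A vanishing derivative at 0 does no harm: an interval across 0 is cut there, and each
  piece has a positive derivative in its interior.\<close>

lemma increasing_punctured: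
  fixes \<phi> \<phi>' :: "real \<Rightarrow> real"
  assumes der: "\<And>t. \<bar>t\<bar> < \<delta> \<Longrightarrow> (\<phi> has_real_derivative \<phi>' t) (at t)"
    and pos: "\<And>t. \<bar>t\<bar> < \<delta> \<Longrightarrow> t \<noteq> 0 \<Longrightarrow> 0 < \<phi>' t"
    and tt: "- \<delta> < t" "t < t'" "t' < \<delta>"
  shows "\<phi> t < \<phi> t'"
proof -
  have *: "\<phi> x < \<phi> y" if "- \<delta> < x" "x < y" "y < \<delta>" "\<not> (x < 0 \<and> 0 < y)" for x y
  proof (rule DERIV_pos_imp_increasing_open [OF that(2)])
    fix u assume u: "x < u" "u < y"
    then have "\<bar>u\<bar> < \<delta>" "u \<noteq> 0" using that by auto
    then show "\<exists>d. (\<phi> has_real_derivative d) (at u) \<and> 0 < d" using der pos by blast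
  next
    show "continuous_on {x..y} \<phi>"
    proof (rule continuous_at_imp_continuous_on, rule ballI)
      fix u assume "u \<in> {x..y}"
      then have "\<bar>u\<bar> < \<delta>" using that by auto
      then show "isCont \<phi> u" using der DERIV_isCont by blast
    qed
  qed
  show ?thesis
  proof (cases "t < 0 \<and> 0 < t'")
    case True
    then have "\<phi> t < \<phi> 0" "\<phi> 0 < \<phi> t'" using * [of t 0] * [of 0 t'] tt by auto
    then show ?thesis by simp
  next
    case False then show ?thesis using * tt by blast
  qed
qed

text \<open>The tangent direction of the critical value curve turns with constant speed: up to a
  real factor it is \<open>cis (t / 2)\<close> or \<open>\<i> * cis (t / 2)\<close>, according to the parity of the order.\<close>

lemma critical_values_strict_mono:
  fixes G :: "complex \<Rightarrow> complex" and e :: complex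
  assumes r: "0 < r" and hol: "G holomorphic_on ball 0 r"
    and j: "0 < j" "\<And>i. 0 < i \<Longrightarrow> i < j \<Longrightarrow> (deriv ^^ i) G 0 = 0" "(deriv ^^ j) G 0 \<noteq> 0"
    and e: "e \<noteq> 0"
    and dir: "\<And>t. \<bar>t\<bar> < r \<Longrightarrow> \<exists>y. e * deriv G (of_real t) = (if odd j then 1 else -1) * cis t * y + cnj y"
  obtains s \<delta> :: real where "s = 1 \<or> s = -1" "0 < \<delta>" "\<delta> \<le> r"
    "\<And>t t'. - \<delta> < t \<Longrightarrow> t < t' \<Longrightarrow> t' < \<delta> \<Longrightarrow> s * Re (e * G (of_real t)) < s * Re (e * G (of_real t'))"
proof -
  have z0: "(0::complex) \<in> ball 0 r" using r by simp
  obtain g r' where g: "0 < r'" "g holomorphic_on ball 0 r'"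
      "\<And>w. w \<in> ball 0 r' \<Longrightarrow> G w - G 0 = (w - 0) ^ j * g w" "\<And>w. w \<in> ball 0 r' \<Longrightarrow> g w \<noteq> 0"
    by (rule holomorphic_factor_order_of_zero [OF hol open_ball z0 j(1,3,2)]) meson+
  define rr where "rr = min r r'"
  have rr: "0 < rr" "rr \<le> r" "rr \<le> r'" using r g(1) by (auto simp: rr_def)
  define w2 where "w2 w = of_nat j * g w + w * deriv g w" for w
  have dG: "deriv G w = w ^ (j - 1) * w2 w" if w: "w \<in> ball 0 rr" for w
  proof (rule DERIV_imp_deriv, rule has_field_derivative_transform_within_open [OF _ open_ball w])
    have w': "w \<in> ball 0 r'" using w rr by auto
    have "w ^ j = w * w ^ (j - 1)" using j(1) by (simp add: power_eq_if)
    then show "((\<lambda>w. G 0 + w ^ j * g w) has_field_derivative w ^ (j - 1) * w2 w) (at w)"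
      using holomorphic_derivI [OF g(2) open_ball w'] unfolding w2_def
      by (auto intro!: derivative_eq_intros simp: algebra_simps)
    show "G 0 + x ^ j * g x = G x" if "x \<in> ball 0 rr" for x
    proof -
      have "x \<in> ball 0 r'" using that rr by auto
      from g(3) [OF this] show ?thesis by (simp add: algebra_simps)
    qed
  qed
  have hol_w2: "w2 holomorphic_on ball 0 r'"
    unfolding w2_def by (intro holomorphic_intros g(2) holomorphic_deriv) auto
  \<comment> \<open>The zero of \<open>deriv G\<close> and half of the rotation \<open>cis t\<close>
    are divided out. What remains is continuous and nonzero at 0, and \<open>dir\<close> makes it
    real for odd \<open>j\<close> and imaginary for even \<open>j\<close>. \<open>Rp\<close> is the
    surviving component, \<open>Op\<close> the vanishing one.\<close>
  define V where "V t = cis (- (t / 2)) * (e * w2 (of_real t))" for t :: real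
  define Rp where "Rp z = (if odd j then Re z else Im z)" for z
  define Op where "Op z = (if odd j then Im z else Re z)" for z
  have contV: "isCont V 0"
  proof -
    have "isCont w2 (complex_of_real 0)"
      by (rule field_differentiable_imp_continuous_at, rule holomorphic_on_imp_differentiable_at [OF hol_w2 open_ball])
         (use g in simp)
    then have "isCont (\<lambda>t. w2 (complex_of_real t)) 0"
      by (rule isCont_o2 [rotated]) (intro continuous_intros)
    moreover have "continuous_on UNIV (\<lambda>t::real. cis (- (t / 2)))" by (intro continuous_intros) auto
    then have "isCont (\<lambda>t. cis (- (t / 2))) 0" by (simp add: continuous_on_eq_continuous_at)
    ultimately show ?thesis unfolding V_def by (intro continuous_intros)
  qed
  have contRO: "isCont (\<lambda>t. Rp (V t)) 0" "isCont (\<lambda>t. Op (V t)) 0"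
    using isCont_Re [OF contV] isCont_Im [OF contV] by (cases "odd j"; simp add: Rp_def Op_def)+
  have eG: "e * deriv G (of_real t) = of_real (t ^ (j - 1)) * (cis (t / 2) * V t)" if "\<bar>t\<bar> < rr" for t
  proof -
    have "cis (t / 2) * V t = e * w2 (of_real t)"
      by (simp add: V_def mult.assoc [symmetric] cis_mult)
    moreover have "complex_of_real t \<in> ball 0 rr" using that by simp
    ultimately show ?thesis using dG by simp
  qed
  have OpV: "Op (V t) = 0" if t: "\<bar>t\<bar> < rr" "t \<noteq> 0" for t
  proof -
    obtain y where y: "e * deriv G (of_real t) = (if odd j then 1 else -1) * cis t * y + cnj y"
      using dir [of t] t rr by auto
    define E where "E = cis (t / 2) * y"
    have "of_real (t ^ (j - 1)) * V t = cis (- (t / 2)) * (e * deriv G (of_real t))"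
      unfolding eG [OF t(1)] by (simp add: mult_ac cis_mult)
    also have "\<dots> = (if odd j then 1 else -1) * (cis (- (t / 2)) * cis t * y) + cis (- (t / 2)) * cnj y"
      unfolding y by (simp add: algebra_simps)
    also have "\<dots> = (if odd j then 1 else -1) * E + cnj E"
      by (simp add: E_def cis_mult cis_cnj)
    finally have eq: "of_real (t ^ (j - 1)) * V t = (if odd j then 1 else -1) * E + cnj E" .
    have "Op (of_real (t ^ (j - 1)) * V t) = t ^ (j - 1) * Op (V t)" by (simp add: Op_def flip: of_real_power)
    moreover have "Op ((if odd j then 1 else -1) * E + cnj E) = 0" by (simp add: Op_def)
    ultimately have "t ^ (j - 1) * Op (V t) = 0" using eq by simp
    then show ?thesis using t(2) by simp
  qed
  have "\<forall>\<^sub>F t in at 0. Op (V t) = 0"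
    unfolding eventually_at using rr(1) OpV by (intro exI [of _ rr]) auto
  then have "Op (V 0) = 0" by (rule isCont_zero_punctured [OF contRO(2)])
  moreover have "V 0 \<noteq> 0" using e j(1) g(1,4) by (simp add: V_def w2_def)
  ultimately have Rp0: "Rp (V 0) \<noteq> 0" by (auto simp: Rp_def Op_def complex_eq_iff split: if_splits)
  define \<sigma> where "\<sigma> = sgn (Rp (V 0))"
  have "isCont (\<lambda>t. \<sigma> * Rp (V t)) 0" by (intro isCont_mult contRO(1) continuous_const)
  then have "((\<lambda>t. \<sigma> * Rp (V t)) \<longlongrightarrow> \<sigma> * Rp (V 0)) (nhds 0)"
    unfolding isCont_def tendsto_at_iff_tendsto_nhds [of "\<lambda>t. \<sigma> * Rp (V t)" 0] .
  moreover have "0 < \<sigma> * Rp (V 0)" using Rp0 by (simp add: \<sigma>_def sgn_real_def)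
  ultimately have "\<forall>\<^sub>F t in nhds 0. 0 < \<sigma> * Rp (V t)"
    by (rule order_tendstoD(1))
  then obtain d where d: "0 < d" "\<And>t. dist t 0 < d \<Longrightarrow> 0 < \<sigma> * Rp (V t)"
    unfolding eventually_nhds_metric by blast
  \<comment> \<open>The bound 1 keeps \<open>t / 2\<close> within a quarter turn, so that its cosine
    is positive and its sine has the sign of \<open>t\<close>.\<close>
  define \<delta> where "\<delta> = min d (min rr 1)"
  have \<delta>: "0 < \<delta>" "\<delta> \<le> d" "\<delta> \<le> rr" "\<delta> \<le> 1" using d rr by (auto simp: \<delta>_def)
  \<comment> \<open>For imaginary \<open>V t\<close> the real part of
    \<open>cis (t / 2) * V t\<close> is minus the sine times \<open>Im (V t)\<close>; hence the
    extra sign for even \<open>j\<close>.\<close>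
  define s where "s = (if odd j then \<sigma> else - \<sigma>)"
  define \<phi>' where "\<phi>' t = s * Re (e * deriv G (of_real t))" for t
  have der: "((\<lambda>t. s * Re (e * G (of_real t))) has_real_derivative \<phi>' t) (at t)" if t: "\<bar>t\<bar> < \<delta>" for t
  proof -
    have tb: "complex_of_real t \<in> ball 0 r" using t \<delta> rr by simp
    have "(of_real has_vector_derivative (1::complex)) (at t)"
      by (auto intro!: derivative_eq_intros)
    from field_vector_diff_chain_at [OF this holomorphic_derivI [OF hol open_ball tb]]
    have "((\<lambda>t. G (of_real t)) has_vector_derivative deriv G (of_real t)) (at t)" by (simp add: o_def)
    then have "((\<lambda>t. e * G (of_real t)) has_vector_derivative e * deriv G (of_real t)) (at t)"
      by (rule has_vector_derivative_mult_right)
    then have "((\<lambda>t. Re (e * G (of_real t))) has_vector_derivative Re (e * deriv G (of_real t))) (at t)"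
      by (rule bounded_linear.has_vector_derivative [OF bounded_linear_Re])
    then have "((\<lambda>t. Re (e * G (of_real t))) has_real_derivative Re (e * deriv G (of_real t))) (at t)"
      by (simp only: has_real_derivative_iff_has_vector_derivative)
    then show ?thesis unfolding \<phi>'_def by (rule DERIV_cmult)
  qed
  have pos: "0 < \<phi>' t" if t: "\<bar>t\<bar> < \<delta>" "t \<noteq> 0" for t
  proof -
    have trr: "\<bar>t\<bar> < rr" using t \<delta> by simp
    have V: "0 < \<sigma> * Rp (V t)" using d(2) [of t] t \<delta> by simp
    have O: "Op (V t) = 0" using OpV [OF trr t(2)] .
    have re: "Re (e * deriv G (of_real t)) = t ^ (j - 1) * Re (cis (t / 2) * V t)"
      unfolding eG [OF trr] by (simp flip: of_real_power)
    have ph: "\<phi>' t = s * (t ^ (j - 1) * Re (cis (t / 2) * V t))" unfolding \<phi>'_def re ..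
    show ?thesis
    proof (cases "odd j")
      case True
      then have "\<phi>' t = (t ^ (j - 1) * cos (t / 2)) * (\<sigma> * Rp (V t))"
        using O unfolding ph by (simp add: s_def Rp_def Op_def)
      moreover have "0 < t ^ (j - 1)" using True t(2) by (intro zero_less_power_eq [THEN iffD2]) auto
      moreover have "0 < cos (t / 2)"
        by (rule cos_gt_zero_pi) (use t \<delta>(4) pi_gt3 in linarith)+
      ultimately show ?thesis using V by simp
    next
      case False
      then have "\<phi>' t = (t ^ (j - 1) * sin (t / 2)) * (\<sigma> * Rp (V t))"
        using O unfolding ph by (simp add: s_def Rp_def Op_def)
      \<comment> \<open>Here the right angle of the cusp pays off: \<open>j - 1\<close> is odd, so
        the power and the sine change sign together at 0.\<close>
      moreover have "0 < t ^ (j - 1) * sin (t / 2)"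
      proof (cases "0 < t")
        case True
        then have "0 < sin (t / 2)" by (intro sin_gt_zero) (use t \<delta>(4) pi_gt3 in linarith)+
        then show ?thesis using True by simp
      next
        case neg: False
        have "0 < sin (- t / 2)" by (intro sin_gt_zero) (use t neg \<delta>(4) pi_gt3 in linarith)+
        then have "sin (t / 2) < 0" by simp
        moreover have "odd (j - 1)" using False j(1) by simp
        then have "t ^ (j - 1) < 0" using neg t(2) by (simp add: power_less_zero_eq)
        ultimately show ?thesis by (rule mult_neg_neg [rotated])
      qed
      ultimately show ?thesis using V by simp
    qed
  qed
  show ?thesis
  proof (rule that [of s \<delta>])
    show "s = 1 \<or> s = -1" using Rp0 by (auto simp: s_def \<sigma>_def sgn_real_def)
    show "0 < \<delta>" "\<delta> \<le> r" using \<delta> rr by auto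
    show "s * Re (e * G (of_real t)) < s * Re (e * G (of_real t'))"
      if "- \<delta> < t" "t < t'" "t' < \<delta>" for t t'
      by (rule increasing_punctured [OF der pos that])
  qed
qed

text \<open>An odd number of half turns takes the negative half-axis to itself. This is what
  identifies the critical value curve with the real diameter.\<close>

lemma model_map_real:
  assumes "Im w = 0" "1 \<le> n1"
  shows "model_map n1 n2 w = w"
proof -
  define x where "x = Re w"
  have w: "w = of_real x" using assms(1) by (simp add: complex_eq_iff x_def)
  have odd: "cis ((2 * real n1 - 1) * pi) = - 1"
    using cis_odd_pi [of "2 * n1 - 1"] assms(2) by (simp add: of_nat_diff)
  show ?thesis
  proof (cases "0 \<le> x")
    case True
    then show ?thesis using model_map_upper [of x 0 n1 n2] by (simp add: w)
  next
    case False
    then show ?thesis using model_map_upper [of "- x" pi n1 n2] odd by (simp add: w)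
  qed
qed

section \<open>The theorem\<close>

text \<open>The Jacobian is \<open>(cmod (deriv q z))\<^sup>2\<close> times
  \<open>(cmod (\<psi> z))\<^sup>2 - 1\<close>. At \<open>a\<close> the first factor may vanish, so
  \<open>cmod (\<psi> a) = 1\<close> is taken from nearby critical points: were it false, one of
  them would have \<open>deriv q z = 0\<close> with \<open>z\<close> different from
  \<open>a\<close>.\<close>

lemma critical_dichotomy:
  assumes W: "open W" "a \<in> W" and hol: "p holomorphic_on W" "q holomorphic_on W" "\<psi> holomorphic_on W"
    and f: "\<And>z. z \<in> W \<Longrightarrow> f z = p z + cnj (q z)"
    and \<psi>: "\<And>z. z \<in> W - {a} \<Longrightarrow> deriv q z \<noteq> 0 \<and> \<psi> z = deriv p z / deriv q z"
    and crit: "smooth_critical_point f \<Omega> a" and \<Omega>: "open \<Omega>"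
  shows "\<And>z. z \<in> W \<Longrightarrow> deriv p z = \<psi> z * deriv q z" "cmod (\<psi> a) = 1"
    "\<And>z. z \<in> W \<Longrightarrow> jacobian f z = 0 \<longleftrightarrow> cmod (\<psi> z) = 1"
proof -
  show dp: "deriv p z = \<psi> z * deriv q z" if z: "z \<in> W" for z
  proof (cases "z = a")
    case False then show ?thesis using \<psi> [of z] z by simp
  next
    case True
    have "(\<lambda>z. deriv p z - \<psi> z * deriv q z) holomorphic_on W"
      by (intro holomorphic_intros hol holomorphic_deriv W)
    then have "isCont (\<lambda>z. deriv p z - \<psi> z * deriv q z) a"
      using W by (meson continuous_on_eq_continuous_at holomorphic_on_imp_continuous_on)
    moreover have "\<forall>\<^sub>F z in at a. deriv p z - \<psi> z * deriv q z = 0"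
      unfolding eventually_at_topological using W \<psi> by (intro exI [of _ W]) auto
    ultimately have "deriv p a - \<psi> a * deriv q a = 0" by (rule isCont_zero_punctured)
    then show ?thesis using True by simp
  qed
  have J: "jacobian f z = (cmod (deriv q z))\<^sup>2 * ((cmod (\<psi> z))\<^sup>2 - 1)" if "z \<in> W" for z
  proof -
    have "jacobian f z = (cmod (deriv p z))\<^sup>2 - (cmod (deriv q z))\<^sup>2"
      by (rule jacobian_local [OF W(1) that hol(1,2) f])
    then show ?thesis using dp [OF that] by (simp add: norm_mult power_mult_distrib algebra_simps)
  qed
  have one: "(cmod w)\<^sup>2 - 1 = 0 \<longleftrightarrow> cmod w = 1" for w :: complex
    unfolding right_minus_eq power2_eq_1_iff using norm_ge_zero [of w] by linarith
  show \<psi>1: "cmod (\<psi> a) = 1"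
  proof (rule ccontr)
    assume ne: "cmod (\<psi> a) \<noteq> 1"
    have "continuous_on W (\<lambda>z. cmod (\<psi> z))"
      by (intro continuous_intros holomorphic_on_imp_continuous_on hol)
    then have "open (W \<inter> (\<lambda>z. cmod (\<psi> z)) -` (- {1}))"
      by (rule continuous_open_preimage [OF _ W(1)]) auto
    moreover have "a \<in> W \<inter> (\<lambda>z. cmod (\<psi> z)) -` (- {1})" using W ne by simp
    ultimately obtain z where z: "z \<in> W" "cmod (\<psi> z) \<noteq> 1" "z \<noteq> a" "z \<in> critical_set f \<Omega>"
      using curve_submanifold_not_isolated [of "critical_set f \<Omega>" a "W \<inter> (\<lambda>z. cmod (\<psi> z)) -` (- {1})"] crit
      by (auto simp: smooth_critical_point_def)
    then have "jacobian f z = 0" by (simp add: critical_set_def)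
    then have "deriv q z = 0" using J [OF z(1)] one [of "\<psi> z"] z(2) by simp
    then show False using \<psi> [of z] z by simp
  qed
  show "jacobian f z = 0 \<longleftrightarrow> cmod (\<psi> z) = 1" if z: "z \<in> W" for z
  proof (cases "z = a")
    case True
    then show ?thesis using crit \<psi>1 by (simp add: smooth_critical_point_def critical_set_def)
  next
    case False
    then show ?thesis using J [OF z] \<psi> [of z] z one [of "\<psi> z"] by simp
  qed
qed

text \<open>\<open>2 * n1 - 1\<close> is odd and within 1 of the order of \<open>A\<close>: it
  equals that order if odd, and is one of its two neighbours if even. The order being
  \<open>m\<close> or \<open>m + 1\<close>, this gives the four rows of the table.\<close>

lemma model_indices_mem:
  assumes "0 < m" "1 \<le> n1" "1 \<le> n2" "n1 + n2 = (if odd j then m else m + 1) + 1"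
    "\<bar>2 * int n1 - 1 - int (if odd j then m else m + 1)\<bar> \<le> 1"
  shows "(n1, n2) \<in> model_indices m j"
proof -
  have n2: "int n2 = int (if odd j then m else m + 1) + 1 - int n1" using assms(4) by linarith
  show ?thesis
  proof (cases "odd j")
    case True
    then have "\<bar>2 * int n1 - 1 - int m\<bar> \<le> 1" using assms(5) by simp
    then have a: "2 * int n1 - 1 - int m \<le> 1 \<and> - (2 * int n1 - 1 - int m) \<le> 1" by linarith
    show ?thesis
    proof (cases "odd m")
      case odd: True
      then have "2 * int n1 - 1 = int m" using a by presburger
      then show ?thesis using True odd n2 by (simp add: model_indices_def)
    next
      case even: False
      then have "2 * int n1 - 1 = int m + 1 \<or> 2 * int n1 - 1 = int m - 1" using a by presburger
      then show ?thesis using True even n2 by (auto simp: model_indices_def)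
    qed
  next
    case False
    then have "\<bar>2 * int n1 - 1 - int (m + 1)\<bar> \<le> 1" using assms(5) by (simp only: if_False)
    then have a: "2 * int n1 - 2 - int m \<le> 1 \<and> - (2 * int n1 - 2 - int m) \<le> 1" by linarith
    show ?thesis
    proof (cases "odd m")
      case odd: True
      then have "2 * int n1 - 1 = int m + 2 \<or> 2 * int n1 - 1 = int m" using a by presburger
      then show ?thesis using False odd n2 by (auto simp: model_indices_def)
    next
      case even: False
      then have "2 * int n1 - 1 = int m + 1" using a by presburger
      then show ?thesis using False even n2 by (auto simp: model_indices_def)
    qed
  qed
qed

lemma model_indices_unique:
  assumes "even (m + j)"
  shows "\<exists>!p. p \<in> model_indices m j"
proof -
  define n where "n = (if odd m then (m + 1) div 2 else (m + 2) div 2)"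
  have n: "2 * int n - 1 = (if odd m then int m else int m + 1)"
    unfolding n_def by (auto elim!: oddE evenE)
  have "p \<in> model_indices m j \<longleftrightarrow> p = (n, n)" for p
    using assms n by (cases p) (auto simp: model_indices_def split: if_splits)
  then show ?thesis by auto
qed

theorem theorem6p1:
  fixes f :: "complex \<Rightarrow> complex" and \<Omega> :: "complex set" and z0 :: complex
    and \<gamma> \<beta> :: "real \<Rightarrow> complex" and m j :: nat
  assumes "harmonic_map_on f \<Omega>"
    and "smooth_critical_point f \<Omega> z0"
    and "map_order f z0 = enat m"
    and "natural_parametrization f z0 \<gamma>"
    and "\<And>t. \<beta> t = f (\<gamma> t)"
    and "curve_order \<beta> 0 = enat j"
    and "has_order_pair \<beta> 0 j (j + 1)"
  shows "(\<exists>(n1, n2) \<in> model_indices m j. \<exists>U h1 g1 h2 g2.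
            open U \<and> z0 \<in> U \<and> U \<subseteq> \<Omega> \<and>
            homeomorphism U (ball 0 1) h1 g1 \<and> orientation_preserving_on U h1 \<and> h1 z0 = 0 \<and>
            homeomorphism UNIV UNIV h2 g2 \<and> orientation_preserving_on UNIV h2 \<and>
            h2 (f z0) = 0 \<and>
            (\<forall>z\<in>ball 0 1. h2 (f (g1 z)) = model_map n1 n2 z) \<and>
            (\<exists>a b. a < 0 \<and> 0 < b \<and> \<gamma> ` {a<..<b} = critical_set f \<Omega> \<inter> U \<and>
               fibre_cardinalities f U (h2 -` ball 0 1) (\<beta> ` {a<..<b}) n1 n2))
       \<and> (even (m + j) \<longrightarrow> (\<exists>!p. p \<in> model_indices m j))"
proof -
  have \<Omega>: "open \<Omega>" using assms(1) by (simp add: harmonic_map_on_def harmonic_fun_on_def)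
  have z0\<Omega>: "z0 \<in> \<Omega>" using assms(2) by (simp add: smooth_critical_point_def critical_set_def)
  obtain W' p q \<psi> \<epsilon> where W': "open W'" "z0 \<in> W'" and hol': "p holomorphic_on W'" "q holomorphic_on W'"
      "\<psi> holomorphic_on W'"
    and f': "\<And>z. z \<in> W' \<Longrightarrow> f z = p z + cnj (q z)"
    and \<psi>': "\<And>z. z \<in> W' - {z0} \<Longrightarrow> deriv q z \<noteq> 0 \<and> \<psi> z = deriv p z / deriv q z"
    and inj': "inj_on \<psi> W'" and \<epsilon>: "\<epsilon> > 0"
    and \<gamma>: "\<And>t. \<bar>t\<bar> < \<epsilon> \<Longrightarrow> \<gamma> t \<in> W' \<and> \<psi> (\<gamma> t) = \<psi> z0 * cis t"
    using assms(4) unfolding natural_parametrization_def by blast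
  define W where "W = W' \<inter> \<Omega>"
  have W: "open W" "z0 \<in> W" and sub: "W \<subseteq> W'" "W \<subseteq> \<Omega>" using W' \<Omega> z0\<Omega> by (auto simp: W_def)
  have hol: "p holomorphic_on W" "q holomorphic_on W" "\<psi> holomorphic_on W"
    by (rule holomorphic_on_subset [OF _ sub(1)], fact)+
  have f: "f z = p z + cnj (q z)" if "z \<in> W" for z using f' that sub by blast
  have \<psi>: "deriv q z \<noteq> 0 \<and> \<psi> z = deriv p z / deriv q z" if "z \<in> W - {z0}" for z using \<psi>' that sub by blast
  have inj: "inj_on \<psi> W" using inj' sub(1) by (rule inj_on_subset)
  note dich = critical_dichotomy [OF W hol f \<psi> assms(2) \<Omega>]
  have dp: "deriv p z = \<psi> z * deriv q z" if "z \<in> W" for z using dich(1) that by blast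
  have \<psi>1: "cmod (\<psi> z0) = 1" using dich(2) by blast
  have crit: "critical_set f \<Omega> \<inter> U = {z \<in> U. cmod (\<psi> z) = 1}" if "U \<subseteq> W" for U
    using dich(3) that sub by (auto simp: critical_set_def)
  have \<psi>0: "\<psi> z0 \<noteq> 0" using \<psi>1 by auto
  have m: "0 < m" "\<And>i. 0 < i \<Longrightarrow> i < m \<Longrightarrow> (deriv ^^ i) q z0 = 0"
      "(deriv ^^ m) p z0 \<noteq> 0 \<or> (deriv ^^ m) q z0 \<noteq> 0"
    using map_order_local [OF W(1) hol(1,2) f W(2) assms(3)] by blast+
  have Suc_deriv: "(deriv ^^ i) (deriv F) z = (deriv ^^ Suc i) F z" for i F and z :: complex
    by (simp only: funpow_Suc_right o_apply)
  have R: "(deriv ^^ k) (deriv q) z0 = 0" if "k < m - 1" for k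
    unfolding Suc_deriv by (rule m(2)) (use that in auto)
  have hdq: "deriv q holomorphic_on W" by (rule holomorphic_deriv [OF hol(2) W(1)])
  \<comment> \<open>The \<open>m\<close>-th derivative of \<open>p\<close> at \<open>z0\<close> is
    \<open>\<psi> z0\<close> times that of \<open>q\<close>, so neither can be nonzero without the
    other.\<close>
  have qm: "(deriv ^^ m) q z0 \<noteq> 0"
  proof
    assume 0: "(deriv ^^ m) q z0 = 0"
    have "(deriv ^^ (m - 1)) (deriv p) z0 = (deriv ^^ (m - 1)) (\<lambda>z. \<psi> z * deriv q z) z0"
      by (rule higher_deriv_transform_within_open [OF _ _ W])
         (use dp in \<open>auto intro!: holomorphic_intros holomorphic_deriv hol W\<close>)
    also have "\<dots> = \<psi> z0 * (deriv ^^ (m - 1)) (deriv q) z0"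
      by (rule leibniz_lowest(2) [OF W hol(3) hdq R])
    finally have "(deriv ^^ m) p z0 = \<psi> z0 * (deriv ^^ m) q z0"
      unfolding Suc_deriv using m(1) by simp
    then show False using 0 m(3) by simp
  qed
  \<comment> \<open>The value prescribed for \<open>T z0\<close>. Rotating the target by a unit
    \<open>e0\<close> multiplies the quotient of the two derivatives by \<open>e0\<^sup>2\<close>,
    so a square root of \<open>\<tau> / \<psi> z0\<close> achieves it.\<close>
  define \<tau> :: complex where "\<tau> = (if odd j then 1 else -1)"
  have \<tau>: "\<tau> \<noteq> 0" "cmod \<tau> = 1" by (auto simp: \<tau>_def)
  define e0 where "e0 = csqrt (\<tau> / \<psi> z0)"
  have e0: "e0\<^sup>2 * \<psi> z0 = \<tau>" using \<psi>0 by (simp add: e0_def)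
  have ce0: "cmod e0 = 1"
  proof -
    have "(cmod e0)\<^sup>2 = 1" using arg_cong [OF e0, of cmod] \<psi>1 \<tau> by (simp add: norm_mult norm_power)
    then show ?thesis unfolding power2_eq_1_iff using norm_ge_zero [of e0] by linarith
  qed
  obtain \<psi>i where \<psi>i: "\<psi>i holomorphic_on \<psi> ` W" "\<And>z. z \<in> W \<Longrightarrow> \<psi>i (\<psi> z) = z"
    using holomorphic_has_inverse [OF hol(3) W(1) inj] by metis
  have "open (\<psi> ` W)" by (rule open_mapping_thm3 [OF hol(3) W(1) inj])
  then have "open ((\<lambda>\<zeta>. \<psi> z0 * exp (\<i> * \<zeta>)) -` (\<psi> ` W))"
    by (intro continuous_open_vimage) (auto intro!: continuous_intros)
  moreover have "0 \<in> (\<lambda>\<zeta>. \<psi> z0 * exp (\<i> * \<zeta>)) -` (\<psi> ` W)" using W(2) by simp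
  ultimately obtain r0 where r0: "0 < r0" "ball 0 r0 \<subseteq> (\<lambda>\<zeta>. \<psi> z0 * exp (\<i> * \<zeta>)) -` (\<psi> ` W)"
    using openE by blast
  define r where "r = min r0 \<epsilon>"
  have r: "0 < r" "r \<le> r0" "r \<le> \<epsilon>" using r0 \<epsilon> by (auto simp: r_def)
  \<comment> \<open>The holomorphic extension of \<open>\<gamma>\<close> to complex times.\<close>
  define gh where "gh \<zeta> = \<psi>i (\<psi> z0 * exp (\<i> * \<zeta>))" for \<zeta>
  have gh: "gh \<zeta> \<in> W" "\<psi> (gh \<zeta>) = \<psi> z0 * exp (\<i> * \<zeta>)" if "\<zeta> \<in> ball 0 r" for \<zeta>
  proof -
    have "\<zeta> \<in> ball 0 r0" using that r by auto
    then have "\<psi> z0 * exp (\<i> * \<zeta>) \<in> \<psi> ` W" using r0 by blast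
    then obtain z where "z \<in> W" "\<psi> z0 * exp (\<i> * \<zeta>) = \<psi> z" by blast
    then show "gh \<zeta> \<in> W" "\<psi> (gh \<zeta>) = \<psi> z0 * exp (\<i> * \<zeta>)" using \<psi>i(2) by (auto simp: gh_def)
  qed
  have hol_gh: "gh holomorphic_on ball 0 r"
  proof -
    have "(\<lambda>\<zeta>. \<psi> z0 * exp (\<i> * \<zeta>)) holomorphic_on ball 0 r" by (intro holomorphic_intros)
    moreover have "(\<lambda>\<zeta>. \<psi> z0 * exp (\<i> * \<zeta>)) ` ball 0 r \<subseteq> \<psi> ` W"
    proof clarify
      fix \<zeta> :: complex assume "\<zeta> \<in> ball 0 r"
      then have "\<zeta> \<in> ball 0 r0" using r by simp
      then show "\<psi> z0 * exp (\<i> * \<zeta>) \<in> \<psi> ` W" using r0(2) by blast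
    qed
    ultimately have "(\<psi>i \<circ> (\<lambda>\<zeta>. \<psi> z0 * exp (\<i> * \<zeta>))) holomorphic_on ball 0 r"
      using holomorphic_on_compose_gen [OF _ \<psi>i(1)] by blast
    then show ?thesis by (simp add: o_def gh_def [abs_def])
  qed
  have \<gamma>_eq: "z = \<gamma> t" if "z \<in> W" "\<psi> z = \<psi> z0 * cis t" "\<bar>t\<bar> < r" for z t
  proof -
    have "\<bar>t\<bar> < \<epsilon>" using that r by simp
    from \<gamma> [OF this] show ?thesis using inj_onD [OF inj', of z "\<gamma> t"] that sub by auto
  qed
  have gh_\<gamma>: "gh (of_real t) = \<gamma> t" if "\<bar>t\<bar> < r" for t
    by (rule \<gamma>_eq) (use gh [of "of_real t"] that in \<open>auto simp: cis_conv_exp\<close>)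
  \<comment> \<open>Conjugating the time inside the conjugated summand makes it holomorphic without
    changing it at real times; so \<open>G\<close> extends \<open>\<beta>\<close>
    holomorphically.\<close>
  define G where "G \<zeta> = p (gh \<zeta>) + cnj (q (gh (cnj \<zeta>)))" for \<zeta>
  have holc: "(\<lambda>\<zeta>. F (gh \<zeta>)) holomorphic_on ball 0 r" if "F holomorphic_on W" for F
    using holomorphic_on_compose_gen [OF hol_gh that] gh(1) by (auto simp: o_def image_subset_iff)
  have hol_qc: "(\<lambda>\<zeta>. cnj (q (gh (cnj \<zeta>)))) holomorphic_on ball 0 r"
  proof -
    have "(\<lambda>\<zeta>. q (gh \<zeta>)) holomorphic_on cnj ` ball 0 r"
      by (rule holomorphic_on_subset [OF holc [OF hol(2)]]) auto
    then have "(cnj \<circ> (\<lambda>\<zeta>. q (gh \<zeta>)) \<circ> cnj) holomorphic_on ball 0 r"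
      by (rule holomorphic_on_compose_cnj_cnj) auto
    then show ?thesis by (simp add: o_def)
  qed
  have hol_G: "G holomorphic_on ball 0 r"
    unfolding G_def by (intro holomorphic_on_add holc [OF hol(1)] hol_qc)
  have \<beta>_G: "\<beta> t = G (of_real t)" if "\<bar>t\<bar> < r" for t
  proof -
    have "\<gamma> t \<in> W" using gh(1) [of "of_real t"] gh_\<gamma> [OF that] that by simp
    then show ?thesis using assms(5) [of t] f gh_\<gamma> [OF that] by (simp add: G_def)
  qed
  have j: "0 < j" "\<And>i. 0 < i \<Longrightarrow> i < j \<Longrightarrow> (deriv ^^ i) G 0 = 0" "(deriv ^^ j) G 0 \<noteq> 0"
    using curve_order_holomorphic [OF r(1) hol_G \<beta>_G assms(6)] by blast+
  have dir: "\<exists>y. e0 * deriv G (of_real t) = (if odd j then 1 else -1) * cis t * y + cnj y" if t: "\<bar>t\<bar> < r" for t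
  proof -
    have tb: "complex_of_real t \<in> ball 0 r" using t by simp
    let ?z = "gh (of_real t)"
    have z: "?z \<in> W" by (rule gh(1) [OF tb])
    have chain: "((\<lambda>\<zeta>. F (gh \<zeta>)) has_field_derivative deriv F ?z * deriv gh (of_real t)) (at (of_real t))"
      if "F holomorphic_on W" for F
      by (rule DERIV_chain2 [OF holomorphic_derivI [OF that W(1) z] holomorphic_derivI [OF hol_gh open_ball tb]])
    have "((\<lambda>\<zeta>. cnj (q (gh (cnj \<zeta>)))) has_field_derivative cnj (deriv q ?z * deriv gh (of_real t))) (at (of_real t))"
      using has_field_derivative_cnj_cnj [of "\<lambda>\<zeta>. q (gh \<zeta>)" "deriv q ?z * deriv gh (of_real t)" "of_real t"] chain [OF hol(2)] by (simp add: o_def)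
    with chain [OF hol(1)] have "(G has_field_derivative
        deriv p ?z * deriv gh (of_real t) + cnj (deriv q ?z * deriv gh (of_real t))) (at (of_real t))"
      unfolding G_def by (rule DERIV_add)
    then have dG: "deriv G (of_real t) = \<psi> ?z * (deriv q ?z * deriv gh (of_real t)) + cnj (deriv q ?z * deriv gh (of_real t))"
      using dp [OF z] by (simp add: DERIV_imp_deriv mult.assoc)
    define d where "d = deriv q ?z * deriv gh (of_real t)"
    have \<psi>z: "\<psi> ?z = \<psi> z0 * cis t" using gh(2) [OF tb] by (simp add: cis_conv_exp)
    have ee: "e0 * cnj e0 = 1" using ce0 by (simp add: complex_norm_square [symmetric])
    \<comment> \<open>The witness for \<open>dir\<close> is \<open>cnj e0 * d\<close>; both
      \<open>e0\<^sup>2 * \<psi> z0 = \<tau>\<close> and \<open>e0 * cnj e0 = 1\<close>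
      enter.\<close>
    have "\<tau> * cis t * (cnj e0 * d) + cnj (cnj e0 * d) = e0 * (e0 * cnj e0) * \<psi> z0 * cis t * d + e0 * cnj d"
      unfolding e0 [symmetric] by (simp add: power2_eq_square mult_ac)
    also have "\<dots> = e0 * deriv G (of_real t)"
      unfolding dG d_def [symmetric] \<psi>z ee by (simp add: algebra_simps)
    finally show ?thesis unfolding \<tau>_def by metis
  qed
  have e0nz: "e0 \<noteq> 0" using ce0 by auto
  obtain s \<delta> :: real where s: "s = 1 \<or> s = -1" and \<delta>: "0 < \<delta>" "\<delta> \<le> r"
    and mono: "\<And>t t'. - \<delta> < t \<Longrightarrow> t < t' \<Longrightarrow> t' < \<delta> \<Longrightarrow> s * Re (e0 * G (of_real t)) < s * Re (e0 * G (of_real t'))"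
    by (rule critical_values_strict_mono [OF r(1) hol_G j e0nz dir]) auto
  \<comment> \<open>Of the square roots \<open>e0\<close> and \<open>- e0\<close>, this one makes
    the real part of the curve decrease in \<open>t\<close>. The coordinate \<open>eta\<close> runs
    along the critical curve as \<open>- t\<close>, so the real part increases with it.\<close>
  define e where "e = of_real (- s) * e0"
  have e: "e\<^sup>2 * \<psi> z0 = \<tau>" "cmod e = 1" "e \<noteq> 0"
    using s e0 ce0 e0nz by (auto simp: e_def power_mult_distrib norm_mult)
  have ee: "e * cnj e = 1" using e(2) by (simp add: complex_norm_square [symmetric])
  define P where "P z = e * (p z - p z0)" for z
  define Q where "Q z = cnj e * (q z - q z0)" for z
  define T where "T z = e\<^sup>2 * \<psi> z" for z
  have holPQT: "P holomorphic_on W" "Q holomorphic_on W" "T holomorphic_on W"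
    unfolding P_def Q_def T_def by (intro holomorphic_intros hol)+
  have T0: "T z0 = \<tau>" by (simp add: T_def e)
  have cT: "cmod (T z) = cmod (\<psi> z)" for z by (simp add: T_def norm_mult norm_power e)
  have dPQ: "deriv P z = e * deriv p z" "deriv Q z = cnj e * deriv q z" if "z \<in> W" for z
  proof -
    have fd: "p field_differentiable at z" "q field_differentiable at z"
      using hol W that holomorphic_on_imp_differentiable_at by blast+
    show "deriv P z = e * deriv p z" "deriv Q z = cnj e * deriv q z"
      unfolding P_def Q_def using fd by (simp_all add: field_differentiable_diff)
  qed
  have dP: "deriv P z = T z * deriv Q z" if "z \<in> W" for z
  proof -
    have "T z * deriv Q z = e * (e * cnj e) * \<psi> z * deriv q z"
      by (simp add: T_def dPQ [OF that] power2_eq_square mult_ac)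
    also have "\<dots> = deriv P z" unfolding ee dPQ(1) [OF that] dp [OF that] by simp
    finally show ?thesis ..
  qed
  have injT: "inj_on T W"
    using inj e(3) by (auto simp: inj_on_def T_def)
  have F: "P z + cnj (Q z) = e * (f z - f z0)" if "z \<in> W" for z
    using f [OF that] f [OF W(2)] by (simp add: P_def Q_def algebra_simps)
  have T_\<psi>: "T z = T z0 * cis x \<longleftrightarrow> \<psi> z = \<psi> z0 * cis x" for z x
    using e(3) by (auto simp: T_def)
  define M where "M = (if odd j then m else m + 1)"
  have dA: "(deriv ^^ Suc i) (\<lambda>z. P z + Q z) z0 = (deriv ^^ i) (\<lambda>z. (1 + T z) * deriv Q z) z0" for i
  proof -
    have "deriv (\<lambda>z. P z + Q z) z = (1 + T z) * deriv Q z" if "z \<in> W" for z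
    proof -
      have "P field_differentiable at z" "Q field_differentiable at z"
        using holPQT W that holomorphic_on_imp_differentiable_at by blast+
      then show ?thesis using dP [OF that] by (simp add: algebra_simps)
    qed
    then have "(deriv ^^ i) (deriv (\<lambda>z. P z + Q z)) z0 = (deriv ^^ i) (\<lambda>z. (1 + T z) * deriv Q z) z0"
      by (intro higher_deriv_transform_within_open [OF _ _ W])
         (auto intro!: holomorphic_intros holomorphic_deriv holPQT W)
    then show ?thesis unfolding Suc_deriv .
  qed
  have dQ: "(deriv ^^ k) (deriv Q) z0 = cnj e * (deriv ^^ Suc k) q z0" for k
  proof -
    have "(deriv ^^ k) (deriv Q) z0 = (deriv ^^ k) (\<lambda>z. cnj e * deriv q z) z0"
      by (rule higher_deriv_transform_within_open [OF _ _ W])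
         (use dPQ in \<open>auto intro!: holomorphic_intros holomorphic_deriv holPQT hol W\<close>)
    also have "\<dots> = cnj e * (deriv ^^ k) (deriv q) z0"
      by (rule higher_deriv_cmult [OF hdq W(2) W(1)])
    finally show ?thesis unfolding Suc_deriv .
  qed
  have RQ: "(deriv ^^ k) (deriv Q) z0 = 0" if "k < m - 1" for k
    unfolding dQ using m(2) [of "Suc k"] that by simp
  have RQm: "(deriv ^^ (m - 1)) (deriv Q) z0 \<noteq> 0"
    unfolding dQ using qm m(1) e(3) by simp
  have holS: "(\<lambda>z. 1 + T z) holomorphic_on W" by (intro holomorphic_intros holPQT)
  have hdQ: "deriv Q holomorphic_on W" by (rule holomorphic_deriv [OF holPQT(2) W(1)])
  have leib: "(deriv ^^ (m - 1)) (\<lambda>z. (1 + T z) * deriv Q z) z0 = (1 + T z0) * (deriv ^^ (m - 1)) (deriv Q) z0"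
    by (rule leibniz_lowest(2) [OF W holS hdQ RQ])
  have leib_Suc: "(deriv ^^ Suc (m - 1)) (\<lambda>z. (1 + T z) * deriv Q z) z0 =
      of_nat (Suc (m - 1)) * deriv (\<lambda>z. 1 + T z) z0 * (deriv ^^ (m - 1)) (deriv Q) z0" if "1 + T z0 = 0"
    by (rule leibniz_lowest(3) [OF W holS hdQ RQ that])
  have dT: "deriv (\<lambda>z. 1 + T z) z0 \<noteq> 0"
    by (rule holomorphic_injective_imp_regular [OF holS W(1) _ W(2)]) (use injT in \<open>auto simp: inj_on_def\<close>)
  have M: "0 < M" "(deriv ^^ M) (\<lambda>z. P z + Q z) z0 \<noteq> 0"
      "\<And>i. 0 < i \<Longrightarrow> i < M \<Longrightarrow> (deriv ^^ i) (\<lambda>z. P z + Q z) z0 = 0"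
  proof -
    show "0 < M" using m(1) by (simp add: M_def)
    show "(deriv ^^ M) (\<lambda>z. P z + Q z) z0 \<noteq> 0"
    proof (cases "odd j")
      case True
      then have "M = Suc (m - 1)" using m(1) by (simp add: M_def)
      then have "(deriv ^^ M) (\<lambda>z. P z + Q z) z0 = (1 + T z0) * (deriv ^^ (m - 1)) (deriv Q) z0"
        by (simp only: dA leib)
      then show ?thesis using RQm T0 True by (simp add: \<tau>_def)
    next
      case False
      then have "M = Suc (Suc (m - 1))" using m(1) by (simp add: M_def)
      moreover have "1 + T z0 = 0" using T0 False by (simp add: \<tau>_def)
      ultimately have "(deriv ^^ M) (\<lambda>z. P z + Q z) z0 =
          of_nat (Suc (m - 1)) * deriv (\<lambda>z. 1 + T z) z0 * (deriv ^^ (m - 1)) (deriv Q) z0"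
        by (simp only: dA leib_Suc)
      moreover have "complex_of_nat (Suc (m - 1)) \<noteq> 0" by (rule of_nat_neq_0)
      ultimately show ?thesis using RQm dT by (simp only: mult_eq_0_iff) simp
    qed
    show "(deriv ^^ i) (\<lambda>z. P z + Q z) z0 = 0" if i: "0 < i" "i < M" for i
    proof -
      have iS: "(deriv ^^ i) (\<lambda>z. P z + Q z) z0 = (deriv ^^ (i - 1)) (\<lambda>z. (1 + T z) * deriv Q z) z0"
        using dA [of "i - 1"] i(1) by simp
      have "i < (if odd j then m else m + 1)" using i(2) by (simp add: M_def)
      then consider "i - 1 < m - 1" | "\<not> odd j" "i - 1 = m - 1"
        using i(1) m(1) by (cases "i < m") (auto split: if_splits)
      then show ?thesis
      proof cases
        case 1 then show ?thesis
          unfolding iS by (intro leibniz_lowest(1) [where n = "m - 1", OF W holS hdQ] RQ)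
      next
        case 2
        then have "1 + T z0 = 0" using T0 by (simp add: \<tau>_def)
        then show ?thesis unfolding iS 2(2) using leib by simp
      qed
    qed
  qed
  have monoPQ: "Re (P z + Q z) < Re (P w + Q w)"
    if zw: "z \<in> W" "w \<in> W" "T z = T z0 * cis (- x)" "T w = T z0 * cis (- y)" "- \<delta> < x" "x < y" "y < \<delta>"
    for z w x y
  proof -
    have Re_eq: "Re (P v + Q v) = Re (e * G (of_real (- u))) - Re (e * f z0)"
      if v: "v \<in> W" "T v = T z0 * cis (- u)" "\<bar>u\<bar> < \<delta>" for v u
    proof -
      have u: "\<bar>- u\<bar> < r" using v(3) \<delta>(2) by simp
      have "v = \<gamma> (- u)" using \<gamma>_eq [OF v(1) _ u] v(2) T_\<psi> by blast
      then have "f v = G (of_real (- u))" using \<beta>_G [OF u] assms(5) by simp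
      moreover have "Re (P v + Q v) = Re (P v + cnj (Q v))" by simp
      ultimately show ?thesis using F [OF v(1)] by (simp add: right_diff_distrib)
    qed
    have "s * Re (e0 * G (of_real (- y))) < s * Re (e0 * G (of_real (- x)))" by (rule mono) (use zw in auto)
    then have "Re (e * G (of_real (- x))) < Re (e * G (of_real (- y)))"
      unfolding e_def mult.assoc Re_complex_of_real by simp
    moreover have "\<bar>x\<bar> < \<delta>" "\<bar>y\<bar> < \<delta>" using zw by auto
    ultimately show ?thesis using Re_eq [OF zw(1,3)] Re_eq [OF zw(2,4)] by simp
  qed
  have PQ0: "P z0 = 0" "Q z0 = 0" by (simp_all add: P_def Q_def)
  have cT0: "cmod (T z0) = 1" using T0 \<tau> by simp
  obtain n1 n2 :: nat and c :: "real \<Rightarrow> real" and \<rho> a b :: real and U h where af: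
    "1 \<le> n1" "1 \<le> n2" "n1 + n2 = M + 1" "\<bar>2 * int n1 - 1 - int M\<bar> \<le> 1"
    "continuous_on UNIV c" "c 0 = 0" "0 < \<rho>"
    "open U" "z0 \<in> U" "U \<subseteq> W" "continuous_on U h" "inj_on h U" "h ` U = ball 0 1" "h z0 = 0"
    "orientation_preserving_on U h"
    "\<And>z. z \<in> U \<Longrightarrow> shear c (P z + cnj (Q z)) / of_real \<rho> = model_map n1 n2 (h z)"
    "\<And>z. z \<in> U \<Longrightarrow> Im (h z) = 0 \<longleftrightarrow> cmod (T z) = 1"
    "a < 0" "0 < b"
    "\<And>z. z \<in> U \<Longrightarrow> cmod (T z) = 1 \<Longrightarrow> \<exists>x. a < x \<and> x < b \<and> T z = T z0 * cis (- x)"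
    "\<And>x. a < x \<Longrightarrow> x < b \<Longrightarrow> \<bar>x\<bar> < \<delta> \<and> (\<exists>z\<in>U. T z = T z0 * cis (- x))"
    by (rule analytic_fold [OF W holPQT PQ0 dP injT cT0 M \<delta>(1) monoPQ]) blast+
  obtain g1 where hom1: "homeomorphism U (ball 0 1) h g1"
    using invariance_of_domain_homeomorphism [OF af(8,11) _ af(12)] af(13) by auto
  define h2 where "h2 w = shear c (e * (w - f z0)) / of_real \<rho>" for w
  obtain g2 where h2: "homeomorphism UNIV UNIV h2 g2" "orientation_preserving_on UNIV h2" "h2 (f z0) = 0"
    unfolding h2_def [abs_def] by (rule shear_homeomorphism [OF af(5,6) e(3) af(7)])
  have h2f: "h2 (f z) = model_map n1 n2 (h z)" if "z \<in> U" for z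
    using af(16) [OF that] F [of z] af(10) that by (auto simp: h2_def)
  have g1: "g1 z \<in> U" "h (g1 z) = z" if "z \<in> ball 0 1" for z
    using hom1 that by (auto simp: homeomorphism_def)
  have model: "\<forall>z\<in>ball 0 1. h2 (f (g1 z)) = model_map n1 n2 z"
    using h2f g1 by simp
  \<comment> \<open>The interval is reflected because the parameter \<open>x\<close> of
    \<open>analytic_fold\<close> is \<open>- t\<close>. The bound by \<open>\<delta>\<close> lets
    injectivity of \<open>\<psi>\<close> identify a point having the value
    \<open>\<psi> z0 * cis t\<close> with \<open>\<gamma> t\<close>.\<close>
  have curve: "\<gamma> ` {- b<..<- a} = {z \<in> U. cmod (T z) = 1}"
  proof (intro equalityI subsetI)
    fix z assume "z \<in> \<gamma> ` {- b<..<- a}"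
    then obtain t where t: "- b < t" "t < - a" "z = \<gamma> t" by auto
    then have tt: "a < - t" "- t < b" by auto
    obtain w where w: "w \<in> U" "T w = T z0 * cis (- (- t))" and "\<bar>- t\<bar> < \<delta>" using af(21) [OF tt] by blast
    then have "w = \<gamma> t" using \<gamma>_eq [of w t] af(10) T_\<psi> \<delta>(2) by auto
    moreover have "cmod (T w) = 1" unfolding w(2) norm_mult cT0 by simp
    ultimately show "z \<in> {z \<in> U. cmod (T z) = 1}" using w t by simp
  next
    fix z assume z: "z \<in> {z \<in> U. cmod (T z) = 1}"
    then obtain x where x: "a < x" "x < b" "T z = T z0 * cis (- x)" using af(20) by blast
    then have "\<bar>x\<bar> < \<delta>" using af(21) by blast
    then have "z = \<gamma> (- x)" using \<gamma>_eq [of z "- x"] z af(10) x(3) T_\<psi> \<delta>(2) by auto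
    then show "z \<in> \<gamma> ` {- b<..<- a}" using x by auto
  qed
  have crit_U: "\<gamma> ` {- b<..<- a} = critical_set f \<Omega> \<inter> U"
    unfolding curve crit [OF af(10)] cT ..
  \<comment> \<open>The model map fixes the real diameter pointwise, and \<open>h\<close> takes the
    critical points in \<open>U\<close> exactly onto it.\<close>
  have \<beta>_img: "\<beta> ` {- b<..<- a} = h2 -` {w \<in> ball 0 1. Im w = 0}"
  proof -
    have "\<beta> ` {- b<..<- a} = f ` {z \<in> U. cmod (T z) = 1}"
      unfolding curve [symmetric] image_image assms(5) ..
    also have "\<dots> = h2 -` {w \<in> ball 0 1. Im w = 0}"
    proof (intro equalityI subsetI)
      fix v assume "v \<in> f ` {z \<in> U. cmod (T z) = 1}"
      then obtain z where z: "z \<in> U" "cmod (T z) = 1" "v = f z" by blast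
      then have "Im (h z) = 0" "h z \<in> ball 0 1" using af(17) af(13) by auto
      then show "v \<in> h2 -` {w \<in> ball 0 1. Im w = 0}"
        using h2f [OF z(1)] model_map_real [OF _ af(1)] z(3) by simp
    next
      fix v assume v: "v \<in> h2 -` {w \<in> ball 0 1. Im w = 0}"
      define z where "z = g1 (h2 v)"
      have z: "z \<in> U" "h z = h2 v" using g1 [of "h2 v"] v by (auto simp: z_def)
      then have "cmod (T z) = 1" using af(17) [OF z(1)] v by simp
      moreover have "h2 (f z) = h2 v" using h2f [OF z(1)] z(2) model_map_real [OF _ af(1)] v by simp
      then have "f z = v" using h2(1) by (metis homeomorphism_apply1 UNIV_I)
      ultimately show "v \<in> f ` {z \<in> U. cmod (T z) = 1}" using z by blast
    qed
    finally show ?thesis .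
  qed
  have fib: "fibre_cardinalities f U (h2 -` ball 0 1) (\<beta> ` {- b<..<- a}) n1 n2"
    by (rule fibre_cardinalities_model [OF af(1,2) hom1 h2(1) model \<beta>_img])
  have mem: "(n1, n2) \<in> model_indices m j"
    by (rule model_indices_mem [OF m(1) af(1,2)]) (use af(3,4) in \<open>simp_all only: M_def\<close>)
  have "- b < 0" "0 < - a" using af(18,19) by auto
  then have arc: "\<exists>a b. a < 0 \<and> 0 < b \<and> \<gamma> ` {a<..<b} = critical_set f \<Omega> \<inter> U \<and>
               fibre_cardinalities f U (h2 -` ball 0 1) (\<beta> ` {a<..<b}) n1 n2"
    using crit_U fib by blast
  have U\<Omega>: "U \<subseteq> \<Omega>" using af(10) sub(2) by (rule order_trans)
  show ?thesis
    by (rule conjI, rule bexI [OF _ mem], unfold prod.case,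
        rule exI [of _ U], rule exI [of _ h], rule exI [of _ g1], rule exI [of _ h2], rule exI [of _ g2],
        intro conjI af(8,9,14,15) U\<Omega> hom1 h2 model arc)
       (intro impI model_indices_unique)
qed

end
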